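(* Let $\Theta$ be a lattice congruence on the weak order on $B_n$. The following are equivalent: (i) $\Theta$ is the restriction of a lattice congruence on the weak order on $S_{2n}$; (ii) $\Theta$ is the restriction of a symmetric lattice congruence on the weak order on $S_{2n}$; (iii) the set of type-B arcs corresponding to join-irreducible signed permutations not contracted by $\Theta$ is closed under passing to loose subarcs.
   Context: $S_{2n}$ is the group of permutations of $\{\pm1,\ldots,\pm n\}$, written $\pi_{-n}\cdots\pi_{-1}\pi_1\cdots\pi_n$ (positions ordered $-n<\cdots<-1<1<\cdots<n$), with the weak order (inclusion of inversion sets), a lattice; $B_n\subseteq S_{2n}$ is the set of signed permutations ($\pi(-i)=-\pi(i)$), which forms a sublattice, whose induced order is the weak order on $B_n$. The restriction of a congruence on $S_{2n}$ to $B_n$ is the induced equivalence relation on $B_n$. With $w_0$ the longest element of $S_{2n}$, $w_0\pi w_0=(-\pi_n)\cdots(-\pi_1)(-\pi_{-1})\cdots(-\pi_{-n})$; a congruence on $S_{2n}$ is symmetric if $\pi\equiv\tau$ iff $w_0\pi w_0\equiv w_0\tau w_0$. A lattice congruence is an equivalence relation compatible with $\wedge,\vee$; it contracts a join-irreducible $j$ (covering exactly one element $j_*$) if $j\equiv j_*$. Type-B arcs: in the orbifold plane $\mathbb R^2/(x\sim-x)$ (open upper half-plane plus one semicircle point, the closed lower semicircle of radius $r$, for each $r\ge0$; $r=0$ is the orbifold point $\times$), numbered points $1,\ldots,n$ lie above $\times$ on the vertical axis. Up to combinatorial equivalence: an ordinary arc goes monotone downward from numbered $q$ to numbered $p<q$;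 an orbifold arc goes monotone downward from numbered $p$ to $\times$; a long arc contains exactly one semicircle point, not $\times$, with disjoint left piece descending from its left endpoint $p$ and right piece from its right endpoint $q\ne p$. For ordinary/orbifold $\alpha$ with endpoints $p<q$ ($\times=0$), $L(\alpha),R(\alpha)$ are the numbered points strictly between lying left/right of $\alpha$; for long $\alpha$, $L(\alpha)$ = points in $(0,p)$ left of the left piece and $R(\alpha)$ = points in $(0,q)$ right of the right piece, and the other points of $(0,\min(p,q))$ lie between the pieces. Join-irreducibles $j$ of $B_n$ correspond bijectively to type-B arcs: the arc corresponding to $j$ is the image, under identifying $x$ with $-x$ (points below the horizontal axis sent to their negatives, points on the axis to semicircle points), of the symmetric arc or symmetric pair formed by the arcs of $\delta(j)$, where $\delta(\pi)$ has, for each consecutive positions $a,b$ with $\pi_a>\pi_b$, an arc from $\pi_a$ down to $\pi_b$ on points labeled $-n,\ldots,n$, passing right of each $\pi_c$ with $\pi_b<\pi_c<\pi_a$, $c$ before $a$, and left of such $\pi_c$ with $c$ after $b$. Subarcs: If $\alpha$ is ordinary or orbifold with endpoints $p<q$ ($\times=0$), a subarc is an arc $\alpha'$ with endpoints $p\le p'<q'\le q$ and $R(\alpha')=R(\alpha)\cap(p',q')$ (ordinary unless $p'=0$, then orbifold). If $\alpha$ is long with left endpoint $p$, right endpoint $q$: an ordinary $\alpha'$ with endpoints $p'<q'$ is a subarc iff either $q'\le p$ and $L(\alpha')=L(\alpha)\cap(p',q')$, or $q'\le q$ and $R(\alpha')=R(\alpha)\cap(p',q')$; an orbifold $\alpha'$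 with upper endpoint $p'$ is a subarc iff $p'\le\min(p,q)$, $L(\alpha')=L(\alpha)\cap(0,p')$, $R(\alpha')=R(\alpha)\cap(0,p')$; a long $\alpha'$ with left endpoint $p'$ and right endpoint $q'$ is a subarc iff $p'\le p$, $q'\le q$, $L(\alpha')=L(\alpha)\cap(0,p')$, $R(\alpha')=R(\alpha)\cap(0,q')$, $p'\notin R(\alpha)$, $q'\notin L(\alpha)$. Loose subarcs: $\alpha'$ is a loose subarc of $\alpha$ iff either $\alpha'$ is a subarc of $\alpha$; or $\alpha$ is an orbifold arc and $\alpha'$ is a long arc with left endpoint $p'$ and right endpoint $q'$ such that $L(\alpha')=L(\alpha)\cap(0,p')$ and $R(\alpha')=R(\alpha)\cap(0,q')$; or $\alpha$ is a long arc with left endpoint $p$ and right endpoint $q$ and $\alpha'$ is a long arc with left endpoint $p'$ and right endpoint $q'$ with $p'\le q$, $q'\le p$, $L(\alpha')=(0,p')\setminus R(\alpha)$, $R(\alpha')=(0,q')\setminus L(\alpha)$, and no numbered points between the two pieces of $\alpha'$. (Intervals denote sets of numbered points.)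
   Formalization: In the definition of loose subarc, a long arc that is a loose subarc of an orbifold arc is additionally required to have both endpoints p', q' at most the upper endpoint of the orbifold arc; without this bound the equivalence fails, e.g. for n = 2. *)

theory Defs
  imports "HOL-Algebra.Lattice" "HOL-Combinatorics.Permutations"
begin

section \<open>Lattice congruences\<close>

definition lattice_congruence :: "'a gorder \<Rightarrow> 'a rel \<Rightarrow> bool" where
  "lattice_congruence L \<Theta> \<longleftrightarrow>
     equiv (carrier L) \<Theta> \<and>
     (\<forall>x x' y y'. (x, x') \<in> \<Theta> \<longrightarrow> (y, y') \<in> \<Theta> \<longrightarrow>
        (x \<sqinter>\<^bsub>L\<^esub> y, x' \<sqinter>\<^bsub>L\<^esub> y') \<in> \<Theta> \<and> (x \<squnion>\<^bsub>L\<^esub> y, x' \<squnion>\<^bsub>L\<^esub> y') \<in> \<Theta>)"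

definition covers :: "'a gorder \<Rightarrow> 'a \<Rightarrow> 'a \<Rightarrow> bool" where
  "covers L y x \<longleftrightarrow>
     x \<in> carrier L \<and> y \<in> carrier L \<and> x \<sqsubset>\<^bsub>L\<^esub> y \<and>
     \<not> (\<exists>z \<in> carrier L. x \<sqsubset>\<^bsub>L\<^esub> z \<and> z \<sqsubset>\<^bsub>L\<^esub> y)"

definition join_irreducible :: "'a gorder \<Rightarrow> 'a \<Rightarrow> bool" where
  "join_irreducible L j \<longleftrightarrow> j \<in> carrier L \<and> (\<exists>!x. covers L j x)"

text \<open>Meaningful for join-irreducible \<open>j\<close>, where the description is \<open>j\<^sub>*\<close>.\<close>
definition contracts :: "'a gorder \<Rightarrow> 'a rel \<Rightarrow> 'a \<Rightarrow> bool" where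
  "contracts L \<Theta> j \<longleftrightarrow> (j, (THE x. covers L j x)) \<in> \<Theta>"

definition restriction :: "'a rel \<Rightarrow> 'a set \<Rightarrow> 'a rel" where
  "restriction \<Phi> X = \<Phi> \<inter> X \<times> X"


section \<open>Permutations and signed permutations\<close>

definition pm :: "nat \<Rightarrow> int set" where
  "pm n = {- int n..int n} - {0}"

definition S2n :: "nat \<Rightarrow> (int \<Rightarrow> int) set" where
  "S2n n = {\<pi>. \<pi> permutes pm n}"

definition Bn :: "nat \<Rightarrow> (int \<Rightarrow> int) set" where
  "Bn n = {\<pi> \<in> S2n n. \<forall>i \<in> pm n. \<pi> (- i) = - \<pi> i}"

text \<open>An inversion is recorded as a pair of values (not of positions), so that going down in
  the weak order along a cover exchanges the entries in two consecutive positions.\<close>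
definition inversions :: "nat \<Rightarrow> (int \<Rightarrow> int) \<Rightarrow> (int \<times> int) set" where
  "inversions n \<pi> = {(\<pi> i, \<pi> j) | i j. i \<in> pm n \<and> j \<in> pm n \<and> i < j \<and> \<pi> i > \<pi> j}"

definition weak_order_on :: "nat \<Rightarrow> (int \<Rightarrow> int) set \<Rightarrow> (int \<Rightarrow> int) gorder" where
  "weak_order_on n X =
     \<lparr>carrier = X, eq = (=), le = (\<lambda>\<sigma> \<tau>. inversions n \<sigma> \<subseteq> inversions n \<tau>)\<rparr>"

abbreviation weak_S2n :: "nat \<Rightarrow> (int \<Rightarrow> int) gorder" where
  "weak_S2n n \<equiv> weak_order_on n (S2n n)"

abbreviation weak_Bn :: "nat \<Rightarrow> (int \<Rightarrow> int) gorder" where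
  "weak_Bn n \<equiv> weak_order_on n (Bn n)"

text \<open>The longest element: every pair of positions is inverted.\<close>
definition w0 :: "nat \<Rightarrow> int \<Rightarrow> int" where
  "w0 n i = (if i \<in> pm n then - i else i)"

definition symmetric_congruence :: "nat \<Rightarrow> (int \<Rightarrow> int) rel \<Rightarrow> bool" where
  "symmetric_congruence n \<Phi> \<longleftrightarrow>
     lattice_congruence (weak_S2n n) \<Phi> \<and>
     (\<forall>\<pi> \<in> S2n n. \<forall>\<tau> \<in> S2n n.
        (\<pi>, \<tau>) \<in> \<Phi> \<longleftrightarrow> (w0 n \<circ> \<pi> \<circ> w0 n, w0 n \<circ> \<tau> \<circ> w0 n) \<in> \<Phi>)"


section \<open>The arcs of a permutation\<close>

text \<open>\<open>Arc q p L R\<close> is the combinatorial equivalence class of an arc going down from the point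
  \<open>q\<close> to the point \<open>p\<close>. Here and in the type-B arcs below, \<open>L\<close> and \<open>R\<close> are the sets of
  points to the left and to the right of the arc; thus the arc passes to the right of the
  points in \<open>L\<close>.\<close>
datatype arc = Arc (upper_end: int) (lower_end: int) (left_pts: "int set") (right_pts: "int set")

definition consecutive :: "nat \<Rightarrow> int \<Rightarrow> int \<Rightarrow> bool" where
  "consecutive n a b \<longleftrightarrow> a \<in> pm n \<and> b \<in> pm n \<and> a < b \<and> \<not> (\<exists>c \<in> pm n. a < c \<and> c < b)"

definition delta :: "nat \<Rightarrow> (int \<Rightarrow> int) \<Rightarrow> arc set" where
  "delta n \<pi> =
     {Arc (\<pi> a) (\<pi> b)
        {\<pi> c | c. c \<in> pm n \<and> \<pi> b < \<pi> c \<and> \<pi> c < \<pi> a \<and> c < a}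
        {\<pi> c | c. c \<in> pm n \<and> \<pi> b < \<pi> c \<and> \<pi> c < \<pi> a \<and> b < c}
      | a b. consecutive n a b \<and> \<pi> a > \<pi> b}"

text \<open>The image of an arc under the half-turn \<open>x \<mapsto> -x\<close> of the plane, which exchanges left and
  right.\<close>
fun half_turn :: "arc \<Rightarrow> arc" where
  "half_turn (Arc q p L R) = Arc (- p) (- q) (uminus ` R) (uminus ` L)"


section \<open>Type-B arcs\<close>

text \<open>Combinatorial equivalence classes of type-B arcs. \<open>Ordinary p q L R\<close> has lower endpoint
  \<open>p\<close> and upper endpoint \<open>q\<close>, \<open>Orbifold p L R\<close> goes down from \<open>p\<close> to the orbifold point, and
  \<open>Long p q L R\<close> has left endpoint \<open>p\<close> and right endpoint \<open>q\<close>; in the last case \<open>L\<close> consists of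
  the points left of the left piece and \<open>R\<close> of the points right of the right piece.\<close>
datatype type_B_arc =
    Ordinary int int "int set" "int set"
  | Orbifold int "int set" "int set"
  | Long int int "int set" "int set"

text \<open>Which data come from arcs. In a long arc the two pieces are disjoint, so that the left
  piece is left of the right one at all common heights. Hence no point is both left of the
  left piece and right of the right piece, and neither endpoint is on the wrong side of the
  other piece; these are the only constraints.\<close>
fun is_type_B_arc :: "nat \<Rightarrow> type_B_arc \<Rightarrow> bool" where
  "is_type_B_arc n (Ordinary p q L R) \<longleftrightarrow>
     0 < p \<and> p < q \<and> q \<le> int n \<and> L \<union> R = {p<..<q} \<and> L \<inter> R = {}"
| "is_type_B_arc n (Orbifold p L R) \<longleftrightarrow>
     0 < p \<and> p \<le> int n \<and> L \<union> R = {0<..<p} \<and> L \<inter> R = {}"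
| "is_type_B_arc n (Long p q L R) \<longleftrightarrow>
     0 < p \<and> p \<le> int n \<and> 0 < q \<and> q \<le> int n \<and> p \<noteq> q \<and>
     L \<subseteq> {0<..<p} \<and> R \<subseteq> {0<..<q} \<and> L \<inter> R = {} \<and> p \<notin> R \<and> q \<notin> L"

text \<open>\<open>folds_to D \<alpha>\<close>: the symmetric arc or symmetric pair of arcs \<open>D\<close> has image \<open>\<alpha>\<close> when \<open>x\<close> is
  identified with \<open>-x\<close>.

  In the third rule, \<open>A\<close> goes down from \<open>q > 0\<close> to \<open>-p < 0\<close> and its half-turn from \<open>p\<close> to \<open>-q\<close>.
  Exactly one of the endpoints \<open>p\<close> and \<open>-q\<close> of the half-turn is at a height strictly between
  \<open>-p\<close> and \<open>q\<close>, and \<open>A\<close> is the right-hand arc of the pair iff this endpoint is to the left of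
  \<open>A\<close>. In that case \<open>A\<close> crosses the horizontal axis to the right of the origin, so its upper
  part is the right piece of the image, and its lower part turns into the left piece; the
  points right of the lower part become the points left of the left piece.\<close>
inductive folds_to :: "arc set \<Rightarrow> type_B_arc \<Rightarrow> bool" where
  fold_orbifold:
    "A = Arc p (- p) L R \<Longrightarrow> 0 < p \<Longrightarrow> half_turn A = A \<Longrightarrow>
     folds_to {A} (Orbifold p (L \<inter> {0<..}) (R \<inter> {0<..}))"
| fold_ordinary:
    "A = Arc q p L R \<Longrightarrow> 0 < p \<Longrightarrow> p < q \<Longrightarrow>
     folds_to {A, half_turn A} (Ordinary p q L R)"
| fold_long:
    "A = Arc q (- p) L R \<Longrightarrow> 0 < p \<Longrightarrow> 0 < q \<Longrightarrow> p \<noteq> q \<Longrightarrow> {p, - q} \<inter> L \<noteq> {} \<Longrightarrow>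
     folds_to {A, half_turn A} (Long p q (uminus ` R \<inter> {0<..}) (R \<inter> {0<..}))"

text \<open>\<open>subarc \<alpha>' \<alpha>\<close>: \<open>\<alpha>'\<close> is a subarc of \<open>\<alpha>\<close>. This and the next relation are meant for type-B
  arcs, i.e. for data satisfying \<^const>\<open>is_type_B_arc\<close>; in particular a condition that
  involves only \<open>R\<close> then determines \<open>L\<close> for an ordinary or orbifold arc. For subarcs of an
  orbifold arc, the lower endpoint of which is \<open>0\<close>, the condition on the lower endpoint is
  void.\<close>
fun subarc :: "type_B_arc \<Rightarrow> type_B_arc \<Rightarrow> bool" where
  "subarc (Ordinary p' q' L' R') (Ordinary p q L R) \<longleftrightarrow>
     p \<le> p' \<and> q' \<le> q \<and> R' = R \<inter> {p'<..<q'}"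
| "subarc (Ordinary p' q' L' R') (Orbifold q L R) \<longleftrightarrow>
     q' \<le> q \<and> R' = R \<inter> {p'<..<q'}"
| "subarc (Orbifold q' L' R') (Orbifold q L R) \<longleftrightarrow>
     q' \<le> q \<and> R' = R \<inter> {0<..<q'}"
| "subarc (Ordinary p' q' L' R') (Long p q L R) \<longleftrightarrow>
     q' \<le> p \<and> L' = L \<inter> {p'<..<q'} \<or>
     q' \<le> q \<and> R' = R \<inter> {p'<..<q'}"
| "subarc (Orbifold p' L' R') (Long p q L R) \<longleftrightarrow>
     p' \<le> min p q \<and> L' = L \<inter> {0<..<p'} \<and> R' = R \<inter> {0<..<p'}"
| "subarc (Long p' q' L' R') (Long p q L R) \<longleftrightarrow>
     p' \<le> p \<and> q' \<le> q \<and> L' = L \<inter> {0<..<p'} \<and> R' = R \<inter> {0<..<q'} \<and> p' \<notin> R \<and> q' \<notin> L"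
| "subarc _ _ \<longleftrightarrow> False"

text \<open>In the second case, the endpoints of the long arc are required to lie on or below the
  upper endpoint of the orbifold arc. In the third case, the last condition says that no
  point lies between the two pieces of the smaller arc.\<close>
definition loose_subarc :: "type_B_arc \<Rightarrow> type_B_arc \<Rightarrow> bool" where
  "loose_subarc \<alpha>' \<alpha> \<longleftrightarrow>
     subarc \<alpha>' \<alpha> \<or>
     (\<exists>p L R p' q' L' R'. \<alpha> = Orbifold p L R \<and> \<alpha>' = Long p' q' L' R' \<and>
        p' \<le> p \<and> q' \<le> p \<and> L' = L \<inter> {0<..<p'} \<and> R' = R \<inter> {0<..<q'}) \<or>
     (\<exists>p q L R p' q' L' R'. \<alpha> = Long p q L R \<and> \<alpha>' = Long p' q' L' R' \<and>
        p' \<le> q \<and> q' \<le> p \<and> L' = {0<..<p'} - R \<and> R' = {0<..<q'} - L \<and>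
        {0<..<min p' q'} \<subseteq> L' \<union> R')"

definition closed_under_loose_subarcs :: "nat \<Rightarrow> type_B_arc set \<Rightarrow> bool" where
  "closed_under_loose_subarcs n U \<longleftrightarrow>
     (\<forall>\<alpha> \<in> U. \<forall>\<alpha>'. is_type_B_arc n \<alpha>' \<longrightarrow> loose_subarc \<alpha>' \<alpha> \<longrightarrow> \<alpha>' \<in> U)"

definition uncontracted_arcs :: "nat \<Rightarrow> (int \<Rightarrow> int) rel \<Rightarrow> type_B_arc set" where
  "uncontracted_arcs n \<Theta> =
     {\<alpha>. \<exists>j. join_irreducible (weak_Bn n) j \<and> \<not> contracts (weak_Bn n) \<Theta> j \<and>
          folds_to (delta n j) \<alpha>}"

end

(*
  A permutation is identified with its inversion set, which may be any set I of pairs such that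
  both I and its complement are transitive; joins are transitive closures of unions. Signed
  permutations are those with an inversion set invariant under (u, v) |-> (-v, -u), so they form a
  sublattice.

  A congruence contracts a cover of S_2n or not according to the arc that labels the cover, and
  if it contracts an arc then it contracts all arcs containing it. Conversely, let U be a set of
  arcs closed under passing to subarcs. Call x and y equivalent if they lie above the same
  join-irreducibles with arcs in U; this respects meets. Dually, call them equivalent if they lie
  below the same meet-irreducibles with arcs in U; this respects joins. Both relations contract
  precisely the covers with labels outside U, so they agree and form a congruence.

  The cover of a join-irreducible signed permutation is contracted iff both of its arcs A and -A
  are. It remains to compare subarcs of A and -A with loose subarcs of their common image.
*)
theory Submission
  imports Defs
begin

section \<open>Permutations as inversion sets\<close>

text \<open>The value 0 is missing from \<open>pm n\<close>, so an arc from a positive to a negative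
  value has no visible side of the origin: only the points between it and its half-turn tell which
  of the two is on the right. The folding rule reads the right-hand one. A part of a symmetric arc
  with unequal ends slides off the orbifold point and becomes a long arc; a part of the right-hand
  arc of a pair may turn out to be the left-hand one of its own pair when no point separates the
  two. These are the two clauses by which loose subarcs exceed subarcs.

  Restriction loses information: an uncontracted join-irreducible says only that one of its two arcs
  survives. Under a symmetric congruence both survive together, and contraction can be tested on
  either lift. This is why (iii) is derived from (ii) and not from (i).

  For the converse, the arcs of the uncontracted join-irreducibles are completed by all their
  subarcs. The danger is that this adds an arc of a contracted one; closure under loose subarcs
  excludes exactly that.\<close>

lemma pm_iff: "i \<in> pm n \<longleftrightarrow> i \<noteq> 0 \<and> - int n \<le> i \<and> i \<le> int n"
  by (auto simp: pm_def)

lemma finite_pm [simp]: "finite (pm n)"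
  by (simp add: pm_def)

lemma uminus_pm [simp]: "- i \<in> pm n \<longleftrightarrow> i \<in> pm n"
  by (auto simp: pm_iff)

lemma S2n_permutes: "\<pi> \<in> S2n n \<Longrightarrow> \<pi> permutes pm n"
  by (simp add: S2n_def)

lemma Bn_subset_S2n: "Bn n \<subseteq> S2n n"
  by (auto simp: Bn_def)

text \<open>Passes from positions to values: later arguments compare values \<open>u\<close> and
  \<open>v\<close> by their positions \<open>inv \<pi> u\<close> and
  \<open>inv \<pi> v\<close>.\<close>

lemma inversions_iff:
  assumes "\<pi> \<in> S2n n"
  shows "(u, v) \<in> inversions n \<pi> \<longleftrightarrow> u \<in> pm n \<and> v \<in> pm n \<and> v < u \<and> inv \<pi> u < inv \<pi> v"
proof -
  note P = S2n_permutes[OF assms]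
  have *: "\<pi> i \<in> pm n \<longleftrightarrow> i \<in> pm n" "inv \<pi> i \<in> pm n \<longleftrightarrow> i \<in> pm n" for i
    using P permutes_inv[OF P] by (simp_all add: permutes_in_image)
  have **: "\<pi> (inv \<pi> i) = i" "inv \<pi> (\<pi> i) = i" for i
    using P by (simp_all add: permutes_inverses)
  show ?thesis
    unfolding inversions_def using * ** by (smt (verit) mem_Collect_eq prod.inject)
qed

text \<open>As 0 is not a position, positions are not consecutive integers. Ranks carry the order of
  positions and a prescribed order of values to the same initial segment of the naturals, where they
  can be matched.\<close>

lemma rank_bij:
  fixes lt :: "'a \<Rightarrow> 'a \<Rightarrow> bool"
  assumes A: "finite A"
    and irrefl: "\<And>u. u \<in> A \<Longrightarrow> \<not> lt u u"
    and total: "\<And>u v. u \<in> A \<Longrightarrow> v \<in> A \<Longrightarrow> u \<noteq> v \<Longrightarrow> lt u v \<or> lt v u"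
    and trans: "\<And>u v w. u \<in> A \<Longrightarrow> v \<in> A \<Longrightarrow> w \<in> A \<Longrightarrow> lt u v \<Longrightarrow> lt v w \<Longrightarrow> lt u w"
  defines "rank \<equiv> \<lambda>u. card {v \<in> A. lt v u}"
  shows "bij_betw rank A {..<card A}"
    and "\<And>u v. u \<in> A \<Longrightarrow> v \<in> A \<Longrightarrow> rank u < rank v \<longleftrightarrow> lt u v"
proof -
  have mono: "rank u < rank v" if "u \<in> A" "v \<in> A" "lt u v" for u v
    unfolding rank_def
  proof (rule psubset_card_mono)
    show "{w \<in> A. lt w u} \<subset> {w \<in> A. lt w v}"
      using that trans irrefl by blast
  qed (use A in auto)
  show iff: "rank u < rank v \<longleftrightarrow> lt u v" if "u \<in> A" "v \<in> A" for u v
    using that mono total irrefl by (metis less_asym less_irrefl)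
  have inj: "inj_on rank A"
    using mono total by (metis inj_onI less_irrefl)
  have "rank u < card A" if "u \<in> A" for u
    unfolding rank_def using that A irrefl by (intro psubset_card_mono) auto
  then have "rank ` A \<subseteq> {..<card A}" by auto
  moreover have "card (rank ` A) = card {..<card A}"
    using inj by (simp add: card_image)
  ultimately have "rank ` A = {..<card A}"
    by (simp add: card_subset_eq)
  with inj show "bij_betw rank A {..<card A}"
    by (simp add: bij_betw_def)
qed

text \<open>The inversion set tells of any two values which stands first, hence how many values
  precede \<open>u\<close>; this number is the rank \<open>g\<close> of the position of
  \<open>u\<close>.\<close>

lemma inversions_inj:
  assumes "\<pi> \<in> S2n n" "\<sigma> \<in> S2n n" "inversions n \<pi> = inversions n \<sigma>"
  shows "\<pi> = \<sigma>"
proof -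
  define g where "g a = card {i \<in> pm n. i < a}" for a
  have g: "inj_on g (pm n)"
    using rank_bij(1)[of "pm n" "(<)"] unfolding g_def bij_betw_def by fastforce
  have rank: "g (inv \<tau> u) = card {v \<in> pm n. inv \<tau> v < inv \<tau> u}" if "\<tau> \<in> S2n n" for \<tau> u
  proof -
    note P = S2n_permutes[OF that]
    have "{i \<in> pm n. i < inv \<tau> u} = inv \<tau> ` {v \<in> pm n. inv \<tau> v < inv \<tau> u}"
      using permutes_in_image[OF P] permutes_inverses[OF P] permutes_in_image[OF permutes_inv[OF P]]
      by (auto simp: image_iff) metis
    then show ?thesis
      unfolding g_def using permutes_inj[OF permutes_inv[OF P]]
      by (simp add: card_image inj_on_subset[OF _ subset_UNIV])
  qed
  have less: "inv \<pi> v < inv \<pi> u \<longleftrightarrow> inv \<sigma> v < inv \<sigma> u" if "u \<in> pm n" "v \<in> pm n" for u v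
  proof -
    have "inv \<tau> v < inv \<tau> u \<longleftrightarrow> (v, u) \<in> inversions n \<tau> \<or> v < u \<and> (u, v) \<notin> inversions n \<tau>"
      if "\<tau> \<in> S2n n" for \<tau>
    proof -
      have "inv \<tau> u \<noteq> inv \<tau> v" if "u \<noteq> v"
        using that permutes_inverses(1)[OF S2n_permutes[OF \<open>\<tau> \<in> S2n n\<close>]] by metis
      then show ?thesis
        using inversions_iff[OF that] \<open>u \<in> pm n\<close> \<open>v \<in> pm n\<close>
        by (metis linorder_less_linear order_less_asym)
    qed
    from this[OF assms(1)] this[OF assms(2)] show ?thesis using assms(3) by simp
  qed
  have "inv \<pi> u = inv \<sigma> u" for u
  proof (cases "u \<in> pm n")
    case True
    have "g (inv \<pi> u) = g (inv \<sigma> u)"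
      unfolding rank[OF assms(1)] rank[OF assms(2)] using less True
      by (intro arg_cong[of _ _ card]) auto
    moreover have "inv \<pi> u \<in> pm n" "inv \<sigma> u \<in> pm n"
      using True assms(1,2) by (simp_all add: permutes_in_image permutes_inv S2n_permutes)
    ultimately show ?thesis using g by (auto dest: inj_onD)
  next
    case False
    then show ?thesis
      using assms(1,2) by (metis S2n_permutes permutes_inv permutes_not_in)
  qed
  then have "inv \<pi> = inv \<sigma>" by auto
  then show ?thesis
    using assms(1,2) by (metis S2n_permutes permutes_inv_inv)
qed

section \<open>Biclosed sets of pairs\<close>

definition all_inversions :: "nat \<Rightarrow> (int \<times> int) set" where
  "all_inversions n = {(u, v). u \<in> pm n \<and> v \<in> pm n \<and> v < u}"

text \<open>The last conjunct is transitivity of the complement in \<open>all_inversions n\<close>,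
  contraposed so that it splits an inversion at an intermediate value.\<close>

definition biclosed :: "nat \<Rightarrow> (int \<times> int) set \<Rightarrow> bool" where
  "biclosed n I \<longleftrightarrow> I \<subseteq> all_inversions n \<and> trans I \<and>
     (\<forall>a b c. (c, a) \<in> I \<longrightarrow> a < b \<longrightarrow> b < c \<longrightarrow> b \<in> pm n \<longrightarrow> (c, b) \<in> I \<or> (b, a) \<in> I)"

lemma finite_all_inversions: "finite (all_inversions n)"
  by (rule finite_subset[of _ "pm n \<times> pm n"]) (auto simp: all_inversions_def)

lemma biclosed_inversions: "\<pi> \<in> S2n n \<Longrightarrow> biclosed n (inversions n \<pi>)"
  unfolding biclosed_def all_inversions_def trans_def
  by (auto simp: inversions_iff)

lemma finite_inversions: "\<pi> \<in> S2n n \<Longrightarrow> finite (inversions n \<pi>)"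
  using biclosed_inversions finite_all_inversions finite_subset biclosed_def by metis

lemma biclosed_imp_inversions:
  assumes "biclosed n I"
  obtains \<pi> where "\<pi> \<in> S2n n" "inversions n \<pi> = I"
proof -
  \<comment> \<open>\<open>lt u v\<close> is to mean that \<open>u\<close> stands before
    \<open>v\<close>. On three values its transitivity is closure of \<open>I\<close> or of the
    complement, depending on how the values compare in size.\<close>
  define lt where "lt u v \<longleftrightarrow> (u < v \<and> (v, u) \<notin> I \<or> v < u \<and> (u, v) \<in> I)" for u v
  have sub: "I \<subseteq> all_inversions n" and tr: "\<And>a b c. (c, b) \<in> I \<Longrightarrow> (b, a) \<in> I \<Longrightarrow> (c, a) \<in> I"
    and co: "\<And>a b c. (c, a) \<in> I \<Longrightarrow> a < b \<Longrightarrow> b < c \<Longrightarrow> b \<in> pm n \<Longrightarrow> (c, b) \<in> I \<or> (b, a) \<in> I"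
    using assms unfolding biclosed_def by (blast, meson transD, blast)
  have lt_trans: "lt u w" if "u \<in> pm n" "v \<in> pm n" "w \<in> pm n" "lt u v" "lt v w" for u v w
  proof -
    show ?thesis
      using that
      by (cases u v rule: linorder_cases; cases v w rule: linorder_cases;
          cases u w rule: linorder_cases) (auto simp: lt_def dest: tr co)
  qed
  have irrefl: "\<not> lt u u" if "u \<in> pm n" for u
    by (simp add: lt_def)
  have total: "lt u v \<or> lt v u" if "u \<in> pm n" "v \<in> pm n" "u \<noteq> v" for u v
    using that by (auto simp: lt_def)
  define rk where "rk u = card {v \<in> pm n. lt v u}" for u
  define g where "g a = card {i \<in> pm n. i < a}" for a
  have rk: "bij_betw rk (pm n) {..<card (pm n)}"
    unfolding rk_def by (rule rank_bij(1)[where lt = lt]) (fact finite_pm irrefl total lt_trans)+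
  have rk_less: "rk u < rk v \<longleftrightarrow> lt u v" if "u \<in> pm n" "v \<in> pm n" for u v
    unfolding rk_def
    by (rule rank_bij(2)[where A = "pm n" and lt = lt]) (rule that | fact finite_pm irrefl total lt_trans)+
  have g: "bij_betw g (pm n) {..<card (pm n)}"
    "\<And>u v. u \<in> pm n \<Longrightarrow> v \<in> pm n \<Longrightarrow> g u < g v \<longleftrightarrow> u < v"
    unfolding g_def
    by ((rule rank_bij(1)[where lt = "(<)"]; simp add: neq_iff),
        (rule rank_bij(2)[where lt = "(<)" and A = "pm n"]; simp add: neq_iff))
  \<comment> \<open>\<open>f\<close> sends a value to the position of the same rank, so the
    permutation sought is the inverse of \<open>f\<close>.\<close>
  define f where "f u = (if u \<in> pm n then inv_into (pm n) g (rk u) else u)" for u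
  have "bij_betw (inv_into (pm n) g \<circ> rk) (pm n) (pm n)"
    using rk bij_betw_inv_into[OF g(1)] by (rule bij_betw_trans)
  then have "bij_betw f (pm n) (pm n)"
    by (rule bij_betw_cong[THEN iffD1, rotated]) (simp add: f_def)
  then have f: "f permutes pm n"
    by (rule bij_imp_permutes) (simp add: f_def)
  have gf: "g (f u) = rk u" if "u \<in> pm n" for u
    using that bij_betw_inv_into_right[OF g(1), of "rk u"] bij_betwE[OF rk] by (simp add: f_def)
  have f_less: "f u < f v \<longleftrightarrow> lt u v" if "u \<in> pm n" "v \<in> pm n" for u v
    using that rk_less g(2) gf permutes_in_image[OF f] by metis
  have inv: "inv f \<in> S2n n"
    by (simp add: S2n_def permutes_inv f)
  have "inversions n (inv f) = I"
  proof -
    have "(u, v) \<in> inversions n (inv f) \<longleftrightarrow> (u, v) \<in> I" for u v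
      using inversions_iff[OF inv, of u v] f_less[of u v] sub
      by (auto simp: permutes_inv_inv[OF f] lt_def all_inversions_def)
    then show ?thesis by auto
  qed
  with inv show thesis by (rule that)
qed

definition perm_of :: "nat \<Rightarrow> (int \<times> int) set \<Rightarrow> int \<Rightarrow> int" where
  "perm_of n = inv_into (S2n n) (inversions n)"

lemma perm_of:
  assumes "biclosed n I"
  shows "perm_of n I \<in> S2n n" "inversions n (perm_of n I) = I"
proof -
  have "I \<in> inversions n ` S2n n"
    using biclosed_imp_inversions[OF assms] by (metis image_eqI)
  then show "perm_of n I \<in> S2n n" "inversions n (perm_of n I) = I"
    unfolding perm_of_def by (simp_all add: inv_into_into f_inv_into_f)
qed

lemma biclosed_empty: "biclosed n {}"
  by (simp add: biclosed_def)

lemma biclosed_complement: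
  assumes "biclosed n I"
  shows "biclosed n (all_inversions n - I)"
proof -
  have tr: "\<And>a b c. (c, b) \<in> I \<Longrightarrow> (b, a) \<in> I \<Longrightarrow> (c, a) \<in> I"
    and co: "\<And>a b c. (c, a) \<in> I \<Longrightarrow> a < b \<Longrightarrow> b < c \<Longrightarrow> b \<in> pm n \<Longrightarrow> (c, b) \<in> I \<or> (b, a) \<in> I"
    using assms unfolding biclosed_def by (meson transD, blast)
  have "trans (all_inversions n - I)"
  proof (rule transI)
    fix c b a
    assume "(c, b) \<in> all_inversions n - I" "(b, a) \<in> all_inversions n - I"
    then show "(c, a) \<in> all_inversions n - I"
      using co[of c a b] by (auto simp: all_inversions_def)
  qed
  moreover have "(c, b) \<in> all_inversions n - I \<or> (b, a) \<in> all_inversions n - I"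
    if "(c, a) \<in> all_inversions n - I" "a < b" "b < c" "b \<in> pm n" for a b c
    using that tr[of c b a] by (auto simp: all_inversions_def)
  ultimately show ?thesis unfolding biclosed_def by blast
qed

text \<open>A chain of pairs from \<open>c\<close> down to \<open>a\<close> either visits
  \<open>b\<close> or jumps over it in a single step, and that step lies in \<open>I\<close> or
  \<open>J\<close>, which can split it at \<open>b\<close>.\<close>

lemma biclosed_trancl_Un:
  assumes "biclosed n I" "biclosed n J"
  shows "biclosed n ((I \<union> J)\<^sup>+)"
proof -
  have sub: "(I \<union> J)\<^sup>+ \<subseteq> all_inversions n"
  proof -
    have "(I \<union> J)\<^sup>+ \<subseteq> (all_inversions n)\<^sup>+"
      using assms by (intro trancl_mono_subset) (auto simp: biclosed_def)
    also have "\<dots> = all_inversions n"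
      by (intro trancl_id) (auto simp: all_inversions_def trans_def)
    finally show ?thesis .
  qed
  have edge: "(c, b) \<in> I \<union> J \<or> (b, a) \<in> I \<union> J"
    if "(c, a) \<in> I \<union> J" "a < b" "b < c" "b \<in> pm n" for a b c
    using assms that unfolding biclosed_def by blast
  have "\<forall>b. a < b \<longrightarrow> b < c \<longrightarrow> b \<in> pm n \<longrightarrow> (c, b) \<in> (I \<union> J)\<^sup>+ \<or> (b, a) \<in> (I \<union> J)\<^sup>+"
    if "(c, a) \<in> (I \<union> J)\<^sup>+" for a c
    using that
  proof (induction rule: trancl_induct)
    case (base y)
    then show ?case using edge by blast
  next
    case (step y z)
    show ?case
    proof (intro allI impI)
      fix b assume b: "z < b" "b < c" "b \<in> pm n"
      consider "b = y" | "y < b" | "b < y" by linarith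
      then show "(c, b) \<in> (I \<union> J)\<^sup>+ \<or> (b, z) \<in> (I \<union> J)\<^sup>+"
      proof cases
        case 1
        then show ?thesis using step.hyps by blast
      next
        case 2
        then show ?thesis using step.IH step.hyps(2) b by (meson trancl.trancl_into_trancl)
      next
        case 3
        then show ?thesis using edge[OF step.hyps(2) b(1) 3 b(3)] step.hyps(1)
          by (meson r_into_trancl trancl_into_trancl)
      qed
    qed
  qed
  with sub show ?thesis by (simp add: biclosed_def)
qed

section \<open>The weak order\<close>

text \<open>The effect on inversion sets of conjugation by \<open>w0 n\<close>: positions and values
  are both negated, so every pair is negated and reversed
  (\<open>inversions_conjugate\<close>).\<close>

definition mirror :: "(int \<times> int) set \<Rightarrow> (int \<times> int) set" where
  "mirror I = {(u, v). (- v, - u) \<in> I}"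

lemma mirror_iff [simp]: "(u, v) \<in> mirror I \<longleftrightarrow> (- v, - u) \<in> I"
  by (simp add: mirror_def)

lemma mirror_mirror [simp]: "mirror (mirror I) = I"
  by auto

lemma mirror_mono: "I \<subseteq> J \<Longrightarrow> mirror I \<subseteq> mirror J"
  by auto

lemma mirror_Un: "mirror (I \<union> J) = mirror I \<union> mirror J"
  by auto

lemma mirror_Diff: "mirror (I - J) = mirror I - mirror J"
  by auto

lemma mirror_all_inversions [simp]: "mirror (all_inversions n) = all_inversions n"
  by (auto simp: all_inversions_def)

lemma mirror_trancl_subset: "mirror (I\<^sup>+) \<subseteq> (mirror I)\<^sup>+"
proof -
  have "(- v, - u) \<in> (mirror I)\<^sup>+" if "(u, v) \<in> I\<^sup>+" for u v
    using that
  proof (induction rule: trancl_induct)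
    case (base y)
    then show ?case by auto
  next
    case (step y z)
    then have "(- z, - y) \<in> mirror I" by simp
    then show ?case using step.IH by (rule trancl_into_trancl2)
  qed
  from this[of "- _" "- _"] show ?thesis by auto
qed

lemma mirror_trancl: "mirror (I\<^sup>+) = (mirror I)\<^sup>+"
  using mirror_trancl_subset[of I] mirror_mono[OF mirror_trancl_subset[of "mirror I"]] by auto

section \<open>Conjugation by the longest element\<close>

definition conjugate :: "nat \<Rightarrow> (int \<Rightarrow> int) \<Rightarrow> int \<Rightarrow> int" where
  "conjugate n \<pi> = w0 n \<circ> \<pi> \<circ> w0 n"

lemma w0_permutes: "w0 n permutes pm n"
proof (rule bij_imp_permutes)
  show "bij_betw (w0 n) (pm n) (pm n)"
    by (rule bij_betw_byWitness[where f' = uminus]) (auto simp: w0_def)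
qed (simp add: w0_def)

lemma conjugate_S2n: "\<pi> \<in> S2n n \<Longrightarrow> conjugate n \<pi> \<in> S2n n"
  unfolding conjugate_def S2n_def by (simp add: permutes_compose w0_permutes)

lemma conjugate_apply: "\<pi> \<in> S2n n \<Longrightarrow> conjugate n \<pi> i = - \<pi> (- i)"
  using permutes_in_image[OF S2n_permutes, of \<pi> n] permutes_not_in[OF S2n_permutes, of \<pi> n]
  by (auto simp: conjugate_def w0_def)

lemma conjugate_conjugate: "\<pi> \<in> S2n n \<Longrightarrow> conjugate n (conjugate n \<pi>) = \<pi>"
  by (rule ext) (simp add: conjugate_apply conjugate_S2n)

lemma inversions_conjugate:
  assumes "\<pi> \<in> S2n n"
  shows "inversions n (conjugate n \<pi>) = mirror (inversions n \<pi>)"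
proof -
  note P = S2n_permutes[OF assms]
  have "inv (conjugate n \<pi>) u = - inv \<pi> (- u)" for u
  proof -
    have "conjugate n \<pi> (- inv \<pi> (- u)) = u"
      by (simp add: conjugate_apply assms permutes_inverses[OF P])
    then show ?thesis
      using permutes_inv_eq[OF S2n_permutes[OF conjugate_S2n[OF assms]]] by blast
  qed
  then show ?thesis
    by (auto simp: inversions_iff assms conjugate_S2n)
qed

text \<open>Signed permutations are the fixed points of conjugation; since inversion sets determine
  permutations, being fixed can be read off from them.\<close>

lemma Bn_iff: "\<pi> \<in> Bn n \<longleftrightarrow> \<pi> \<in> S2n n \<and> mirror (inversions n \<pi>) = inversions n \<pi>"
proof (cases "\<pi> \<in> S2n n")
  case True
  have "\<pi> \<in> Bn n \<longleftrightarrow> (\<forall>i. \<pi> (- i) = - \<pi> i)"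
    using True permutes_not_in[OF S2n_permutes[OF True]] unfolding Bn_def
    by simp (metis uminus_pm)
  also have "\<dots> \<longleftrightarrow> conjugate n \<pi> = \<pi>"
    using conjugate_apply[OF True] by (metis ext minus_minus)
  also have "\<dots> \<longleftrightarrow> mirror (inversions n \<pi>) = inversions n \<pi>"
    using inversions_inj[OF conjugate_S2n[OF True] True] inversions_conjugate[OF True] by metis
  finally show ?thesis using True by simp
qed (simp add: Bn_def)

lemma conjugate_Bn: "\<pi> \<in> Bn n \<Longrightarrow> conjugate n \<pi> = \<pi>"
  by (metis Bn_iff conjugate_S2n inversions_conjugate inversions_inj)

section \<open>Joins, meets and congruences, for all and for signed permutations at once\<close>

definition perm_join :: "nat \<Rightarrow> (int \<Rightarrow> int) \<Rightarrow> (int \<Rightarrow> int) \<Rightarrow> int \<Rightarrow> int" where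
  "perm_join n x y = perm_of n ((inversions n x \<union> inversions n y)\<^sup>+)"

text \<open>Complementing inversion sets reverses the order, so this is the formula for joins
  applied to noninversions.\<close>

definition perm_meet :: "nat \<Rightarrow> (int \<Rightarrow> int) \<Rightarrow> (int \<Rightarrow> int) \<Rightarrow> int \<Rightarrow> int" where
  "perm_meet n x y = perm_of n (all_inversions n -
     ((all_inversions n - inversions n x) \<union> (all_inversions n - inversions n y))\<^sup>+)"

lemma inversions_trancl: "x \<in> S2n n \<Longrightarrow> (inversions n x)\<^sup>+ = inversions n x"
  using biclosed_inversions unfolding biclosed_def by (intro trancl_id) blast

lemma inversions_subset_all: "x \<in> S2n n \<Longrightarrow> inversions n x \<subseteq> all_inversions n"
  using biclosed_inversions unfolding biclosed_def by blast

context
  fixes n :: nat and X :: "(int \<Rightarrow> int) set"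
  assumes X: "X = S2n n \<or> X = Bn n"
begin

lemma carrier_S2n: "x \<in> X \<Longrightarrow> x \<in> S2n n"
  using X Bn_subset_S2n by auto

lemma carrier_I: "x \<in> S2n n \<Longrightarrow> (X = Bn n \<Longrightarrow> mirror (inversions n x) = inversions n x) \<Longrightarrow> x \<in> X"
  using X Bn_iff by auto

text \<open>\<open>mirror\<close> commutes with unions and transitive closures, so joins of signed
  permutations are signed and one formula serves both orders.\<close>

lemma perm_join:
  assumes "x \<in> X" "y \<in> X"
  shows "perm_join n x y \<in> X" "inversions n (perm_join n x y) = (inversions n x \<union> inversions n y)\<^sup>+"
proof -
  let ?I = "(inversions n x \<union> inversions n y)\<^sup>+"
  have I: "biclosed n ?I"
    using assms carrier_S2n by (intro biclosed_trancl_Un biclosed_inversions) auto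
  show inv: "inversions n (perm_join n x y) = ?I"
    unfolding perm_join_def by (rule perm_of(2)[OF I])
  show "perm_join n x y \<in> X"
  proof (rule carrier_I)
    show "perm_join n x y \<in> S2n n"
      unfolding perm_join_def by (rule perm_of(1)[OF I])
    show "mirror (inversions n (perm_join n x y)) = inversions n (perm_join n x y)" if "X = Bn n"
      using assms that unfolding inv by (simp add: mirror_trancl mirror_Un Bn_iff)
  qed
qed

lemma perm_meet:
  assumes "x \<in> X" "y \<in> X"
  shows "perm_meet n x y \<in> X" "inversions n (perm_meet n x y) = all_inversions n -
     ((all_inversions n - inversions n x) \<union> (all_inversions n - inversions n y))\<^sup>+"
proof -
  let ?I = "all_inversions n -
     ((all_inversions n - inversions n x) \<union> (all_inversions n - inversions n y))\<^sup>+"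
  have I: "biclosed n ?I"
    using assms carrier_S2n
    by (intro biclosed_complement biclosed_trancl_Un biclosed_inversions) auto
  show inv: "inversions n (perm_meet n x y) = ?I"
    unfolding perm_meet_def by (rule perm_of(2)[OF I])
  show "perm_meet n x y \<in> X"
  proof (rule carrier_I)
    show "perm_meet n x y \<in> S2n n"
      unfolding perm_meet_def by (rule perm_of(1)[OF I])
    show "mirror (inversions n (perm_meet n x y)) = inversions n (perm_meet n x y)" if "X = Bn n"
      using assms that unfolding inv by (simp add: mirror_trancl mirror_Un mirror_Diff Bn_iff)
  qed
qed

lemma perm_join_upper:
  assumes "x \<in> X" "y \<in> X"
  shows "inversions n x \<subseteq> inversions n (perm_join n x y)" "inversions n y \<subseteq> inversions n (perm_join n x y)"
  using assms by (auto simp: perm_join)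

lemma perm_join_least:
  assumes "x \<in> X" "y \<in> X" "z \<in> X" "inversions n x \<subseteq> inversions n z" "inversions n y \<subseteq> inversions n z"
  shows "inversions n (perm_join n x y) \<subseteq> inversions n z"
proof -
  have "(inversions n x \<union> inversions n y)\<^sup>+ \<subseteq> (inversions n z)\<^sup>+"
    using assms by (intro trancl_mono_subset) auto
  then show ?thesis using assms carrier_S2n by (simp add: perm_join inversions_trancl)
qed

lemma perm_meet_lower:
  assumes "x \<in> X" "y \<in> X"
  shows "inversions n (perm_meet n x y) \<subseteq> inversions n x" "inversions n (perm_meet n x y) \<subseteq> inversions n y"
  using assms by (auto simp: perm_meet)

lemma perm_meet_greatest:
  assumes "x \<in> X" "y \<in> X" "z \<in> X" "inversions n z \<subseteq> inversions n x" "inversions n z \<subseteq> inversions n y"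
  shows "inversions n z \<subseteq> inversions n (perm_meet n x y)"
proof -
  let ?c = "\<lambda>x. all_inversions n - inversions n x"
  have "trans (?c z)"
    using biclosed_complement[OF biclosed_inversions[OF carrier_S2n[OF assms(3)]]]
    by (simp add: biclosed_def)
  moreover have "(?c x \<union> ?c y)\<^sup>+ \<subseteq> (?c z)\<^sup>+"
    using assms by (intro trancl_mono_subset) auto
  ultimately have "(?c x \<union> ?c y)\<^sup>+ \<subseteq> ?c z" by (simp add: trancl_id)
  then show ?thesis
    using assms(1,2) inversions_subset_all[OF carrier_S2n[OF assms(3)]] by (auto simp: perm_meet)
qed

lemma join_weak_order:
  assumes "x \<in> X" "y \<in> X"
  shows "x \<squnion>\<^bsub>weak_order_on n X\<^esub> y = perm_join n x y"
proof -
  let ?L = "weak_order_on n X"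
  have least: "least ?L (perm_join n x y) (Upper ?L {x, y})"
    using assms perm_join(1) perm_join_upper perm_join_least
    by (auto simp: least_def Upper_def weak_order_on_def)
  have "z = perm_join n x y" if "least ?L z (Upper ?L {x, y})" for z
  proof (rule inversions_inj)
    show "inversions n z = inversions n (perm_join n x y)"
      using that least by (auto simp: least_def weak_order_on_def)
    show "z \<in> S2n n" "perm_join n x y \<in> S2n n"
      using that least by (auto simp: least_def Upper_def weak_order_on_def carrier_S2n)
  qed
  with least show ?thesis
    unfolding join_def sup_def by (rule some_equality)
qed

lemma meet_weak_order:
  assumes "x \<in> X" "y \<in> X"
  shows "x \<sqinter>\<^bsub>weak_order_on n X\<^esub> y = perm_meet n x y"
proof -
  let ?L = "weak_order_on n X"
  have greatest: "greatest ?L (perm_meet n x y) (Lower ?L {x, y})"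
    using assms perm_meet(1) perm_meet_lower perm_meet_greatest
    by (auto simp: greatest_def Lower_def weak_order_on_def)
  have "z = perm_meet n x y" if "greatest ?L z (Lower ?L {x, y})" for z
  proof (rule inversions_inj)
    show "inversions n z = inversions n (perm_meet n x y)"
      using that greatest by (auto simp: greatest_def weak_order_on_def)
    show "z \<in> S2n n" "perm_meet n x y \<in> S2n n"
      using that greatest by (auto simp: greatest_def Lower_def weak_order_on_def carrier_S2n)
  qed
  with greatest show ?thesis
    unfolding meet_def inf_def by (rule some_equality)
qed

lemma lattice_congruence_weak_order:
  "lattice_congruence (weak_order_on n X) \<Theta> \<longleftrightarrow> equiv X \<Theta> \<and>
     (\<forall>x x' y y'. (x, x') \<in> \<Theta> \<longrightarrow> (y, y') \<in> \<Theta> \<longrightarrow>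
        (perm_meet n x y, perm_meet n x' y') \<in> \<Theta> \<and> (perm_join n x y, perm_join n x' y') \<in> \<Theta>)"
proof -
  have carrier: "carrier (weak_order_on n X) = X" by (simp add: weak_order_on_def)
  have "x \<in> X \<and> x' \<in> X" if "equiv X \<Theta>" "(x, x') \<in> \<Theta>" for x x'
    using that by (simp add: equiv_class_eq_iff)
  then show ?thesis
    unfolding lattice_congruence_def carrier using join_weak_order meet_weak_order
    by (smt (verit))
qed

lemma perm_join_absorb:
  assumes "x \<in> X" "y \<in> X" "inversions n x \<subseteq> inversions n y"
  shows "perm_join n x y = y" "perm_join n y x = y"
  using assms by (auto intro!: inversions_inj[of _ n] simp: carrier_S2n perm_join Un_absorb1 Un_absorb2 inversions_trancl)

lemma perm_meet_absorb:
  assumes "x \<in> X" "y \<in> X" "inversions n x \<subseteq> inversions n y"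
  shows "perm_meet n x y = x" "perm_meet n y x = x"
proof -
  show "perm_meet n x y = x"
    using assms perm_meet_lower perm_meet_greatest[of x y x]
    by (intro inversions_inj[of _ n]) (auto simp: carrier_S2n perm_meet(1))
  show "perm_meet n y x = x"
    using assms perm_meet_lower(2)[of y x] perm_meet_greatest[of y x x]
    by (intro inversions_inj[of _ n]) (auto simp: carrier_S2n perm_meet(1))
qed

text \<open>Joining both members of the pair with \<open>z\<close> turns \<open>x\<close> into
  \<open>z\<close> and leaves \<open>y\<close> unchanged.\<close>

lemma congruence_convex:
  assumes \<Theta>: "lattice_congruence (weak_order_on n X) \<Theta>" "(x, y) \<in> \<Theta>"
    and z: "z \<in> X" "inversions n x \<subseteq> inversions n z" "inversions n z \<subseteq> inversions n y"
  shows "(x, z) \<in> \<Theta>" "(z, y) \<in> \<Theta>"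
proof -
  have E: "equiv X \<Theta>" and comp: "\<And>x x' y y'. (x, x') \<in> \<Theta> \<Longrightarrow> (y, y') \<in> \<Theta> \<Longrightarrow> (perm_join n x y, perm_join n x' y') \<in> \<Theta>"
    using \<Theta>(1) unfolding lattice_congruence_weak_order by blast+
  have xy: "x \<in> X" "y \<in> X"
    using \<Theta>(2) E by (simp_all add: equiv_class_eq_iff)
  have "(z, z) \<in> \<Theta>"
    using E z by (simp add: equiv_class_eq_iff)
  from comp[OF \<Theta>(2) this] show "(z, y) \<in> \<Theta>"
    using xy z by (simp add: perm_join_absorb)
  with E \<Theta>(2) show "(x, z) \<in> \<Theta>"
    by (meson equivE symD transD)
qed

end

section \<open>Descents and covers\<close>

text \<open>Descents are given by their values, not by their positions.\<close>
definition descent :: "nat \<Rightarrow> (int \<Rightarrow> int) \<Rightarrow> int \<Rightarrow> int \<Rightarrow> bool" where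
  "descent n \<pi> q p \<longleftrightarrow> (q, p) \<in> inversions n \<pi> \<and>
     \<not> (\<exists>c \<in> pm n. inv \<pi> q < inv \<pi> c \<and> inv \<pi> c < inv \<pi> p)"

definition label :: "nat \<Rightarrow> (int \<Rightarrow> int) \<Rightarrow> int \<Rightarrow> int \<Rightarrow> arc" where
  "label n \<pi> q p = Arc q p {c \<in> pm n. p < c \<and> c < q \<and> inv \<pi> c < inv \<pi> q}
     {c \<in> pm n. p < c \<and> c < q \<and> inv \<pi> p < inv \<pi> c}"

lemma label_ends [simp]: "upper_end (label n \<pi> q p) = q" "lower_end (label n \<pi> q p) = p"
  by (simp_all add: label_def)

lemma pos_pm: "\<pi> \<in> S2n n \<Longrightarrow> inv \<pi> u \<in> pm n \<longleftrightarrow> u \<in> pm n"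
  by (simp add: permutes_in_image permutes_inv S2n_permutes)

lemma pos_eq: "\<pi> \<in> S2n n \<Longrightarrow> inv \<pi> u = inv \<pi> v \<longleftrightarrow> u = v"
  by (metis S2n_permutes permutes_inverses(1))

lemma delta_label:
  assumes "\<pi> \<in> S2n n"
  shows "delta n \<pi> = {label n \<pi> q p | q p. descent n \<pi> q p}"
proof -
  note P = S2n_permutes[OF assms]
  note inverses [simp] = permutes_inverses[OF P]
  note image [simp] = permutes_in_image[OF P]
  have ex: "(\<exists>c. Q c (\<pi> c)) \<longleftrightarrow> (\<exists>c. Q (inv \<pi> c) c)" for Q
    by (metis inverses)
  have lab: "Arc (\<pi> a) (\<pi> b)
        {\<pi> c | c. c \<in> pm n \<and> \<pi> b < \<pi> c \<and> \<pi> c < \<pi> a \<and> c < a}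
        {\<pi> c | c. c \<in> pm n \<and> \<pi> b < \<pi> c \<and> \<pi> c < \<pi> a \<and> b < c} = label n \<pi> (\<pi> a) (\<pi> b)" for a b
  proof -
    have "{\<pi> c | c. c \<in> pm n \<and> \<pi> b < \<pi> c \<and> \<pi> c < \<pi> a \<and> Q c}
      = {c \<in> pm n. \<pi> b < c \<and> c < \<pi> a \<and> Q (inv \<pi> c)}" for Q
      by (auto simp: pos_pm[OF assms]) (metis inverses(1) pos_pm[OF assms])
    then show ?thesis by (simp add: label_def)
  qed
  have con: "consecutive n a b \<and> \<pi> a > \<pi> b \<longleftrightarrow> descent n \<pi> (\<pi> a) (\<pi> b)" for a b
    unfolding consecutive_def descent_def inversions_iff[OF assms]
    by simp (metis inverses(1) inverses(2) pos_pm[OF assms])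
  show ?thesis
    unfolding delta_def lab con by (auto, metis inverses(1))
qed

lemma descent_total:
  assumes \<pi>: "\<pi> \<in> S2n n" and d: "descent n \<pi> q p" and c: "c \<in> pm n" "c \<noteq> q" "c \<noteq> p"
  shows "inv \<pi> c < inv \<pi> q \<and> inv \<pi> c < inv \<pi> p \<or> inv \<pi> p < inv \<pi> c \<and> inv \<pi> q < inv \<pi> c"
proof -
  have "inv \<pi> c \<noteq> inv \<pi> q" "inv \<pi> c \<noteq> inv \<pi> p"
    using c pos_eq[OF \<pi>] by auto
  with d c show ?thesis
    unfolding descent_def inversions_iff[OF \<pi>] by force
qed

lemma descent_pm: "\<pi> \<in> S2n n \<Longrightarrow> descent n \<pi> q p \<Longrightarrow> q \<in> pm n \<and> p \<in> pm n \<and> p < q \<and> inv \<pi> q < inv \<pi> p"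
  by (simp add: descent_def inversions_iff)

text \<open>The entries \<open>q\<close> and \<open>p\<close> are adjacent, so every other value
  stands on the same side of both. Hence \<open>(q, p)\<close> is not composed of two inversions,
  and whenever it helps to split an inversion, the other half is an inversion as well.\<close>

lemma biclosed_remove_descent:
  assumes \<pi>: "\<pi> \<in> S2n n" and d: "descent n \<pi> q p"
  shows "biclosed n (inversions n \<pi> - {(q, p)})"
proof -
  note i = inversions_iff[OF \<pi>] and t = descent_total[OF \<pi> d] and pq = descent_pm[OF \<pi> d]
  have "(c, a) \<in> inversions n \<pi> - {(q, p)}"
    if "(c, b) \<in> inversions n \<pi> - {(q, p)}" "(b, a) \<in> inversions n \<pi> - {(q, p)}" for a b c
    using that t[of b] pq by (auto simp: i)
  moreover have "(c, b) \<in> inversions n \<pi> - {(q, p)} \<or> (b, a) \<in> inversions n \<pi> - {(q, p)}"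
    if "(c, a) \<in> inversions n \<pi> - {(q, p)}" "a < b" "b < c" "b \<in> pm n" for a b c
  proof -
    have "(c, b) \<in> inversions n \<pi> \<or> (b, a) \<in> inversions n \<pi>"
      using biclosed_inversions[OF \<pi>] that unfolding biclosed_def by blast
    moreover have "(p, a) \<in> inversions n \<pi>" if "c = q" "b = p"
      using \<open>(c, a) \<in> _\<close> \<open>a < b\<close> t[of a] pq that by (auto simp: i)
    moreover have "(c, q) \<in> inversions n \<pi>" if "b = q" "a = p"
      using \<open>(c, a) \<in> _\<close> \<open>b < c\<close> t[of c] pq that by (auto simp: i)
    ultimately show ?thesis using pq by auto
  qed
  ultimately show ?thesis
    using inversions_subset_all[OF \<pi>] unfolding biclosed_def trans_def by blast
qed

definition remove :: "nat \<Rightarrow> (int \<Rightarrow> int) \<Rightarrow> int \<Rightarrow> int \<Rightarrow> int \<Rightarrow> int" where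
  "remove n \<pi> q p = perm_of n (inversions n \<pi> - {(q, p)})"

lemma remove:
  assumes "\<pi> \<in> S2n n" "descent n \<pi> q p"
  shows "remove n \<pi> q p \<in> S2n n" "inversions n (remove n \<pi> q p) = inversions n \<pi> - {(q, p)}"
  unfolding remove_def using perm_of[OF biclosed_remove_descent[OF assms]] by simp_all

text \<open>Among the inversions of \<open>x\<close> missing from \<open>y\<close>, one whose
  entries are closest in \<open>x\<close> is a descent. For an entry \<open>c\<close> between them,
  the closer inversions that it forms with \<open>q\<close> and \<open>p\<close> already belong to
  \<open>y\<close>, and those of \<open>y\<close> belong to \<open>x\<close>; whether
  \<open>c\<close> is above, below or between \<open>q\<close> and \<open>p\<close> in size, this is
  contradictory.\<close>

lemma ex_descent:
  assumes x: "x \<in> S2n n" and y: "y \<in> S2n n" and le: "inversions n y \<subset> inversions n x"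
  obtains q p where "descent n x q p" "(q, p) \<notin> inversions n y"
proof -
  let ?D = "inversions n x - inversions n y"
  have "?D \<noteq> {}" using le by auto
  moreover have "finite ?D" using finite_inversions[OF x] by simp
  ultimately obtain z where z: "z \<in> ?D"
    "\<And>z'. z' \<in> ?D \<Longrightarrow> nat (inv x (snd z) - inv x (fst z)) \<le> nat (inv x (snd z') - inv x (fst z'))"
    using ex_min_if_finite[of "(\<lambda>z. nat (inv x (snd z) - inv x (fst z))) ` ?D"]
    by (smt (verit) finite_imageI image_iff image_is_empty linorder_not_less)
  obtain q p where qp: "z = (q, p)" by (cases z)
  note i = inversions_iff[OF x] inversions_iff[OF y]
  have qp': "q \<in> pm n" "p \<in> pm n" "p < q" "inv x q < inv x p" "inv y p < inv y q"
    using z(1) pos_eq[OF y, of p q] unfolding qp by (auto simp: i)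
  have small: "(u, v) \<in> inversions n y"
    if "(u, v) \<in> inversions n x" "inv x v - inv x u < inv x p - inv x q" for u v
    using z(2)[of "(u, v)"] that qp by (force simp: i)
  have sub: "(u, v) \<in> inversions n x" if "(u, v) \<in> inversions n y" for u v
    using le that by blast
  have "descent n x q p"
  proof -
    have False if c: "c \<in> pm n" "inv x q < inv x c" "inv x c < inv x p" for c
    proof -
      have ne: "c \<noteq> q" "c \<noteq> p" using c by auto
      have 1: "inv y q < inv y c" if "c < q"
        using small[of q c] c qp' that by (auto simp: i)
      have 2: "inv y c < inv y p" if "p < c"
        using small[of c p] c qp' that by (auto simp: i)
      have 3: "inv x c < inv x q" if "q < c" "inv y c < inv y q"
        using sub[of c q] c qp' that by (auto simp: i)
      have 4: "inv x p < inv x c" if "c < p" "inv y p < inv y c"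
        using sub[of p c] c qp' that by (auto simp: i)
      show False using 1 2 3 4 ne c qp' by linarith
    qed
    then show ?thesis using qp' by (auto simp: descent_def i)
  qed
  then show thesis using z(1) qp that by blast
qed

subsection \<open>Covers of signed permutations\<close>

lemma pos_uminus: "x \<in> Bn n \<Longrightarrow> inv x (- u) = - inv x u"
proof -
  assume x: "x \<in> Bn n"
  then have S: "x \<in> S2n n" by (simp add: Bn_iff)
  note P = S2n_permutes[OF S]
  have "x (- inv x u) = - u"
    using conjugate_apply[OF S, of "inv x u"] conjugate_Bn[OF x] permutes_inverses(1)[OF P] by simp
  then show ?thesis using permutes_inv_eq[OF P] by blast
qed

lemma descent_uminus:
  assumes "x \<in> Bn n" "descent n x q p"
  shows "descent n x (- p) (- q)"
proof -
  have S: "x \<in> S2n n" using assms by (simp add: Bn_iff)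
  have "\<not> (- inv x p < inv x c \<and> inv x c < - inv x q)" if "c \<in> pm n" for c
  proof -
    have "- c \<in> pm n" using that by simp
    then have "\<not> (inv x q < inv x (- c) \<and> inv x (- c) < inv x p)"
      using assms(2) unfolding descent_def by blast
    then show ?thesis by (auto simp: pos_uminus[OF assms(1)])
  qed
  then show ?thesis
    using descent_pm[OF S assms(2)] by (auto simp: descent_def inversions_iff[OF S] pos_uminus[OF assms(1)])
qed

lemma half_turn_label:
  assumes "x \<in> Bn n"
  shows "half_turn (label n x q p) = label n x (- p) (- q)"
proof -
  have S: "x \<in> S2n n" using assms by (simp add: Bn_iff)
  have eq: "uminus ` {c \<in> pm n. p < c \<and> c < q \<and> Q c} = {c \<in> pm n. - q < c \<and> c < - p \<and> Q (- c)}" for Q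
    by (auto simp: image_iff) (metis add.inverse_inverse minus_less_iff uminus_pm less_minus_iff)
  then show ?thesis
    unfolding label_def half_turn.simps eq by (auto simp: pos_uminus[OF assms])
qed

text \<open>Descents of a signed permutation come in pairs, and staying signed means undoing both.
  The form as a meet lets compatibility with meets apply directly in \<open>contracts_reduce\<close>
  and includes the self-paired case \<open>q = - p\<close>.\<close>

definition reduce :: "nat \<Rightarrow> (int \<Rightarrow> int) \<Rightarrow> int \<Rightarrow> int \<Rightarrow> int \<Rightarrow> int" where
  "reduce n \<pi> q p = perm_meet n (remove n \<pi> q p) (remove n \<pi> (- p) (- q))"

lemma reduce:
  assumes x: "x \<in> Bn n" and d: "descent n x q p"
  shows "reduce n x q p \<in> Bn n"
    "inversions n (reduce n x q p) = inversions n x - {(q, p), (- p, - q)}"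
proof -
  have S: "x \<in> S2n n" using x by (simp add: Bn_iff)
  note d' = descent_uminus[OF x d]
  note pq = descent_pm[OF S d]
  let ?y = "remove n x q p"
  have y: "?y \<in> S2n n" "inversions n ?y = inversions n x - {(q, p)}"
    using remove[OF S d] by auto
  have "biclosed n (inversions n x - {(q, p), (- p, - q)})"
  proof (cases "q = - p")
    case True
    then show ?thesis using biclosed_remove_descent[OF S d] by simp
  next
    case False
    \<comment> \<open>Undoing \<open>(q, p)\<close> changes the relative order of \<open>q\<close>
      and \<open>p\<close> only. As \<open>q\<close> is not \<open>- p\<close> and 0 is not a value,
      no comparison that makes \<open>(- p, - q)\<close> a descent is affected.\<close>
    have "descent n ?y (- p) (- q)"
    proof -
      have less: "inv ?y u < inv ?y v \<longleftrightarrow> inv x u < inv x v"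
        if "u \<in> pm n" "v \<in> pm n" "(u, v) \<noteq> (q, p)" "(u, v) \<noteq> (p, q)" for u v
      proof -
        have *: "inv \<tau> u < inv \<tau> v \<longleftrightarrow> (u, v) \<in> inversions n \<tau> \<or> u < v \<and> (v, u) \<notin> inversions n \<tau>"
          if "\<tau> \<in> S2n n" for \<tau>
          using pos_eq[OF that, of u v] \<open>u \<in> pm n\<close> \<open>v \<in> pm n\<close> by (auto simp: inversions_iff[OF that])
        show ?thesis
          unfolding *[OF S] *[OF y(1)] y(2) using that by auto
      qed
      have "(- p, - q) \<noteq> (q, p)" "(- p, - q) \<noteq> (p, q)" using False pq by auto
      moreover have "(- p, c) \<noteq> (q, p)" "(- p, c) \<noteq> (p, q)" "(c, - q) \<noteq> (q, p)" "(c, - q) \<noteq> (p, q)" if "c \<in> pm n" for c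
        using False pq that by (auto simp: pm_iff)
      ultimately show ?thesis
        using d' pq less unfolding descent_def y(2) by (auto simp: less)
    qed
    moreover have "inversions n x - {(q, p)} - {(- p, - q)} = inversions n x - {(q, p), (- p, - q)}"
      by auto
    ultimately show ?thesis
      using biclosed_remove_descent[OF y(1)] unfolding y(2) by metis
  qed
  from perm_of[OF this] obtain z where z: "z \<in> S2n n"
    "inversions n z = inversions n x - {(q, p), (- p, - q)}" by blast
  have zB: "z \<in> Bn n"
  proof -
    have "mirror {(q, p), (- p, - q)} = {(q, p), (- p, - q)}" by (auto simp: minus_equation_iff)
    then show ?thesis using x z by (simp add: Bn_iff mirror_Diff)
  qed
  have S2: "S2n n = S2n n \<or> S2n n = Bn n" by simp
  let ?y' = "remove n x (- p) (- q)"
  have y': "?y' \<in> S2n n" "inversions n ?y' = inversions n x - {(- p, - q)}"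
    using remove[OF S d'] by auto
  have "reduce n x q p = z"
    unfolding reduce_def
  proof (rule inversions_inj[OF perm_meet(1)[OF S2 y(1) y'(1)] z(1)])
    show "inversions n (perm_meet n ?y ?y') = inversions n z"
      using perm_meet_lower[OF S2 y(1) y'(1)] perm_meet_greatest[OF S2 y(1) y'(1) z(1)] y y' z(2) by auto
  qed
  with z zB show "reduce n x q p \<in> Bn n"
    "inversions n (reduce n x q p) = inversions n x - {(q, p), (- p, - q)}" by auto
qed

text \<open>Mirror symmetry puts both of \<open>(q, p)\<close> and \<open>(- p, - q)\<close> among
  the inversions of \<open>z\<close>, or neither.\<close>

lemma Bn_subset_cover:
  assumes x: "x \<in> Bn n" and z: "z \<in> Bn n" and d: "descent n x q p"
    and "inversions n (reduce n x q p) \<subseteq> inversions n z" "inversions n z \<subseteq> inversions n x"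
  shows "z = x \<or> z = reduce n x q p"
proof -
  have m: "(q, p) \<in> inversions n z \<longleftrightarrow> (- p, - q) \<in> inversions n z"
  proof -
    have "mirror (inversions n z) = inversions n z" using z by (simp add: Bn_iff)
    then show ?thesis by (metis mirror_iff minus_minus)
  qed
  have "(q, p) \<in> inversions n x" "(- p, - q) \<in> inversions n x"
    using d descent_uminus[OF x d] by (simp_all add: descent_def)
  with m assms(4,5) have "inversions n z = inversions n x \<or> inversions n z = inversions n (reduce n x q p)"
    unfolding reduce(2)[OF x d] by blast
  then show ?thesis
    using inversions_inj x z reduce(1)[OF x d] by (metis Bn_iff)
qed

lemma covers_weak_Bn:
  "covers (weak_Bn n) x y \<longleftrightarrow> x \<in> Bn n \<and> (\<exists>q p. descent n x q p \<and> y = reduce n x q p)"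
proof
  have lless: "u \<sqsubset>\<^bsub>weak_Bn n\<^esub> v \<longleftrightarrow> inversions n u \<subset> inversions n v"
    if "u \<in> Bn n" "v \<in> Bn n" for u v
    using that inversions_inj[of u n v] by (auto simp: lless_def weak_order_on_def Bn_iff)
  have carrier: "carrier (weak_Bn n) = Bn n" by (simp add: weak_order_on_def)
  {
    assume c: "covers (weak_Bn n) x y"
    then have xy: "x \<in> Bn n" "y \<in> Bn n" "inversions n y \<subset> inversions n x"
      using lless by (auto simp: covers_def carrier)
    obtain q p where d: "descent n x q p" "(q, p) \<notin> inversions n y"
      using ex_descent[of x n y] xy by (metis Bn_iff)
    note r = reduce[OF xy(1) d(1)]
    have m: "(- p, - q) \<notin> inversions n y"
      using d(2) xy(2) by (metis Bn_iff mirror_iff minus_minus)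
    have "inversions n (reduce n x q p) \<subset> inversions n x"
      using d(1) r by (auto simp: descent_def)
    then have "\<not> inversions n y \<subset> inversions n (reduce n x q p)"
      using c lless[OF xy(2) r(1)] lless[OF r(1) xy(1)] r(1) unfolding covers_def carrier by blast
    moreover have "inversions n y \<subseteq> inversions n (reduce n x q p)"
      using xy(3) d(2) m r(2) by auto
    ultimately have "inversions n y = inversions n (reduce n x q p)" by auto
    then have "y = reduce n x q p"
      using inversions_inj xy(2) r(1) by (metis Bn_iff)
    with xy d show "x \<in> Bn n \<and> (\<exists>q p. descent n x q p \<and> y = reduce n x q p)" by blast
  next
    assume "x \<in> Bn n \<and> (\<exists>q p. descent n x q p \<and> y = reduce n x q p)"
    then obtain q p where x: "x \<in> Bn n" and d: "descent n x q p" and y: "y = reduce n x q p" by blast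
    note r = reduce[OF x d]
    have "inversions n y \<subset> inversions n x"
      using d r y by (auto simp: descent_def)
    then have "y \<sqsubset>\<^bsub>weak_Bn n\<^esub> x"
      using lless r(1) x y by simp
    moreover have "\<not> (y \<sqsubset>\<^bsub>weak_Bn n\<^esub> z \<and> z \<sqsubset>\<^bsub>weak_Bn n\<^esub> x)" if "z \<in> Bn n" for z
      using Bn_subset_cover[OF x that d] y lless[OF that x] lless[OF r(1) that] by auto
    ultimately show "covers (weak_Bn n) x y"
      using x r(1) y unfolding covers_def carrier by blast
  }
qed

text \<open>A join-irreducible signed permutation with a chosen name for its descent: if
  \<open>q\<close> is not \<open>- p\<close>, the same \<open>j\<close> is also named by
  \<open>(- p, - q)\<close>.\<close>

definition sole_descent :: "nat \<Rightarrow> (int \<Rightarrow> int) \<Rightarrow> int \<Rightarrow> int \<Rightarrow> bool" where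
  "sole_descent n j q p \<longleftrightarrow> j \<in> Bn n \<and> descent n j q p \<and>
     (\<forall>b a. descent n j b a \<longrightarrow> (b, a) = (q, p) \<or> (b, a) = (- p, - q))"

lemma sole_descent_cover:
  assumes "sole_descent n j q p"
  shows "covers (weak_Bn n) j y \<longleftrightarrow> y = reduce n j q p"
proof -
  have j: "j \<in> Bn n" and d: "descent n j q p"
    and s: "\<And>b a. descent n j b a \<Longrightarrow> (b, a) = (q, p) \<or> (b, a) = (- p, - q)"
    using assms by (auto simp: sole_descent_def)
  have "reduce n j (- p) (- q) = reduce n j q p"
    using reduce[OF j d] reduce[OF j descent_uminus[OF j d]]
    by (intro inversions_inj[of _ n]) (auto simp: Bn_iff)
  then show ?thesis
    unfolding covers_weak_Bn using j d s by blast
qed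

lemma join_irreducible_weak_Bn:
  "join_irreducible (weak_Bn n) j \<longleftrightarrow> (\<exists>q p. sole_descent n j q p)"
proof
  assume "\<exists>q p. sole_descent n j q p"
  then show "join_irreducible (weak_Bn n) j"
    using sole_descent_cover by (auto simp: join_irreducible_def weak_order_on_def sole_descent_def)
next
  assume "join_irreducible (weak_Bn n) j"
  then have j: "j \<in> Bn n" and ex1: "\<exists>!y. covers (weak_Bn n) j y"
    by (auto simp: join_irreducible_def weak_order_on_def)
  then obtain q p where d: "descent n j q p"
    unfolding covers_weak_Bn by blast
  have "(b, a) = (q, p) \<or> (b, a) = (- p, - q)" if d': "descent n j b a" for b a
  proof -
    have "reduce n j b a = reduce n j q p"
      using ex1 j d d' unfolding covers_weak_Bn by blast
    then have "(b, a) \<notin> inversions n j - {(q, p), (- p, - q)}"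
      using reduce(2)[OF j d] reduce(2)[OF j d'] by auto
    then show ?thesis using d' by (auto simp: descent_def)
  qed
  with j d show "\<exists>q p. sole_descent n j q p"
    unfolding sole_descent_def by blast
qed

lemma contracts_weak_Bn:
  "sole_descent n j q p \<Longrightarrow> contracts (weak_Bn n) \<Theta> j \<longleftrightarrow> (j, reduce n j q p) \<in> \<Theta>"
  by (simp add: contracts_def sole_descent_cover)

lemma delta_sole_descent:
  assumes "sole_descent n j q p"
  shows "delta n j = {label n j q p, half_turn (label n j q p)}"
proof -
  have "j \<in> Bn n" "j \<in> S2n n" using assms by (simp_all add: sole_descent_def Bn_iff)
  then show ?thesis
    using assms descent_uminus[of j n q p]
    by (auto simp: delta_label sole_descent_def half_turn_label)
qed

text \<open>Every cover relation is perspective to that of a join-irreducible element.\<close>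
lemma ex_sole_descent:
  assumes x: "x \<in> Bn n" and d: "descent n x q p"
  obtains j where "sole_descent n j q p" "label n j q p = label n x q p"
    "inversions n j \<subseteq> inversions n x"
proof -
  \<comment> \<open>A smallest signed permutation below \<open>x\<close> that still inverts
    \<open>(q, p)\<close>: any descent outside this mirror pair could be undone without leaving the
    set.\<close>
  let ?S = "{j \<in> Bn n. inversions n j \<subseteq> inversions n x \<and> (q, p) \<in> inversions n j}"
  have "x \<in> ?S" using x d by (simp add: descent_def)
  then obtain j where jS: "j \<in> ?S" and min: "\<And>z. z \<in> ?S \<Longrightarrow> card (inversions n j) \<le> card (inversions n z)"
    using arg_min_nat_lemma[of "\<lambda>j. j \<in> ?S" x "\<lambda>j. card (inversions n j)"] by auto
  have j: "j \<in> Bn n" "inversions n j \<subseteq> inversions n x" "(q, p) \<in> inversions n j" and S: "j \<in> S2n n" "x \<in> S2n n"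
    using jS x by (auto simp: Bn_iff)
  have sole: "(b, a) = (q, p) \<or> (b, a) = (- p, - q)" if d': "descent n j b a" for b a
  proof -
    note r = reduce[OF j(1) d']
    have "inversions n (reduce n j b a) \<subset> inversions n j"
      using d' r by (auto simp: descent_def)
    then have "card (inversions n (reduce n j b a)) < card (inversions n j)"
      using finite_inversions[OF S(1)] by (rule psubset_card_mono[rotated])
    then have "reduce n j b a \<notin> ?S" using min by (meson linorder_not_less)
    moreover have "inversions n (reduce n j b a) \<subseteq> inversions n x"
      using r(2) j(2) by blast
    ultimately have "(q, p) \<notin> inversions n (reduce n j b a)"
      using r(1) by blast
    then have "(q, p) = (b, a) \<or> (q, p) = (- a, - b)"
      using r(2) j(3) by blast
    then show ?thesis by (metis minus_minus prod.inject)
  qed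
  obtain \<iota> where \<iota>: "\<iota> \<in> S2n n" "inversions n \<iota> = {}"
    using biclosed_imp_inversions[OF biclosed_empty] .
  obtain b a where d': "descent n j b a"
    using ex_descent[OF S(1) \<iota>(1)] j(3) \<iota>(2) by blast
  have dj: "descent n j q p"
    using sole[OF d'] d' descent_uminus[OF j(1) d'] by auto
  then have sd: "sole_descent n j q p"
    using j sole unfolding sole_descent_def by blast
  have pq: "p \<in> pm n" "q \<in> pm n" using descent_pm[OF S(1) dj] by auto
  \<comment> \<open>In \<open>j\<close>, a value \<open>c\<close> before \<open>p\<close> or after
    \<open>q\<close> yields an inversion, which \<open>x\<close> shares. Since \<open>q\<close> and
    \<open>p\<close> are adjacent in both permutations, \<open>c\<close> is then on the same side of
    both in \<open>x\<close> as in \<open>j\<close>.\<close>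
  have "inv j c < inv j q \<longleftrightarrow> inv x c < inv x q" "inv j p < inv j c \<longleftrightarrow> inv x p < inv x c"
    if c: "c \<in> pm n" "p < c" "c < q" for c
  proof -
    have 1: "inv x c < inv x p" if "inv j c < inv j p"
      using subsetD[OF j(2), of "(c, p)"] that c pq
      by (auto simp: inversions_iff[OF S(1)] inversions_iff[OF S(2)])
    have 2: "inv x q < inv x c" if "inv j q < inv j c"
      using subsetD[OF j(2), of "(q, c)"] that c pq
      by (auto simp: inversions_iff[OF S(1)] inversions_iff[OF S(2)])
    show "inv j c < inv j q \<longleftrightarrow> inv x c < inv x q" "inv j p < inv j c \<longleftrightarrow> inv x p < inv x c"
      using 1 2 descent_total[OF S(1) dj c(1)] descent_total[OF S(2) d c(1)] c by fastforce+
  qed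
  then have "label n j q p = label n x q p"
    unfolding label_def by auto
  then show thesis using that[OF sd _ j(2)] by blast
qed

section \<open>Congruences of the weak order on all permutations\<close>

fun is_arc :: "nat \<Rightarrow> arc \<Rightarrow> bool" where
  "is_arc n (Arc q p L R) \<longleftrightarrow>
     p \<in> pm n \<and> q \<in> pm n \<and> p < q \<and> L \<union> R = {p<..<q} \<inter> pm n \<and> L \<inter> R = {}"

fun arc_subarc :: "arc \<Rightarrow> arc \<Rightarrow> bool" where
  "arc_subarc (Arc q' p' L' R') (Arc q p L R) \<longleftrightarrow>
     p \<le> p' \<and> q' \<le> q \<and> L' = L \<inter> {p'<..<q'} \<and> R' = R \<inter> {p'<..<q'}"

text \<open>The inversions of the smallest permutation with a descent labelled by the given arc, and the
  non-inversions of the largest permutation with an ascent labelled by it.\<close>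
fun arc_inversions :: "arc \<Rightarrow> (int \<times> int) set" where
  "arc_inversions (Arc q p L R) = {(b, a). a < b \<and> b \<in> insert q L \<and> a \<in> insert p R}"

fun arc_noninversions :: "arc \<Rightarrow> (int \<times> int) set" where
  "arc_noninversions (Arc q p L R) = {(b, a). a < b \<and> a \<in> insert p L \<and> b \<in> insert q R}"

lemma mem_uminus_image: "x \<in> uminus ` S \<longleftrightarrow> - x \<in> S" for x :: int
  by (metis image_iff minus_minus)

lemma arc_inversions_half_turn: "arc_inversions (half_turn A) = mirror (arc_inversions A)"
  by (cases A) (auto simp: mem_uminus_image)

lemma half_turn_half_turn [simp]: "half_turn (half_turn A) = A"
  by (cases A) (simp add: image_image)

lemma is_arc_half_turn [simp]: "is_arc n (half_turn A) = is_arc n A"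
proof -
  have "is_arc n (half_turn A)" if "is_arc n A" for A
  proof (cases A)
    case (Arc q p L R)
    have "c \<in> L \<or> c \<in> R \<longleftrightarrow> p < c \<and> c < q \<and> c \<in> pm n" "\<not> (c \<in> L \<and> c \<in> R)" for c
      using that Arc by auto
    from this[of "- c" for c]
    have "- c \<in> L \<or> - c \<in> R \<longleftrightarrow> - q < c \<and> c < - p \<and> c \<in> pm n" "\<not> (- c \<in> L \<and> - c \<in> R)" for c
      by auto
    then have "uminus ` R \<union> uminus ` L = {- q<..<- p} \<inter> pm n" "uminus ` R \<inter> uminus ` L = {}"
      unfolding set_eq_iff by (auto simp: mem_uminus_image)
    then show ?thesis using that Arc by simp
  qed
  from this[of A] this[of "half_turn A"] show ?thesis by auto
qed

lemma arc_subarc_refl: "is_arc n A \<Longrightarrow> arc_subarc A A"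
  by (cases A) auto

lemma arc_subarc_trans: "arc_subarc A B \<Longrightarrow> arc_subarc B C \<Longrightarrow> arc_subarc A C"
  by (cases A; cases B; cases C) auto

lemma arc_subarc_half_turn [simp]: "arc_subarc (half_turn A) (half_turn B) = arc_subarc A B"
proof -
  have "arc_subarc (half_turn A) (half_turn B)" if "arc_subarc A B" for A B
    using that by (cases A; cases B) (auto simp: mem_uminus_image)
  from this[of A B] this[of "half_turn A" "half_turn B"] show ?thesis by auto
qed

lemma is_arc_label: "x \<in> S2n n \<Longrightarrow> descent n x q p \<Longrightarrow> is_arc n (label n x q p)"
  using descent_pm[of x n q p] descent_total[of x n q p] by (fastforce simp: label_def)

text \<open>Larger members of pairs lie in \<open>insert q L\<close> and smaller ones in
  \<open>insert p R\<close>. These sets are disjoint, so no two pairs compose. A value between the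
  members of a pair may replace the larger one if it is in \<open>L\<close>, the smaller one if it
  is in \<open>R\<close>; the result is never the pair of endpoints, which can therefore be
  dropped.\<close>

lemma biclosed_arc_inversions:
  assumes "is_arc n A"
  shows "biclosed n (arc_inversions A)"
    "biclosed n (arc_inversions A - {(upper_end A, lower_end A)})"
proof -
  obtain q p L R where A: "A = Arc q p L R" by (cases A)
  have LR: "c \<in> L \<or> c \<in> R \<longleftrightarrow> p < c \<and> c < q \<and> c \<in> pm n" "\<not> (c \<in> L \<and> c \<in> R)" for c
    using assms A by auto
  have pq: "p \<in> pm n" "q \<in> pm n" "p < q"
    using assms A by auto
  have sub: "arc_inversions A \<subseteq> all_inversions n"
    using LR pq unfolding A all_inversions_def by auto
  have vac: False if "(c, b) \<in> arc_inversions A" "(b, a) \<in> arc_inversions A" for a b c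
    using that LR[of a] LR[of b] LR[of c] pq unfolding A by auto
  have co: "(c, b) \<in> arc_inversions A - {(upper_end A, lower_end A)} \<or>
      (b, a) \<in> arc_inversions A - {(upper_end A, lower_end A)}"
    if "(c, a) \<in> arc_inversions A" "a < b" "b < c" "b \<in> pm n" for a b c
    using that LR[of a] LR[of b] LR[of c] pq unfolding A by auto
  show "biclosed n (arc_inversions A)" "biclosed n (arc_inversions A - {(upper_end A, lower_end A)})"
    unfolding biclosed_def trans_def using sub vac co by blast+
qed

text \<open>Exchanging the sides of an arc turns its noninversions into inversions.\<close>

lemma biclosed_arc_noninversions:
  assumes "is_arc n A"
  shows "biclosed n (all_inversions n - arc_noninversions A)"
proof -
  obtain q p L R where A: "A = Arc q p L R" by (cases A)
  have "arc_noninversions A = arc_inversions (Arc q p R L)" "is_arc n (Arc q p R L)"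
    using assms unfolding A by auto
  then show ?thesis
    using biclosed_complement biclosed_arc_inversions(1) by metis
qed

lemma arc_inversions_label:
  assumes x: "x \<in> S2n n" and d: "descent n x q p"
  shows "arc_inversions (label n x q p) \<subseteq> inversions n x"
  using descent_pm[OF x d] unfolding label_def by (auto simp: inversions_iff[OF x])

section \<open>Contraction of arcs by a congruence of all permutations\<close>

definition arc_perm :: "nat \<Rightarrow> arc \<Rightarrow> int \<Rightarrow> int" where
  "arc_perm n A = perm_of n (arc_inversions A)"

definition arc_perm_lower :: "nat \<Rightarrow> arc \<Rightarrow> int \<Rightarrow> int" where
  "arc_perm_lower n A = perm_of n (arc_inversions A - {(upper_end A, lower_end A)})"

lemma arc_perm:
  assumes "is_arc n A"
  shows "arc_perm n A \<in> S2n n" "inversions n (arc_perm n A) = arc_inversions A"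
    "arc_perm_lower n A \<in> S2n n"
    "inversions n (arc_perm_lower n A) = arc_inversions A - {(upper_end A, lower_end A)}"
  unfolding arc_perm_def arc_perm_lower_def
  using perm_of[OF biclosed_arc_inversions(1)[OF assms]] perm_of[OF biclosed_arc_inversions(2)[OF assms]]
  by auto

text \<open>Contraction is tested below the smallest permutation with this label; by
  \<open>contracts_arc_label\<close> every cover with the same label gives the same answer.\<close>

definition contracts_arc :: "nat \<Rightarrow> (int \<Rightarrow> int) rel \<Rightarrow> arc \<Rightarrow> bool" where
  "contracts_arc n \<Phi> A \<longleftrightarrow> (arc_perm n A, arc_perm_lower n A) \<in> \<Phi>"

context
  fixes n :: nat and \<Phi> :: "(int \<Rightarrow> int) rel"
  assumes \<Phi>: "lattice_congruence (weak_S2n n) \<Phi>"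
begin

lemma S2n_X: "S2n n = S2n n \<or> S2n n = Bn n"
  by simp

lemma congruence_equiv: "equiv (S2n n) \<Phi>"
  and congruence_meet: "(x, x') \<in> \<Phi> \<Longrightarrow> (y, y') \<in> \<Phi> \<Longrightarrow> (perm_meet n x y, perm_meet n x' y') \<in> \<Phi>"
  and congruence_join: "(x, x') \<in> \<Phi> \<Longrightarrow> (y, y') \<in> \<Phi> \<Longrightarrow> (perm_join n x y, perm_join n x' y') \<in> \<Phi>"
  using \<Phi> unfolding lattice_congruence_weak_order[OF S2n_X] by blast+

lemma congruence_refl: "x \<in> S2n n \<Longrightarrow> (x, x) \<in> \<Phi>"
  using congruence_equiv by (simp add: equiv_class_eq_iff)

lemma congruence_sym: "(x, y) \<in> \<Phi> \<Longrightarrow> (y, x) \<in> \<Phi>"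
  using congruence_equiv by (meson equivE symD)

lemma congruence_trans: "(x, y) \<in> \<Phi> \<Longrightarrow> (y, z) \<in> \<Phi> \<Longrightarrow> (x, z) \<in> \<Phi>"
  using congruence_equiv by (meson equivE transD)

text \<open>The two covers are perspective: meeting with \<open>arc_perm\<close> carries the cover
  below \<open>x\<close> to the cover below \<open>arc_perm\<close>, and joining with
  \<open>remove n x q p\<close> carries it back.\<close>

lemma contracts_arc_label:
  assumes x: "x \<in> S2n n" and d: "descent n x q p"
  shows "(x, remove n x q p) \<in> \<Phi> \<longleftrightarrow> contracts_arc n \<Phi> (label n x q p)"
proof -
  let ?A = "label n x q p" and ?y = "remove n x q p"
  note A = arc_perm[OF is_arc_label[OF x d], unfolded label_ends] and y = remove[OF x d]
  have le: "arc_inversions ?A \<subseteq> inversions n x"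
    by (rule arc_inversions_label[OF x d])
  have qp: "(q, p) \<in> arc_inversions ?A" "(q, p) \<in> inversions n x"
    using descent_pm[OF x d] d by (auto simp: label_def descent_def)
  have m: "perm_meet n x (arc_perm n ?A) = arc_perm n ?A"
    using le A x by (intro perm_meet_absorb[OF S2n_X]) auto
  have m': "perm_meet n ?y (arc_perm n ?A) = arc_perm_lower n ?A"
  proof (rule inversions_inj[OF perm_meet(1)[OF S2n_X y(1) A(1)] A(3)])
    have "inversions n (arc_perm_lower n ?A) \<subseteq> inversions n (perm_meet n ?y (arc_perm n ?A))"
      using le A y by (intro perm_meet_greatest[OF S2n_X]) auto
    moreover have "inversions n (perm_meet n ?y (arc_perm n ?A)) \<subseteq> inversions n (arc_perm_lower n ?A)"
      using perm_meet_lower[OF S2n_X y(1) A(1)] unfolding A(2,4) y(2) by blast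
    ultimately show "inversions n (perm_meet n ?y (arc_perm n ?A)) = inversions n (arc_perm_lower n ?A)"
      by (rule subset_antisym[rotated])
  qed
  have j: "perm_join n (arc_perm n ?A) ?y = x"
  proof (rule inversions_inj[OF perm_join(1)[OF S2n_X A(1) y(1)] x])
    have "inversions n (perm_join n (arc_perm n ?A) ?y) \<subseteq> inversions n x"
      using le A x y by (intro perm_join_least[OF S2n_X]) auto
    moreover have "inversions n x \<subseteq> inversions n (perm_join n (arc_perm n ?A) ?y)"
      using perm_join_upper[OF S2n_X A(1) y(1)] A(2) y(2) qp by auto
    ultimately show "inversions n (perm_join n (arc_perm n ?A) ?y) = inversions n x"
      by (rule subset_antisym)
  qed
  have j': "perm_join n (arc_perm_lower n ?A) ?y = ?y"
    using le A x y by (intro perm_join_absorb[OF S2n_X]) auto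
  show ?thesis
    unfolding contracts_arc_def
    using congruence_meet[OF _ congruence_refl[OF A(1)], of x ?y] congruence_join[OF _ congruence_refl[OF y(1)], of "arc_perm n ?A"]
    by (metis m m' j j')
qed

text \<open>If the arc \<open>B\<close> is part of the arc \<open>A\<close>, then the inversions of \<open>A\<close> are generated by those of
  \<open>B\<close> together with those of the parts of \<open>A\<close> above and below \<open>B\<close>. This fails once the inversion
  of the endpoints of \<open>B\<close> is dropped.\<close>
lemma contracts_arc_mono:
  assumes A: "is_arc n A" and B: "is_arc n B" and sub: "arc_subarc B A"
    and contr: "contracts_arc n \<Phi> B"
  shows "contracts_arc n \<Phi> A"
proof -
  obtain q p L R where Aeq: "A = Arc q p L R" by (cases A)
  obtain q' p' where Beq: "B = Arc q' p' (L \<inter> {p'<..<q'}) (R \<inter> {p'<..<q'})"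
    using sub unfolding Aeq by (cases B) auto
  have LR: "c \<in> L \<or> c \<in> R \<longleftrightarrow> p < c \<and> c < q \<and> c \<in> pm n" "\<not> (c \<in> L \<and> c \<in> R)" for c
    using A Aeq by auto
  have pm: "p \<in> pm n" "q \<in> pm n" "p' \<in> pm n" "q' \<in> pm n" and le: "p \<le> p'" "p' < q'" "q' \<le> q"
    using A B sub unfolding Aeq Beq by auto
  \<comment> \<open>\<open>I b a\<close> collects the inversions of the part of \<open>A\<close>
    between \<open>b\<close> and \<open>a\<close>. The arc is cut into the parts from
    \<open>q\<close> to \<open>q'\<close>, from \<open>q'\<close> to \<open>p'\<close> (this is
    \<open>B\<close>) and from \<open>p'\<close> to \<open>p\<close>.\<close>
  define I where "I b a = {(x, y). a \<le> y \<and> y < x \<and> x \<le> b \<and> x \<in> insert b L \<and> y \<in> insert a R}" for a b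
  have biclosed_I: "biclosed n (I b a)" if "a \<in> pm n" "b \<in> pm n" "p \<le> a" "b \<le> q" for a b
  proof -
    have "I b a \<subseteq> all_inversions n"
      using that LR unfolding I_def all_inversions_def by auto
    moreover have False if "(z, y) \<in> I b a" "(y, x) \<in> I b a" for x y z
      using that LR[of y] unfolding I_def by auto
    moreover have "(z, y) \<in> I b a \<or> (y, x) \<in> I b a" if "(z, x) \<in> I b a" "x < y" "y < z" "y \<in> pm n" for x y z
      using that LR[of y] \<open>p \<le> a\<close> \<open>b \<le> q\<close> unfolding I_def by auto
    ultimately show ?thesis unfolding biclosed_def trans_def by blast
  qed
  let ?x = "perm_of n (I q q')" and ?y = "perm_of n (I p' p)"
  let ?j = "arc_perm n A" and ?j' = "arc_perm_lower n A" and ?k = "arc_perm n B" and ?k' = "arc_perm_lower n B"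
  have x: "?x \<in> S2n n" "inversions n ?x = I q q'" and y: "?y \<in> S2n n" "inversions n ?y = I p' p"
    using perm_of[OF biclosed_I] pm le by auto
  note j = arc_perm[OF A] and k = arc_perm[OF B]
  have arcB: "arc_inversions B = I q' p'"
    unfolding Beq I_def using le by auto
  define z where "z = perm_join n ?x ?y"
  have z: "z \<in> S2n n" "inversions n z = (I q q' \<union> I p' p)\<^sup>+"
    unfolding z_def using perm_join[OF S2n_X x(1) y(1)] x y by auto
  define w where "w = perm_join n ?k z"
  define w' where "w' = perm_join n ?k' z"
  have w: "w \<in> S2n n" "inversions n w = (I q' p' \<union> inversions n z)\<^sup>+"
    unfolding w_def using perm_join[OF S2n_X k(1) z(1)] k(2) arcB by auto
  have w': "w' \<in> S2n n" "inversions n w' = ((I q' p' - {(q', p')}) \<union> inversions n z)\<^sup>+"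
    unfolding w'_def using perm_join[OF S2n_X k(3) z(1)] k(4) arcB by (auto simp: Beq)
  have ww': "(w, w') \<in> \<Phi>"
    unfolding w_def w'_def using contr z(1)
    by (intro congruence_join congruence_refl) (simp_all add: contracts_arc_def)
  \<comment> \<open>A pair of \<open>A\<close> that reaches over a cut point is composed at that
    point, which is an end of both neighbouring parts on whichever side \<open>A\<close> passes
    it.\<close>
  have "arc_inversions A \<subseteq> inversions n w"
  proof -
    have tr: "(a, c) \<in> inversions n w" if "(a, b) \<in> inversions n w" "(b, c) \<in> inversions n w" for a b c
      using that unfolding w(2) by (rule trancl_trans)
    have g: "(a, b) \<in> inversions n w" if "(a, b) \<in> I q q' \<or> (a, b) \<in> I q' p' \<or> (a, b) \<in> I p' p" for a b
      using that unfolding w(2) z(2) by blast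
    have 2: "(a, b) \<in> inversions n w"
      if ab: "a \<in> insert q L" "b < a" "a \<le> q" "b \<in> insert p' R" "p' \<le> b" for a b
    proof -
      consider "a \<le> q'" | "q' \<le> b" | "b < q'" "q' < a" by linarith
      then show ?thesis
      proof cases
        case 1
        then show ?thesis using ab le g[of a b] unfolding I_def by auto
      next
        case 2
        then show ?thesis using ab le g[of a b] unfolding I_def by auto
      next
        case 3
        then have "(a, q') \<in> inversions n w" "(q', b) \<in> inversions n w"
          using ab le g[of a q'] g[of q' b] unfolding I_def by auto
        then show ?thesis by (rule tr)
      qed
    qed
    have 1: "(a, b) \<in> inversions n w"
      if ab: "a \<in> insert q L" "b < a" "a \<le> q" "b \<in> insert p R" "p \<le> b" for a b
    proof -
      consider "p' \<le> b" "b \<noteq> p \<or> p = p'" | "a \<le> p'" | "b < p'" "p' < a" using le by linarith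
      then show ?thesis
      proof cases
        case 1
        then show ?thesis using ab le 2[of a b] by auto
      next
        case 2
        then show ?thesis using ab le g[of a b] unfolding I_def by auto
      next
        case 3
        then have "(a, p') \<in> inversions n w" "(p', b) \<in> inversions n w"
          using ab le 2[of a p'] g[of p' b] unfolding I_def by auto
        then show ?thesis by (rule tr)
      qed
    qed
    have "(a, b) \<in> inversions n w" if "a \<in> insert q L" "b < a" "b \<in> insert p R" for a b
      using 1[of a b] that LR(1)[of a] LR(1)[of b] by auto
    then show ?thesis unfolding Aeq by auto
  qed
  then have mw: "perm_meet n w ?j = ?j"
    using w j by (intro perm_meet_absorb[OF S2n_X]) auto
  \<comment> \<open>An invariant for chains in \<open>w'\<close>: no generator leads out of
    \<open>S\<close>. The only generator of \<open>w\<close> that would leave it is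
    \<open>(q', p')\<close>, which has been dropped, whereas a chain from \<open>q\<close> to
    \<open>p\<close> has to leave it.\<close>
  define S where "S = {v. q' \<le> v} \<union> (R \<inter> {p'<..<q'})"
  define T where "T = {(u, v). u \<in> S \<longrightarrow> v \<in> S}"
  have T: "trans T" unfolding T_def trans_def by auto
  have closed: "X\<^sup>+ \<subseteq> T" if "X \<subseteq> T" for X
    using trancl_mono_subset[OF that] trancl_id[OF T] by simp
  have "I q q' \<subseteq> T" "I p' p \<subseteq> T"
    unfolding I_def T_def S_def using le by auto
  moreover have "I q' p' - {(q', p')} \<subseteq> T"
    unfolding I_def T_def S_def using LR(2) by auto
  ultimately have "inversions n w' \<subseteq> T"
    unfolding w'(2) z(2) by (intro closed Un_least) auto
  moreover have "(q, p) \<notin> T"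
    unfolding T_def S_def using le by auto
  ultimately have qp: "(q, p) \<notin> inversions n w'" by blast
  let ?u = "perm_meet n w' ?j"
  have u: "?u \<in> S2n n" "inversions n ?u \<subseteq> inversions n ?j" "inversions n ?u \<subseteq> inversions n w'"
    using perm_meet(1)[OF S2n_X w'(1) j(1)] perm_meet_lower[OF S2n_X w'(1) j(1)] by auto
  have "(?u, ?j) \<in> \<Phi>"
    using congruence_meet[OF ww' congruence_refl[OF j(1)]] unfolding mw by (rule congruence_sym)
  moreover have "inversions n ?u \<subseteq> inversions n ?j'" "inversions n ?j' \<subseteq> inversions n ?j"
    using u qp j by (auto simp: Aeq)
  ultimately have "(?j', ?j) \<in> \<Phi>"
    using congruence_convex(2)[OF S2n_X \<Phi>] j(3) by blast
  then show ?thesis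
    unfolding contracts_arc_def by (rule congruence_sym)
qed

text \<open>Both removals lie in the interval from \<open>reduce n x q p\<close> to
  \<open>x\<close>, so convexity gives one direction; the lower end is their meet, which gives the
  other.\<close>

lemma contracts_reduce:
  assumes x: "x \<in> Bn n" and d: "descent n x q p"
  shows "(x, reduce n x q p) \<in> \<Phi> \<longleftrightarrow>
    contracts_arc n \<Phi> (label n x q p) \<and> contracts_arc n \<Phi> (half_turn (label n x q p))"
proof -
  have S: "x \<in> S2n n" using x by (simp add: Bn_iff)
  note d' = descent_uminus[OF x d]
  note r = reduce[OF x d] and y = remove[OF S d] and y' = remove[OF S d']
  have rS: "reduce n x q p \<in> S2n n" using r by (simp add: Bn_iff)
  have "(x, reduce n x q p) \<in> \<Phi> \<longleftrightarrow> (x, remove n x q p) \<in> \<Phi> \<and> (x, remove n x (- p) (- q)) \<in> \<Phi>"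
  proof
    assume "(x, reduce n x q p) \<in> \<Phi>"
    then have "(reduce n x q p, x) \<in> \<Phi>" by (rule congruence_sym)
    then have "(remove n x q p, x) \<in> \<Phi>" "(remove n x (- p) (- q), x) \<in> \<Phi>"
      using y y' r(2) by (auto intro!: congruence_convex(2)[OF S2n_X \<Phi>, of "reduce n x q p"])
    then show "(x, remove n x q p) \<in> \<Phi> \<and> (x, remove n x (- p) (- q)) \<in> \<Phi>"
      by (simp add: congruence_sym)
  next
    assume "(x, remove n x q p) \<in> \<Phi> \<and> (x, remove n x (- p) (- q)) \<in> \<Phi>"
    then have "(perm_meet n x x, reduce n x q p) \<in> \<Phi>"
      unfolding reduce_def by (intro congruence_meet) auto
    then show "(x, reduce n x q p) \<in> \<Phi>"
      using perm_meet_absorb(1)[OF S2n_X S S] by simp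
  qed
  then show ?thesis
    using contracts_arc_label[OF S d] contracts_arc_label[OF S d'] half_turn_label[OF x] by simp
qed

end

section \<open>From sets of arcs to congruences\<close>

definition arc_congruence :: "nat \<Rightarrow> arc set \<Rightarrow> (int \<Rightarrow> int) rel" where
  "arc_congruence n U = {(x, y). x \<in> S2n n \<and> y \<in> S2n n \<and>
     (\<forall>A \<in> U. arc_inversions A \<subseteq> inversions n x \<longleftrightarrow> arc_inversions A \<subseteq> inversions n y)}"

definition dual_arc_congruence :: "nat \<Rightarrow> arc set \<Rightarrow> (int \<Rightarrow> int) rel" where
  "dual_arc_congruence n U = {(x, y). x \<in> S2n n \<and> y \<in> S2n n \<and>
     (\<forall>A \<in> U. arc_noninversions A \<inter> inversions n x = {} \<longleftrightarrow> arc_noninversions A \<inter> inversions n y = {})}"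

text \<open>Extends inclusion of one relation in another from covers to comparable pairs: descend
  from \<open>x\<close> to \<open>z\<close> one descent at a time, where convexity of
  \<open>\<Phi>\<close> keeps each step in \<open>\<Phi>\<close>.\<close>

lemma chain_induct:
  assumes convex: "\<And>x y z. \<lbrakk>x \<in> S2n n; y \<in> S2n n; z \<in> S2n n; inversions n z \<subseteq> inversions n y;
      inversions n y \<subseteq> inversions n x; (x, z) \<in> \<Phi>\<rbrakk> \<Longrightarrow> (x, y) \<in> \<Phi> \<and> (y, z) \<in> \<Phi>"
    and edge: "\<And>x q p. \<lbrakk>x \<in> S2n n; descent n x q p; (x, remove n x q p) \<in> \<Phi>\<rbrakk> \<Longrightarrow> (x, remove n x q p) \<in> \<Psi>"
    and refl: "\<And>x. x \<in> S2n n \<Longrightarrow> (x, x) \<in> \<Psi>" and trans: "trans \<Psi>"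
  shows "\<lbrakk>x \<in> S2n n; z \<in> S2n n; inversions n z \<subseteq> inversions n x; (x, z) \<in> \<Phi>\<rbrakk> \<Longrightarrow> (x, z) \<in> \<Psi>"
proof (induction "card (inversions n x)" arbitrary: x rule: less_induct)
  case less
  show ?case
  proof (cases "inversions n z = inversions n x")
    case True
    then have "x = z" using less.prems inversions_inj by metis
    then show ?thesis using refl less.prems by simp
  next
    case False
    then have "inversions n z \<subset> inversions n x" using less.prems by blast
    then obtain q p where d: "descent n x q p" "(q, p) \<notin> inversions n z"
      using ex_descent less.prems(1,2) by blast
    note r = remove[OF less.prems(1) d(1)]
    have le: "inversions n z \<subseteq> inversions n (remove n x q p)"
      "inversions n (remove n x q p) \<subseteq> inversions n x"
      using r d less.prems by auto
    have "(q, p) \<in> inversions n x" using d(1) by (simp add: descent_def)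
    then have card: "card (inversions n (remove n x q p)) < card (inversions n x)"
      unfolding r(2) using finite_inversions[OF less.prems(1)] by (meson card_Diff1_less)
    have c: "(x, remove n x q p) \<in> \<Phi>" "(remove n x q p, z) \<in> \<Phi>"
      using convex[OF less.prems(1) r(1) less.prems(2) le less.prems(4)] by auto
    have "(x, remove n x q p) \<in> \<Psi>" by (rule edge[OF less.prems(1) d(1) c(1)])
    moreover have "(remove n x q p, z) \<in> \<Psi>"
      by (rule less.hyps[OF card r(1) less.prems(2) le(1) c(2)])
    ultimately show ?thesis using trans by (meson transD)
  qed
qed

context
  fixes n :: nat and U :: "arc set"
  assumes arcs: "\<And>A. A \<in> U \<Longrightarrow> is_arc n A"
    and closed: "\<And>A B. A \<in> U \<Longrightarrow> is_arc n B \<Longrightarrow> arc_subarc B A \<Longrightarrow> B \<in> U"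
begin

text \<open>The cover changes a single pair, so an arc \<open>B\<close> of \<open>U\<close> can
  detect it only if \<open>(q, p)\<close> is among the pairs of \<open>B\<close>. Then
  \<open>q\<close> and \<open>p\<close> lie on \<open>B\<close> or on its proper sides, the
  remaining pairs of \<open>B\<close> force the values in between onto the same sides in
  \<open>x\<close>, and the label is a subarc of \<open>B\<close>. Closure of \<open>U\<close> turns
  this into membership of the label.\<close>

lemma arc_congruence_cover:
  assumes x: "x \<in> S2n n" and d: "descent n x q p"
  shows "(x, remove n x q p) \<in> arc_congruence n U \<longleftrightarrow> label n x q p \<notin> U"
    and "(x, remove n x q p) \<in> dual_arc_congruence n U \<longleftrightarrow> label n x q p \<notin> U"
proof -
  let ?A = "label n x q p" and ?y = "remove n x q p"
  note i = inversions_iff[OF x] and y = remove[OF x d] and pq = descent_pm[OF x d]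
  have A: "is_arc n ?A" by (rule is_arc_label[OF x d])
  have qp: "(q, p) \<in> inversions n x" using d by (simp add: descent_def)
  \<comment> \<open>\<open>side\<close> compares each \<open>c\<close> with the far end only,
    because that is what the pairs of \<open>B\<close> supply; adjacency of \<open>q\<close> and
    \<open>p\<close> extends it to both ends.\<close>
  have sub: "arc_subarc ?A B"
    if "B = Arc q0 p0 L R" "is_arc n B" "p0 \<le> p" "q \<le> q0"
      and side: "\<And>c. \<lbrakk>p < c; c < q; c \<in> pm n\<rbrakk> \<Longrightarrow>
        (c \<in> L \<longrightarrow> inv x c < inv x p) \<and> (c \<in> R \<longrightarrow> inv x q < inv x c)" for B q0 p0 L R
  proof -
    have LR: "c \<in> L \<or> c \<in> R \<longleftrightarrow> p0 < c \<and> c < q0 \<and> c \<in> pm n" for c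
      using that(1,2) by auto
    have "c \<in> L \<longleftrightarrow> inv x c < inv x q" "c \<in> R \<longleftrightarrow> inv x p < inv x c" if c: "p < c" "c < q" "c \<in> pm n" for c
      using descent_total[OF x d c(3)] side[OF c] LR[of c] c \<open>p0 \<le> p\<close> \<open>q \<le> q0\<close> by auto
    moreover have "L \<subseteq> pm n" "R \<subseteq> pm n" using LR by auto
    ultimately have "{c \<in> pm n. p < c \<and> c < q \<and> inv x c < inv x q} = L \<inter> {p<..<q}"
      "{c \<in> pm n. p < c \<and> c < q \<and> inv x p < inv x c} = R \<inter> {p<..<q}"
      by (blast intro: greaterThanLessThan_iff[THEN iffD2] dest: greaterThanLessThan_iff[THEN iffD1])+
    then show ?thesis
      using that(3,4) unfolding label_def \<open>B = _\<close> by simp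
  qed
  have incl: "arc_inversions B \<subseteq> inversions n ?y"
    if notin: "?A \<notin> U" and B: "B \<in> U" "arc_inversions B \<subseteq> inversions n x" for B
  proof (rule ccontr)
    obtain q0 p0 L R where Beq: "B = Arc q0 p0 L R" by (cases B)
    have LR0: "c \<in> L \<or> c \<in> R \<longleftrightarrow> p0 < c \<and> c < q0 \<and> c \<in> pm n" "p0 < q0" for c
      using arcs[OF B(1)] unfolding Beq by auto
    assume "\<not> ?thesis"
    then have "(q, p) \<in> arc_inversions B" using B(2) y(2) by auto
    then have qp0: "q \<in> insert q0 L" "p \<in> insert p0 R" unfolding Beq by auto
    have sd: "(c \<in> L \<longrightarrow> inv x c < inv x p) \<and> (c \<in> R \<longrightarrow> inv x q < inv x c)" if "p < c" "c < q" for c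
      using subsetD[OF B(2), of "(c, p)"] subsetD[OF B(2), of "(q, c)"] qp0 that
      unfolding Beq by (auto simp: i)
    have "p0 \<le> p" "q \<le> q0"
      using qp0 LR0(1)[of p] LR0(1)[of q] LR0(2) by auto
    from sub[OF Beq arcs[OF B(1)] this sd] show False
      using closed[OF B(1) A] notin by blast
  qed
  have disj: "arc_noninversions B \<inter> inversions n x = {}"
    if notin: "?A \<notin> U" and B: "B \<in> U" "arc_noninversions B \<inter> inversions n ?y = {}" for B
  proof (rule ccontr)
    obtain q0 p0 L R where Beq: "B = Arc q0 p0 L R" by (cases B)
    have LR0: "c \<in> L \<or> c \<in> R \<longleftrightarrow> p0 < c \<and> c < q0 \<and> c \<in> pm n" "p0 < q0" for c
      using arcs[OF B(1)] unfolding Beq by auto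
    assume "\<not> ?thesis"
    then have "(q, p) \<in> arc_noninversions B" using B(2) y(2) by auto
    then have qp0: "p \<in> insert p0 L" "q \<in> insert q0 R" unfolding Beq by auto
    have nin: "(b, a) \<notin> inversions n x" if "(b, a) \<in> arc_noninversions B" "(b, a) \<noteq> (q, p)" for a b
      using B(2) that unfolding y(2) by blast
    have sd: "(c \<in> L \<longrightarrow> inv x c < inv x p) \<and> (c \<in> R \<longrightarrow> inv x q < inv x c)"
      if "p < c" "c < q" "c \<in> pm n" for c
      using nin[of q c] nin[of c p] qp0 that descent_total[OF x d that(3)] pq
      unfolding Beq by (auto simp: i)
    have "p0 \<le> p" "q \<le> q0"
      using qp0 LR0(1)[of p] LR0(1)[of q] LR0(2) by auto
    from sub[OF Beq arcs[OF B(1)] this sd] show False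
      using closed[OF B(1) A] notin by blast
  qed
  have "arc_inversions ?A \<subseteq> inversions n x" "\<not> arc_inversions ?A \<subseteq> inversions n ?y"
    using arc_inversions_label[OF x d] pq unfolding y(2) by (auto simp: label_def)
  with incl show "(x, ?y) \<in> arc_congruence n U \<longleftrightarrow> ?A \<notin> U"
    unfolding arc_congruence_def using x y by auto
  have "arc_noninversions ?A \<inter> inversions n x \<noteq> {}"
    using pq qp by (auto simp: label_def)
  moreover have "arc_noninversions ?A \<inter> inversions n ?y = {}"
    using pq unfolding y(2) label_def by (auto simp: i)
  ultimately show "(x, ?y) \<in> dual_arc_congruence n U \<longleftrightarrow> ?A \<notin> U"
    unfolding dual_arc_congruence_def using x y disj by auto
qed

lemma trans_arc_congruence: "trans (arc_congruence n U)" "trans (dual_arc_congruence n U)"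
  by (auto simp: trans_def arc_congruence_def dual_arc_congruence_def)

lemma sym_arc_congruence: "sym (arc_congruence n U)" "sym (dual_arc_congruence n U)"
  by (auto simp: sym_def arc_congruence_def dual_arc_congruence_def)

text \<open>Containing the inversions of an arc means lying above the one permutation
  \<open>arc_perm n A\<close>, and principal filters respect meets.\<close>

lemma arc_inversions_perm_meet:
  assumes "A \<in> U" "x \<in> S2n n" "y \<in> S2n n"
  shows "arc_inversions A \<subseteq> inversions n (perm_meet n x y) \<longleftrightarrow>
    arc_inversions A \<subseteq> inversions n x \<and> arc_inversions A \<subseteq> inversions n y"
proof -
  have X: "S2n n = S2n n \<or> S2n n = Bn n" by simp
  note a = arc_perm[OF arcs[OF assms(1)]]
  show ?thesis
    using perm_meet_greatest[OF X assms(2,3) a(1)] perm_meet_lower[OF X assms(2,3)] a(2) by blast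
qed

text \<open>Avoiding the noninversions of an arc means lying below one permutation, and principal
  ideals respect joins.\<close>

lemma arc_noninversions_perm_join:
  assumes "A \<in> U" "x \<in> S2n n" "y \<in> S2n n"
  shows "arc_noninversions A \<inter> inversions n (perm_join n x y) = {} \<longleftrightarrow>
    arc_noninversions A \<inter> inversions n x = {} \<and> arc_noninversions A \<inter> inversions n y = {}"
proof -
  have X: "S2n n = S2n n \<or> S2n n = Bn n" by simp
  note b = perm_of[OF biclosed_arc_noninversions[OF arcs[OF assms(1)]]]
  have "inversions n z \<subseteq> all_inversions n - arc_noninversions A \<longleftrightarrow> arc_noninversions A \<inter> inversions n z = {}"
    if "z \<in> S2n n" for z
    using inversions_subset_all[OF that] by blast
  then show ?thesis
    using perm_join_least[OF X assms(2,3) b(1)] perm_join_upper[OF X assms(2,3)] b(2) perm_join(1)[OF X assms(2,3)] assms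
    by (metis subset_trans)
qed

text \<open>Each relation is so far compatible with one operation only, and that is enough: related
  \<open>x\<close> and \<open>y\<close> are related to their meet (for the first relation) or join
  (for the second), which leaves comparable pairs, and these reduce to covers.\<close>

lemma arc_congruence_eq_dual: "arc_congruence n U = dual_arc_congruence n U"
proof -
  have X: "S2n n = S2n n \<or> S2n n = Bn n" by simp
  let ?\<Phi> = "arc_congruence n U" and ?\<Psi> = "dual_arc_congruence n U"
  have cov: "(x, remove n x q p) \<in> ?\<Phi> \<longleftrightarrow> (x, remove n x q p) \<in> ?\<Psi>"
    if "x \<in> S2n n" "descent n x q p" for x q p
    using arc_congruence_cover[OF that] by simp
  have down: "(x, z) \<in> ?\<Psi>"
    if "(x, z) \<in> ?\<Phi>" "x \<in> S2n n" "z \<in> S2n n" "inversions n z \<subseteq> inversions n x" for x z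
  proof (rule chain_induct[where \<Phi> = ?\<Phi>])
    show "(x, y) \<in> ?\<Phi> \<and> (y, z) \<in> ?\<Phi>"
      if "x \<in> S2n n" "y \<in> S2n n" "z \<in> S2n n" "inversions n z \<subseteq> inversions n y"
        "inversions n y \<subseteq> inversions n x" "(x, z) \<in> ?\<Phi>" for x y z
      using that unfolding arc_congruence_def by blast
  qed (use that cov trans_arc_congruence in \<open>auto simp: dual_arc_congruence_def\<close>)
  have up: "(x, z) \<in> ?\<Phi>"
    if "(x, z) \<in> ?\<Psi>" "x \<in> S2n n" "z \<in> S2n n" "inversions n z \<subseteq> inversions n x" for x z
  proof (rule chain_induct[where \<Phi> = ?\<Psi>])
    show "(x, y) \<in> ?\<Psi> \<and> (y, z) \<in> ?\<Psi>"
      if "x \<in> S2n n" "y \<in> S2n n" "z \<in> S2n n" "inversions n z \<subseteq> inversions n y"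
        "inversions n y \<subseteq> inversions n x" "(x, z) \<in> ?\<Psi>" for x y z
      using that unfolding dual_arc_congruence_def by blast
  qed (use that cov trans_arc_congruence in \<open>auto simp: arc_congruence_def\<close>)
  have "(x, y) \<in> ?\<Psi>" if xy: "(x, y) \<in> ?\<Phi>" for x y
  proof -
    have S: "x \<in> S2n n" "y \<in> S2n n" using xy by (auto simp: arc_congruence_def)
    note m = perm_meet(1)[OF X S] perm_meet_lower[OF X S]
    have "(x, perm_meet n x y) \<in> ?\<Phi>" "(y, perm_meet n x y) \<in> ?\<Phi>"
      using xy S m(1) arc_inversions_perm_meet[OF _ S] by (auto simp: arc_congruence_def)
    then have "(x, perm_meet n x y) \<in> ?\<Psi>" "(y, perm_meet n x y) \<in> ?\<Psi>"
      using down S m by auto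
    then show ?thesis
      using trans_arc_congruence sym_arc_congruence by (meson symD transD)
  qed
  moreover have "(x, y) \<in> ?\<Phi>" if xy: "(x, y) \<in> ?\<Psi>" for x y
  proof -
    have S: "x \<in> S2n n" "y \<in> S2n n" using xy by (auto simp: dual_arc_congruence_def)
    note j = perm_join(1)[OF X S] perm_join_upper[OF X S]
    have "(perm_join n x y, x) \<in> ?\<Psi>" "(perm_join n x y, y) \<in> ?\<Psi>"
      using xy S j(1) arc_noninversions_perm_join[OF _ S] by (auto simp: dual_arc_congruence_def)
    then have "(perm_join n x y, x) \<in> ?\<Phi>" "(perm_join n x y, y) \<in> ?\<Phi>"
      using up S j by auto
    then show ?thesis
      using trans_arc_congruence sym_arc_congruence by (meson symD transD)
  qed
  ultimately show ?thesis by auto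
qed

lemma lattice_congruence_arc_congruence: "lattice_congruence (weak_S2n n) (arc_congruence n U)"
proof -
  have X: "S2n n = S2n n \<or> S2n n = Bn n" by simp
  have "equiv (S2n n) (arc_congruence n U)"
  proof (rule equivI)
    show "refl_on (S2n n) (arc_congruence n U)" "arc_congruence n U \<subseteq> S2n n \<times> S2n n"
      by (auto simp: refl_on_def arc_congruence_def)
  qed (use trans_arc_congruence sym_arc_congruence in auto)
  moreover have "(perm_meet n x y, perm_meet n x' y') \<in> arc_congruence n U"
    if "(x, x') \<in> arc_congruence n U" "(y, y') \<in> arc_congruence n U" for x x' y y'
    using that perm_meet(1)[OF X] arc_inversions_perm_meet by (simp add: arc_congruence_def)
  moreover have "(perm_join n x y, perm_join n x' y') \<in> arc_congruence n U"
    if "(x, x') \<in> arc_congruence n U" "(y, y') \<in> arc_congruence n U" for x x' y y'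
    using that perm_join(1)[OF X] arc_noninversions_perm_join unfolding arc_congruence_eq_dual
    by (simp add: dual_arc_congruence_def)
  ultimately show ?thesis
    unfolding lattice_congruence_weak_order[OF X] by blast
qed

lemma contracts_arc_congruence:
  assumes "x \<in> S2n n" "descent n x q p"
  shows "contracts_arc n (arc_congruence n U) (label n x q p) \<longleftrightarrow> label n x q p \<notin> U"
  using contracts_arc_label[OF lattice_congruence_arc_congruence assms] arc_congruence_cover(1)[OF assms]
  by simp

lemma symmetric_arc_congruence:
  assumes sym: "\<And>A. A \<in> U \<Longrightarrow> half_turn A \<in> U"
  shows "symmetric_congruence n (arc_congruence n U)"
proof -
  have imp: "(conjugate n x, conjugate n y) \<in> arc_congruence n U" if "(x, y) \<in> arc_congruence n U" for x y
  proof -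
    have S: "x \<in> S2n n" "y \<in> S2n n" using that by (auto simp: arc_congruence_def)
    have "arc_inversions A \<subseteq> mirror I \<longleftrightarrow> arc_inversions (half_turn A) \<subseteq> I" for A I
      unfolding arc_inversions_half_turn using mirror_mono mirror_mirror by metis
    then show ?thesis
      using that sym S by (simp add: arc_congruence_def conjugate_S2n inversions_conjugate)
  qed
  have "(x, y) \<in> arc_congruence n U \<longleftrightarrow> (conjugate n x, conjugate n y) \<in> arc_congruence n U"
    if "x \<in> S2n n" "y \<in> S2n n" for x y
    using imp[of x y] imp[of "conjugate n x" "conjugate n y"] that by (auto simp: conjugate_conjugate)
  then show ?thesis
    using lattice_congruence_arc_congruence by (simp add: symmetric_congruence_def conjugate_def)
qed

end

text \<open>Conjugation carries the cover that tests \<open>A\<close> to the one that tests its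
  half-turn, so under a symmetric congruence one arc of a pair decides for both.\<close>

lemma contracts_arc_half_turn:
  assumes \<Phi>: "symmetric_congruence n \<Phi>" and A: "is_arc n A"
  shows "contracts_arc n \<Phi> (half_turn A) \<longleftrightarrow> contracts_arc n \<Phi> A"
proof -
  note a = arc_perm[OF A] and b = arc_perm[of n "half_turn A"]
  have ends: "upper_end (half_turn A) = - lower_end A" "lower_end (half_turn A) = - upper_end A"
    by (cases A; simp)+
  have "arc_perm n (half_turn A) = conjugate n (arc_perm n A)"
    using a b A conjugate_S2n[OF a(1)]
    by (intro inversions_inj[of _ n]) (simp_all add: inversions_conjugate arc_inversions_half_turn)
  moreover have "arc_perm_lower n (half_turn A) = conjugate n (arc_perm_lower n A)"
    using a b A conjugate_S2n[OF a(3)] ends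
    by (intro inversions_inj[of _ n])
      (auto simp: inversions_conjugate arc_inversions_half_turn minus_equation_iff equation_minus_iff)
  ultimately show ?thesis
    using \<Phi> a(1,3) unfolding contracts_arc_def symmetric_congruence_def conjugate_def by simp
qed

section \<open>Congruences of the weak order on signed permutations\<close>

lemma lattice_congruence_restriction:
  assumes "lattice_congruence (weak_S2n n) \<Phi>"
  shows "lattice_congruence (weak_Bn n) (restriction \<Phi> (Bn n))"
proof -
  have X: "S2n n = S2n n \<or> S2n n = Bn n" and Y: "Bn n = S2n n \<or> Bn n = Bn n" by simp_all
  have E: "equiv (S2n n) \<Phi>"
    and comp: "\<And>x x' y y'. (x, x') \<in> \<Phi> \<Longrightarrow> (y, y') \<in> \<Phi> \<Longrightarrow>
      (perm_meet n x y, perm_meet n x' y') \<in> \<Phi> \<and> (perm_join n x y, perm_join n x' y') \<in> \<Phi>"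
    using assms unfolding lattice_congruence_weak_order[OF X] by blast+
  have "equiv (Bn n) (restriction \<Phi> (Bn n))"
  proof (rule equivI)
    show "restriction \<Phi> (Bn n) \<subseteq> Bn n \<times> Bn n"
      by (auto simp: restriction_def)
    show "refl_on (Bn n) (restriction \<Phi> (Bn n))"
      using E Bn_subset_S2n by (auto simp: restriction_def equiv_def refl_on_def)
    show "sym (restriction \<Phi> (Bn n))"
      using E by (auto simp: restriction_def equiv_def sym_def)
    show "trans (restriction \<Phi> (Bn n))"
      using E unfolding restriction_def equiv_def trans_def by blast
  qed
  then show ?thesis
    unfolding lattice_congruence_weak_order[OF Y] using comp perm_meet(1)[OF Y] perm_join(1)[OF Y]
    by (auto simp: restriction_def)
qed

text \<open>A congruence of this finite lattice is determined by the join-irreducibles it contracts.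
  Covers are traced back to join-irreducibles, comparable pairs are joined by chains of covers, and
  any pair is compared through its meet.\<close>

lemma congruence_subset:
  assumes \<Theta>: "lattice_congruence (weak_Bn n) \<Theta>" and \<Theta>': "lattice_congruence (weak_Bn n) \<Theta>'"
    and contr: "\<And>j. join_irreducible (weak_Bn n) j \<Longrightarrow> contracts (weak_Bn n) \<Theta> j \<Longrightarrow> contracts (weak_Bn n) \<Theta>' j"
  shows "\<Theta> \<subseteq> \<Theta>'"
proof -
  have X: "Bn n = S2n n \<or> Bn n = Bn n" by simp
  have E: "equiv (Bn n) \<Theta>" and E': "equiv (Bn n) \<Theta>'"
    and \<Theta>_meet: "\<And>x x' y y'. (x, x') \<in> \<Theta> \<Longrightarrow> (y, y') \<in> \<Theta> \<Longrightarrow> (perm_meet n x y, perm_meet n x' y') \<in> \<Theta>"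
    and \<Theta>'_join: "\<And>x x' y y'. (x, x') \<in> \<Theta>' \<Longrightarrow> (y, y') \<in> \<Theta>' \<Longrightarrow> (perm_join n x y, perm_join n x' y') \<in> \<Theta>'"
    using \<Theta> \<Theta>' unfolding lattice_congruence_weak_order[OF X] by blast+
  have refl: "(x, x) \<in> \<Theta>" "(x, x) \<in> \<Theta>'" if "x \<in> Bn n" for x
    using that E E' by (simp_all add: equiv_class_eq_iff)
  \<comment> \<open>Meeting with \<open>j\<close> carries the cover below \<open>x\<close> to the
    one below \<open>j\<close>, where the hypothesis applies; joining with
    \<open>reduce n x q p\<close> carries it back.\<close>
  have edge: "(x, reduce n x q p) \<in> \<Theta>'"
    if x: "x \<in> Bn n" and d: "descent n x q p" and xy: "(x, reduce n x q p) \<in> \<Theta>" for x q p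
  proof -
    obtain j where j: "sole_descent n j q p" "inversions n j \<subseteq> inversions n x"
      using ex_sole_descent[OF x d] .
    have jB: "j \<in> Bn n" "descent n j q p" using j(1) by (auto simp: sole_descent_def)
    note r = reduce[OF x d] and s = reduce[OF jB]
    have qp: "(q, p) \<in> inversions n j" "(- p, - q) \<in> inversions n j"
      using jB(2) descent_uminus[OF jB] by (simp_all add: descent_def)
    have "perm_meet n (reduce n x q p) j = reduce n j q p"
    proof (rule inversions_inj[of _ n])
      have "inversions n (reduce n j q p) \<subseteq> inversions n (perm_meet n (reduce n x q p) j)"
        using j(2) by (intro perm_meet_greatest[OF X r(1) jB(1) s(1)]) (auto simp: r s)
      moreover have "inversions n (perm_meet n (reduce n x q p) j) \<subseteq> inversions n (reduce n j q p)"
        using perm_meet_lower[OF X r(1) jB(1)] unfolding r(2) s(2) by blast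
      ultimately show "inversions n (perm_meet n (reduce n x q p) j) = inversions n (reduce n j q p)"
        by (rule subset_antisym[rotated])
    qed (use perm_meet(1)[OF X r(1) jB(1)] s(1) in \<open>auto simp: Bn_iff\<close>)
    then have "(j, reduce n j q p) \<in> \<Theta>"
      using \<Theta>_meet[OF xy refl(1)[OF jB(1)]] perm_meet_absorb(2)[OF X jB(1) x j(2)] by simp
    then have "(j, reduce n j q p) \<in> \<Theta>'"
      using contr[of j] j(1) contracts_weak_Bn join_irreducible_weak_Bn by blast
    from \<Theta>'_join[OF this refl(2)[OF r(1)]]
    have "(perm_join n j (reduce n x q p), perm_join n (reduce n j q p) (reduce n x q p)) \<in> \<Theta>'" .
    moreover have "perm_join n (reduce n j q p) (reduce n x q p) = reduce n x q p"
      using j(2) by (intro perm_join_absorb(1)[OF X s(1) r(1)]) (auto simp: r s)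
    moreover have "perm_join n j (reduce n x q p) = x"
    proof (rule inversions_inj[of _ n])
      have "inversions n (perm_join n j (reduce n x q p)) \<subseteq> inversions n x"
        using j(2) by (intro perm_join_least[OF X jB(1) r(1) x]) (auto simp: r)
      moreover have "inversions n x \<subseteq> inversions n (perm_join n j (reduce n x q p))"
        using perm_join_upper[OF X jB(1) r(1)] qp unfolding r(2) by blast
      ultimately show "inversions n (perm_join n j (reduce n x q p)) = inversions n x"
        by (rule subset_antisym)
    qed (use perm_join(1)[OF X jB(1) r(1)] x in \<open>auto simp: Bn_iff\<close>)
    ultimately show ?thesis by simp
  qed
  have down: "(x, z) \<in> \<Theta>'"
    if "x \<in> Bn n" "z \<in> Bn n" "inversions n z \<subseteq> inversions n x" "(x, z) \<in> \<Theta>" for x z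
    using that
  proof (induction "card (inversions n x)" arbitrary: x rule: less_induct)
    case less
    have S: "x \<in> S2n n" "z \<in> S2n n" using less.prems by (simp_all add: Bn_iff)
    show ?case
    proof (cases "inversions n z = inversions n x")
      case True
      then have "x = z" using S inversions_inj by metis
      then show ?thesis using refl less.prems by simp
    next
      case False
      then have "inversions n z \<subset> inversions n x" using less.prems by blast
      then obtain q p where d: "descent n x q p" "(q, p) \<notin> inversions n z"
        using ex_descent S by blast
      note r = reduce[OF less.prems(1) d(1)]
      have "(- p, - q) \<notin> inversions n z"
        using d(2) less.prems(2) by (metis Bn_iff mirror_iff minus_minus)
      then have le: "inversions n z \<subseteq> inversions n (reduce n x q p)"
        "inversions n (reduce n x q p) \<subseteq> inversions n x"
        using r d less.prems by auto
      have "(q, p) \<in> inversions n x" using d(1) by (simp add: descent_def)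
      then have "inversions n (reduce n x q p) \<subset> inversions n x"
        unfolding r(2) by blast
      then have card: "card (inversions n (reduce n x q p)) < card (inversions n x)"
        using finite_inversions[OF S(1)] by (rule psubset_card_mono[rotated])
      have zx: "(z, x) \<in> \<Theta>" using less.prems(4) E by (meson equivE symD)
      have c: "(x, reduce n x q p) \<in> \<Theta>" "(reduce n x q p, z) \<in> \<Theta>"
        using congruence_convex[OF X \<Theta> zx r(1) le] E by (meson equivE symD)+
      have "(x, reduce n x q p) \<in> \<Theta>'" by (rule edge[OF less.prems(1) d(1) c(1)])
      moreover have "(reduce n x q p, z) \<in> \<Theta>'"
        by (rule less.hyps[OF card r(1) less.prems(2) le(1) c(2)])
      ultimately show ?thesis using E' by (meson equivE transD)
    qed
  qed
  have "(x, y) \<in> \<Theta>'" if xy: "(x, y) \<in> \<Theta>" for x y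
  proof -
    have B: "x \<in> Bn n" "y \<in> Bn n" using xy E by (simp_all add: equiv_class_eq_iff)
    note m = perm_meet(1)[OF X B] perm_meet_lower[OF X B]
    have "(perm_meet n x x, perm_meet n x y) \<in> \<Theta>" "(perm_meet n x y, perm_meet n y y) \<in> \<Theta>"
      using \<Theta>_meet xy refl(1) B by blast+
    then have "(x, perm_meet n x y) \<in> \<Theta>" "(y, perm_meet n x y) \<in> \<Theta>"
      using perm_meet_absorb(1)[OF X] B E by (auto elim: equivE symD)
    then have "(x, perm_meet n x y) \<in> \<Theta>'" "(y, perm_meet n x y) \<in> \<Theta>'"
      using down B m by auto
    then show ?thesis using E' by (meson equivE symD transD)
  qed
  then show ?thesis by auto
qed

section \<open>Type-B arcs and join-irreducible signed permutations\<close>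

text \<open>One of the arcs that fold to the given one. For a long arc it is the right-hand arc of
  the pair: points right of the right piece stay on its right, points left of the left piece come to
  its right when negated, and all others are on its left.\<close>

fun unfold_arc :: "type_B_arc \<Rightarrow> arc" where
  "unfold_arc (Ordinary p q L R) = Arc q p L R"
| "unfold_arc (Orbifold p L R) = Arc p (- p) (L \<union> uminus ` R) (R \<union> uminus ` L)"
| "unfold_arc (Long p q L R) = Arc q (- p) ({- p<..<q} - {0} - (R \<union> uminus ` L)) (R \<union> uminus ` L)"

lemma is_arcI:
  assumes "p \<in> pm n" "q \<in> pm n" "p < q"
    and "\<And>c. c \<in> L \<or> c \<in> R \<longleftrightarrow> p < c \<and> c < q \<and> c \<in> pm n" "\<And>c. \<not> (c \<in> L \<and> c \<in> R)"
  shows "is_arc n (Arc q p L R)"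
proof -
  have "L \<union> R = {p<..<q} \<inter> pm n" "L \<inter> R = {}"
    unfolding set_eq_iff using assms(4,5) by auto
  then show ?thesis using assms(1-3) by simp
qed

text \<open>The permutation is written in blocks, each increasing. The block of
  \<open>insert p R\<close> begins with \<open>p\<close>, and \<open>q\<close> ends the last
  nonempty block before it, so \<open>q\<close> and \<open>p\<close> become adjacent with
  \<open>R\<close> after them and \<open>L\<close> before them.\<close>

lemma ex_Bn_label:
  assumes A: "is_arc n A" "A = Arc q p L R" and q: "0 < q"
    and Z: "\<And>c. c \<in> insert p R \<Longrightarrow> - c \<notin> insert p R"
    and fold: "- q \<notin> insert p R \<or> half_turn A = A"
  obtains x where "x \<in> Bn n" "descent n x q p" "label n x q p = A"
proof -
  let ?Z = "insert p R"
  \<comment> \<open>The block numbers: 1 for \<open>insert p R\<close>, -1 for its negatives, 2 and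
    -2 for the remaining values outside the interval from \<open>- q\<close> to \<open>q\<close>, 0
    for the rest. Hypothesis \<open>Z\<close> makes \<open>\<kappa>\<close> odd, so the permutation
    is signed.\<close>
  define \<kappa> :: "int \<Rightarrow> int" where "\<kappa> v = (if v \<in> ?Z then 1 else if - v \<in> ?Z then - 1
    else if q < v then 2 else if v < - q then - 2 else 0)" for v
  define I where "I = {(b, a) \<in> all_inversions n. \<kappa> b < \<kappa> a}"
  have LR: "c \<in> L \<or> c \<in> R \<longleftrightarrow> p < c \<and> c < q \<and> c \<in> pm n" "\<not> (c \<in> L \<and> c \<in> R)" for c
    using A by auto
  have pq: "p \<in> pm n" "q \<in> pm n" "p < q" using A by auto
  have "biclosed n I"
    unfolding biclosed_def trans_def I_def all_inversions_def by auto
  from biclosed_imp_inversions[OF this] obtain x where x: "x \<in> S2n n" "inversions n x = I" .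
  have "\<kappa> (- v) = - \<kappa> v" for v
    using Z q unfolding \<kappa>_def by auto
  then have "mirror I = I"
    by (auto simp: I_def all_inversions_def)
  then have xB: "x \<in> Bn n" using x by (simp add: Bn_iff)
  have pos: "inv x u < inv x v \<longleftrightarrow> \<kappa> u < \<kappa> v \<or> \<kappa> u = \<kappa> v \<and> u < v" if "u \<in> pm n" "v \<in> pm n" for u v
  proof -
    have "(a, b) \<in> I \<longleftrightarrow> b < a \<and> inv x a < inv x b" if "a \<in> pm n" "b \<in> pm n" for a b
      using inversions_iff[OF x(1), of a b] x(2) that by auto
    from this[of u v] this[of v u] show ?thesis
      using that pos_eq[OF x(1), of u v] by (auto simp: I_def all_inversions_def)
  qed
  have \<kappa>p: "\<kappa> p = 1" by (simp add: \<kappa>_def)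
  have R1: "\<kappa> c = 1" if "c \<in> R" for c using that by (simp add: \<kappa>_def)
  have q_notin: "q \<notin> ?Z" using LR pq by auto
  have Zge: "p \<le> c" if "c \<in> ?Z" for c using that LR(1)[of c] by auto
  have key: "\<kappa> q < 1 \<and> (\<forall>c \<in> pm n. (\<kappa> q < \<kappa> c \<or> \<kappa> q = \<kappa> c \<and> q < c) \<longrightarrow> \<not> (\<kappa> c < 1 \<or> \<kappa> c = 1 \<and> c < p)) \<and>
    (\<forall>c \<in> L. \<kappa> c < \<kappa> q \<or> \<kappa> c = \<kappa> q \<and> c < q)"
  proof (cases "- q \<in> ?Z")
    case False
    then have \<kappa>q: "\<kappa> q = 0" using q q_notin by (simp add: \<kappa>_def)
    have "\<not> (\<kappa> c < 1 \<or> \<kappa> c = 1 \<and> c < p)" if "\<kappa> q < \<kappa> c \<or> \<kappa> q = \<kappa> c \<and> q < c" for c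
      using that Zge[of c] unfolding \<kappa>q by (auto simp: \<kappa>_def split: if_splits)
    moreover have "\<kappa> c < \<kappa> q \<or> \<kappa> c = \<kappa> q \<and> c < q" if "c \<in> L" for c
      using that LR[of c] q unfolding \<kappa>q by (auto simp: \<kappa>_def)
    ultimately show ?thesis using \<kappa>q by auto
  next
    case True
    \<comment> \<open>The case of an orbifold arc: \<open>insert p R\<close> and its negatives
      exhaust the values from \<open>- q\<close> to \<open>q\<close>, so block 0 is empty and
      \<open>q\<close> ends block -1.\<close>
    then have sym: "p = - q" "L = uminus ` R"
      using fold A by auto
    have \<kappa>q: "\<kappa> q = - 1" using True q_notin by (simp add: \<kappa>_def)
    have "\<not> (\<kappa> c < 1 \<or> \<kappa> c = 1 \<and> c < p)"
      if c: "c \<in> pm n" and *: "\<kappa> q < \<kappa> c \<or> \<kappa> q = \<kappa> c \<and> q < c" for c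
    proof
      assume "\<kappa> c < 1 \<or> \<kappa> c = 1 \<and> c < p"
      then consider "\<kappa> c = 0" | "\<kappa> c = - 1" "q < c"
        using * Zge[of c] unfolding \<kappa>q by (auto simp: \<kappa>_def split: if_splits)
      then show False
      proof cases
        case 1
        then have nz: "c \<notin> ?Z" "- c \<notin> ?Z" "- q \<le> c" "c \<le> q"
          by (auto simp: \<kappa>_def split: if_splits)
        then have "p < c" "c < q" unfolding sym(1) by (auto simp: less_le)
        then have "c \<in> L" using LR(1)[of c] c nz by auto
        then show False using nz sym(2) by (simp add: mem_uminus_image)
      next
        case 2
        then have "- c \<in> ?Z" by (auto simp: \<kappa>_def split: if_splits)
        from Zge[OF this] show False using 2 sym by simp
      qed
    qed
    moreover have "\<kappa> c < \<kappa> q \<or> \<kappa> c = \<kappa> q \<and> c < q" if "c \<in> L" for c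
    proof -
      have "c \<notin> ?Z" "- c \<in> ?Z" "c < q" using that LR[of c] sym by (auto simp: mem_uminus_image)
      then show ?thesis unfolding \<kappa>q by (simp add: \<kappa>_def)
    qed
    ultimately show ?thesis using \<kappa>q by auto
  qed
  have d: "descent n x q p"
    unfolding descent_def inversions_iff[OF x(1)] using key pq \<kappa>p pos by auto
  have Lq: "inv x c < inv x q" if "c \<in> L" for c
    using that key pos[of c q] pq LR(1)[of c] by auto
  have Rp: "inv x p < inv x c" if "c \<in> R" for c
    using that R1[of c] \<kappa>p pos[of p c] pq LR(1)[of c] by auto
  have "c \<in> L \<longleftrightarrow> inv x c < inv x q" "c \<in> R \<longleftrightarrow> inv x p < inv x c" if "p < c" "c < q" "c \<in> pm n" for c
    using descent_total[OF x(1) d that(3)] that Lq[of c] Rp[of c] LR(1)[of c] by auto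
  moreover have "c \<in> pm n \<and> p < c \<and> c < q" if "c \<in> L \<or> c \<in> R" for c
    using that LR(1)[of c] by auto
  ultimately have "{c \<in> pm n. p < c \<and> c < q \<and> inv x c < inv x q} = L"
    "{c \<in> pm n. p < c \<and> c < q \<and> inv x p < inv x c} = R"
    by blast+
  then have "label n x q p = A" unfolding label_def A(2) by simp
  with xB d show thesis by (rule that)
qed

text \<open>\<open>ex_Bn_label\<close> realizes every type-B arc. The constraints on long arcs, that
  no point and no endpoint is on the wrong side, become its hypothesis \<open>Z\<close> for the
  unfolded arc.\<close>

lemma unfold_arc_properties:
  assumes "is_type_B_arc n \<alpha>"
  shows "is_arc n (unfold_arc \<alpha>)" "folds_to {unfold_arc \<alpha>, half_turn (unfold_arc \<alpha>)} \<alpha>"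
    "\<exists>x \<in> Bn n. \<exists>q p. descent n x q p \<and> label n x q p = unfold_arc \<alpha>"
proof -
  have "is_arc n (unfold_arc \<alpha>) \<and> folds_to {unfold_arc \<alpha>, half_turn (unfold_arc \<alpha>)} \<alpha> \<and>
    (\<exists>x \<in> Bn n. \<exists>q p. descent n x q p \<and> label n x q p = unfold_arc \<alpha>)"
  proof (cases \<alpha>)
    case (Ordinary p q L R)
    let ?A = "Arc q p L R"
    have LR: "L \<union> R = {p<..<q}" and p: "0 < p" "p < q"
      using assms Ordinary by auto
    have R: "0 < c" if "c \<in> insert p R" for c
    proof -
      have "c \<in> insert p {p<..<q}" using that LR by blast
      then show ?thesis using p by auto
    qed
    have Z: "- c \<notin> insert p R" if "c \<in> insert p R" for c
      using R[of c] R[of "- c"] that by auto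
    have qn: "- q \<notin> insert p R"
      using R[of "- q"] p by auto
    have arc: "is_arc n ?A"
      using assms Ordinary by (auto simp: pm_iff)
    moreover have "folds_to {?A, half_turn ?A} \<alpha>"
      using assms unfolding Ordinary by (intro fold_ordinary) auto
    moreover obtain x where "x \<in> Bn n" "descent n x q p" "label n x q p = ?A"
      using ex_Bn_label[OF arc refl _ Z] qn p by auto
    ultimately show ?thesis using Ordinary arc by auto
  next
    case (Orbifold p L R)
    let ?A = "unfold_arc \<alpha>"
    have LR: "c \<in> L \<or> c \<in> R \<longleftrightarrow> 0 < c \<and> c < p" "\<not> (c \<in> L \<and> c \<in> R)" for c
      using assms Orbifold by auto
    have p: "0 < p" "p \<le> int n" using assms Orbifold by auto
    have A: "?A = Arc p (- p) (L \<union> uminus ` R) (R \<union> uminus ` L)" using Orbifold by simp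
    have h: "half_turn ?A = ?A" unfolding A by (auto simp: image_Un image_image)
    have arc: "is_arc n ?A"
    proof -
      have "c \<in> L \<union> uminus ` R \<or> c \<in> R \<union> uminus ` L \<longleftrightarrow> - p < c \<and> c < p \<and> c \<in> pm n" for c
        using LR[of c] LR[of "- c"] p by (auto simp: mem_uminus_image pm_iff)
      moreover have "\<not> (c \<in> L \<union> uminus ` R \<and> c \<in> R \<union> uminus ` L)" for c
        using LR[of c] LR[of "- c"] by (auto simp: mem_uminus_image)
      ultimately show ?thesis
        using p unfolding A by (intro is_arcI) (auto simp: pm_iff simp del: Un_iff)
    qed
    have Z: "- c \<notin> insert (- p) (R \<union> uminus ` L)" if "c \<in> insert (- p) (R \<union> uminus ` L)" for c
      using that LR[of c] LR[of "- c"] LR[of p] p by (auto simp: mem_uminus_image)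
    obtain x where "x \<in> Bn n" "descent n x p (- p)" "label n x p (- p) = ?A"
      using ex_Bn_label[OF arc A p(1) Z] h by blast
    moreover have "folds_to {?A} \<alpha>"
    proof -
      have "c \<in> (L \<union> uminus ` R) \<inter> {0<..} \<longleftrightarrow> c \<in> L" "c \<in> (R \<union> uminus ` L) \<inter> {0<..} \<longleftrightarrow> c \<in> R" for c
        using LR(1)[of c] LR(1)[of "- c"] by (auto simp: mem_uminus_image)
      then have "(L \<union> uminus ` R) \<inter> {0<..} = L" "(R \<union> uminus ` L) \<inter> {0<..} = R"
        by blast+
      then show ?thesis
        using fold_orbifold[OF A p(1) h] Orbifold by simp
    qed
    ultimately show ?thesis using arc h by auto
  next
    case (Long p q L R)
    let ?A = "unfold_arc \<alpha>"
    let ?R = "R \<union> uminus ` L"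
    let ?L = "{- p<..<q} - {0} - ?R"
    have L: "0 < c \<and> c < p \<and> c \<notin> R" if "c \<in> L" for c using that assms Long by auto
    have R: "0 < c \<and> c < q \<and> c \<notin> L" if "c \<in> R" for c using that assms Long by auto
    have pq: "0 < p" "p \<le> int n" "0 < q" "q \<le> int n" "p \<noteq> q" "p \<notin> R" "q \<notin> L"
      using assms Long by auto
    have A: "?A = Arc q (- p) ?L ?R" using Long by simp
    have R': "c \<in> ?R \<longleftrightarrow> c \<in> R \<or> - c \<in> L" for c by (simp add: mem_uminus_image)
    have arc: "is_arc n ?A"
    proof -
      have "- p < c \<and> c < q \<and> c \<in> pm n" if "c \<in> ?R" for c
        using that L[of "- c"] R[of c] pq by (auto simp: R' pm_iff)
      then have "c \<in> ?L \<or> c \<in> ?R \<longleftrightarrow> - p < c \<and> c < q \<and> c \<in> pm n" for c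
        using pq by (auto simp: pm_iff simp del: Un_iff)
      then show ?thesis
        using pq unfolding A by (intro is_arcI) (auto simp: pm_iff simp del: Un_iff)
    qed
    have Z: "- c \<notin> insert (- p) ?R" if "c \<in> insert (- p) ?R" for c
      using that L[of c] L[of "- c"] R[of c] R[of "- c"] pq by (auto simp: mem_uminus_image)
    have qn: "- q \<notin> insert (- p) ?R"
      using pq R[of "- q"] by (auto simp: mem_uminus_image)
    obtain x where "x \<in> Bn n" "descent n x q (- p)" "label n x q (- p) = ?A"
      using ex_Bn_label[OF arc A pq(3) Z] qn by blast
    moreover have "folds_to {?A, half_turn ?A} \<alpha>"
    proof -
      have "uminus ` ?R \<inter> {0<..} = L" "?R \<inter> {0<..} = R"
        using L R by (auto simp: mem_uminus_image) force+
      \<comment> \<open>The smaller of \<open>p\<close> and \<open>q\<close> supplies the point: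
        \<open>p\<close> itself if \<open>p < q\<close>, and \<open>- q\<close> otherwise.\<close>
      moreover have "{p, - q} \<inter> ?L \<noteq> {}"
        using pq L[of "- p"] R[of "- q"] by (cases "p < q") (auto simp: mem_uminus_image)
      ultimately show ?thesis
        using fold_long[OF A pq(1,3,5)] Long by simp
    qed
    ultimately show ?thesis using arc by blast
  qed
  then show "is_arc n (unfold_arc \<alpha>)" "folds_to {unfold_arc \<alpha>, half_turn (unfold_arc \<alpha>)} \<alpha>"
    "\<exists>x \<in> Bn n. \<exists>q p. descent n x q p \<and> label n x q p = unfold_arc \<alpha>" by auto
qed

text \<open>A pair of arcs does not record which member the folding rule reads, whence the
  alternative in the second claim.\<close>

lemma fold_label:
  assumes j: "j \<in> Bn n" and d: "descent n j q p"
    and fold: "folds_to {label n j q p, half_turn (label n j q p)} \<alpha>"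
  shows "is_type_B_arc n \<alpha>"
    "unfold_arc \<alpha> = label n j q p \<or> unfold_arc \<alpha> = half_turn (label n j q p)"
proof -
  have S: "j \<in> S2n n" using j by (simp add: Bn_iff)
  let ?D = "{label n j q p, half_turn (label n j q p)}"
  have arc: "\<exists>b a. descent n j b a \<and> A = label n j b a" if "A \<in> ?D" for A
    using that d descent_uminus[OF j d] half_turn_label[OF j] by blast
  from fold have "is_type_B_arc n \<alpha> \<and> unfold_arc \<alpha> \<in> ?D"
  proof cases
    case (fold_orbifold A p' L R)
    have AD: "A \<in> ?D" by (simp only: fold_orbifold(1) insertI1)
    have arcA: "is_arc n A" using arc[OF AD] is_arc_label[OF S] by metis
    then have LR: "c \<in> L \<or> c \<in> R \<longleftrightarrow> - p' < c \<and> c < p' \<and> c \<in> pm n" "\<not> (c \<in> L \<and> c \<in> R)" for c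
      unfolding fold_orbifold(3) by auto
    have p': "p' \<in> pm n" using arcA unfolding fold_orbifold(3) by auto
    have sym: "c \<in> R \<longleftrightarrow> - c \<in> L" for c
      using fold_orbifold by (auto simp: mem_uminus_image)
    have "unfold_arc \<alpha> = A"
    proof -
      have "c \<in> L \<inter> {0<..} \<union> uminus ` (R \<inter> {0<..}) \<longleftrightarrow> c \<in> L"
        "c \<in> R \<inter> {0<..} \<union> uminus ` (L \<inter> {0<..}) \<longleftrightarrow> c \<in> R" for c
        using LR(1)[of c] sym[of c] sym[of "- c"] by (auto simp: mem_uminus_image pm_iff)
      then have "L \<inter> {0<..} \<union> uminus ` (R \<inter> {0<..}) = L" "R \<inter> {0<..} \<union> uminus ` (L \<inter> {0<..}) = R"
        by blast+
      then show ?thesis unfolding fold_orbifold(2,3) by simp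
    qed
    moreover have "is_type_B_arc n \<alpha>"
    proof -
      have "c \<in> L \<inter> {0<..} \<union> R \<inter> {0<..} \<longleftrightarrow> 0 < c \<and> c < p'" for c
        using LR(1)[of c] p' by (auto simp: pm_iff)
      then have "L \<inter> {0<..} \<union> R \<inter> {0<..} = {0<..<p'}"
        unfolding set_eq_iff greaterThanLessThan_iff by blast
      moreover have "(L \<inter> {0<..}) \<inter> (R \<inter> {0<..}) = {}" using LR(2) by blast
      ultimately show ?thesis using p' fold_orbifold(4) unfolding fold_orbifold(2) by (simp add: pm_iff)
    qed
    ultimately show ?thesis using AD by simp
  next
    case (fold_ordinary A q' p' L R)
    have AD: "A \<in> ?D" by (simp only: fold_ordinary(1) insertI1)
    have arcA: "is_arc n A" using arc[OF AD] is_arc_label[OF S] by metis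
    then have "L \<union> R = {p'<..<q'} \<inter> pm n" "L \<inter> R = {}" "q' \<in> pm n" using arcA fold_ordinary(3) by auto
    moreover have "{p'<..<q'} \<inter> pm n = {p'<..<q'}"
      using \<open>q' \<in> pm n\<close> \<open>0 < p'\<close> by (auto simp: pm_iff)
    ultimately show ?thesis using fold_ordinary AD by (auto simp: pm_iff)
  next
    case (fold_long A q' p' L R)
    have AD: "A \<in> ?D" by (simp only: fold_long(1) insertI1)
    from arc[OF AD] obtain b a where ba: "descent n j b a" "A = label n j b a" by metis
    then have "b = q'" "a = - p'" using fold_long by (auto simp: label_def)
    with ba have d': "descent n j q' (- p')" and A: "A = label n j q' (- p')" by auto
    note pq' = descent_pm[OF S d']
    have L: "c \<in> L \<longleftrightarrow> c \<in> pm n \<and> - p' < c \<and> c < q' \<and> inv j c < inv j q'"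
      and R: "c \<in> R \<longleftrightarrow> c \<in> pm n \<and> - p' < c \<and> c < q' \<and> inv j (- p') < inv j c" for c
      using A fold_long by (auto simp: label_def)
    have "is_arc n (Arc q' (- p') L R)"
      using is_arc_label[OF S d'] A fold_long(3) by metis
    then have LR: "c \<in> L \<or> c \<in> R \<longleftrightarrow> - p' < c \<and> c < q' \<and> c \<in> pm n" "\<not> (c \<in> L \<and> c \<in> R)" for c
      by auto
    note neg = pos_uminus[OF j]
    have ends: "p' \<in> L \<or> - q' \<in> L"
      using fold_long(7) by blast
    \<comment> \<open>Each alternative in \<open>ends\<close> puts a value before its own negative
      or forces \<open>q'\<close> into a positive position; as positions are odd in the value,
      \<open>- p'\<close> stands in the positive half. So do all points right of the arc, which
      excludes \<open>c\<close> and \<open>- c\<close> together.\<close>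
    have pos: "inv j (- p') > 0"
      using ends pq' neg[of p'] neg[of q'] L[of p'] L[of "- q'"] by linarith
    have disj: "\<not> (c \<in> R \<and> - c \<in> R)" for c
      using pos neg[of c] R[of c] R[of "- c"] by linarith
    have side: "p' \<notin> R" "- q' \<notin> R"
      using ends LR[of p'] LR[of "- q'"] fold_long(4,5) by auto
    have "unfold_arc \<alpha> = A"
    proof -
      have "c \<in> R \<inter> {0<..} \<union> uminus ` (uminus ` R \<inter> {0<..}) \<longleftrightarrow> c \<in> R" for c
        using LR(1)[of c] by (auto simp: mem_uminus_image pm_iff)
      then have eqR: "R \<inter> {0<..} \<union> uminus ` (uminus ` R \<inter> {0<..}) = R" by blast
      have "c \<in> {- p'<..<q'} - {0} - R \<longleftrightarrow> c \<in> L" for c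
        using LR[of c] pq' by (auto simp: pm_iff)
      then have "{- p'<..<q'} - {0} - R = L" by blast
      then show ?thesis unfolding fold_long(2,3) by (simp add: eqR)
    qed
    moreover have "is_type_B_arc n \<alpha>"
    proof -
      have "c < q' \<and> - c < p'" if "c \<in> R" for c
        using that LR(1)[of c] by auto
      then have "uminus ` R \<inter> {0<..} \<subseteq> {0<..<p'}" "R \<inter> {0<..} \<subseteq> {0<..<q'}"
        by auto
      moreover have "(uminus ` R \<inter> {0<..}) \<inter> (R \<inter> {0<..}) = {}"
        using disj mem_uminus_image by blast
      ultimately show ?thesis
        using fold_long(4-6) pq' side unfolding fold_long(2) by (simp add: mem_uminus_image pm_iff)
    qed
    ultimately show ?thesis using AD by simp
  qed
  then show "is_type_B_arc n \<alpha>"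
    "unfold_arc \<alpha> = label n j q p \<or> unfold_arc \<alpha> = half_turn (label n j q p)" by auto
qed

text \<open>The signs of the endpoints select the rule, and where the rule does not fit the arc
  itself it fits the half-turn, which spans the same pair.\<close>

lemma ex_fold_label:
  assumes j: "j \<in> Bn n" and d: "descent n j q p"
  obtains \<alpha> where "folds_to {label n j q p, half_turn (label n j q p)} \<alpha>"
proof -
  have S: "j \<in> S2n n" using j by (simp add: Bn_iff)
  let ?A = "label n j q p"
  obtain L R where A: "?A = Arc q p L R" by (simp add: label_def)
  note pq = descent_pm[OF S d]
  have arc: "is_arc n ?A" by (rule is_arc_label[OF S d])
  have h: "half_turn ?A = Arc (- p) (- q) (uminus ` R) (uminus ` L)" unfolding A by simp
  have swap: "{half_turn ?A, half_turn (half_turn ?A)} = {?A, half_turn ?A}" by auto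
  consider "0 < p" | "q < 0" | "p < 0" "0 < q" "q = - p" | "p < 0" "0 < q" "q \<noteq> - p"
    using pq by (auto simp: pm_iff) linarith
  then show thesis
  proof cases
    case 1
    then show ?thesis using that fold_ordinary[OF A] pq by blast
  next
    case 2
    then have "folds_to {half_turn ?A, half_turn (half_turn ?A)} (Ordinary (- q) (- p) (uminus ` R) (uminus ` L))"
      using pq by (intro fold_ordinary[OF h]) auto
    then show ?thesis using that swap by metis
  next
    case 3
    then have "half_turn ?A = ?A" using half_turn_label[OF j, of q p] by simp
    then show ?thesis using that fold_orbifold[of ?A q L R] A 3 by auto
  next
    case 4
    show ?thesis
    proof (cases "{- p, - q} \<inter> L = {}")
      case False
      then have "folds_to {?A, half_turn ?A} (Long (- p) q (uminus ` R \<inter> {0<..}) (R \<inter> {0<..}))"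
        using 4 A by (intro fold_long) auto
      then show ?thesis by (rule that)
    next
      case True
      \<comment> \<open>One of \<open>- p\<close> and \<open>- q\<close> is at a height between the
        ends. Not being left of the arc, it is right of it, and the half-turn moves its negative to
        the left.\<close>
      have "- p \<in> L \<union> R \<or> - q \<in> L \<union> R"
        using arc 4 pq unfolding A by (cases "- p < q") auto
      then have "{q, - (- p)} \<inter> uminus ` R \<noteq> {}"
        using True by (auto simp: mem_uminus_image)
      then have "folds_to {half_turn ?A, half_turn (half_turn ?A)}
        (Long q (- p) (uminus ` (uminus ` L) \<inter> {0<..}) (uminus ` L \<inter> {0<..}))"
        using 4 h by (intro fold_long) auto
      then show ?thesis using that swap by metis
    qed
  qed
qed

text \<open>Both permutations lie above \<open>arc_perm\<close> of the common label, so their meet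
  still inverts \<open>(q, p)\<close> and, being signed, also \<open>(- p, - q)\<close>. If it were
  strictly below \<open>j\<close>, it would miss some descent of \<open>j\<close>, but there are no
  others.\<close>

lemma sole_descent_unique:
  assumes "sole_descent n j q p" "sole_descent n j' q p" "label n j q p = label n j' q p"
  shows "j = j'"
proof -
  have le: "inversions n j \<subseteq> inversions n j'"
    if j: "sole_descent n j q p" "sole_descent n j' q p" "label n j q p = label n j' q p" for j j'
  proof -
    have B: "j \<in> Bn n" "j' \<in> Bn n" and d: "descent n j q p" "descent n j' q p"
      and sole: "\<And>b a. descent n j b a \<Longrightarrow> (b, a) = (q, p) \<or> (b, a) = (- p, - q)"
      using j(1,2) unfolding sole_descent_def by auto
    have S: "j \<in> S2n n" "j' \<in> S2n n" using B by (simp_all add: Bn_iff)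
    have X: "S2n n = S2n n \<or> S2n n = Bn n" and Y: "Bn n = S2n n \<or> Bn n = Bn n" by simp_all
    let ?A = "label n j q p"
    note a = arc_perm[OF is_arc_label[OF S(1) d(1)]]
    have "arc_inversions ?A \<subseteq> inversions n j" "arc_inversions ?A \<subseteq> inversions n j'"
      using arc_inversions_label[OF S(1) d(1)] arc_inversions_label[OF S(2) d(2)] j(3) by auto
    then have "inversions n (arc_perm n ?A) \<subseteq> inversions n (perm_meet n j j')"
      using a by (intro perm_meet_greatest[OF X S]) auto
    moreover have "(q, p) \<in> arc_inversions ?A"
      using descent_pm[OF S(1) d(1)] by (simp add: label_def)
    ultimately have qp: "(q, p) \<in> inversions n (perm_meet n j j')" using a(2) by blast
    have mB: "perm_meet n j j' \<in> Bn n" by (rule perm_meet(1)[OF Y B])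
    then have qp': "(- p, - q) \<in> inversions n (perm_meet n j j')"
      using qp by (metis Bn_iff mirror_iff minus_minus)
    have "\<not> inversions n (perm_meet n j j') \<subset> inversions n j"
      using ex_descent[OF S(1) perm_meet(1)[OF X S]] sole qp qp' by metis
    then show ?thesis using perm_meet_lower[OF X S] by blast
  qed
  have "inversions n j = inversions n j'"
    using le[of j j'] le[of j' j] assms by auto
  then show ?thesis
    using assms inversions_inj by (metis Bn_iff sole_descent_def)
qed

section \<open>Loose subarcs\<close>

text \<open>Left sets are complements of right sets between the ends, so comparing right sets
  suffices; this halves the case analyses below.\<close>

lemma arc_subarcI:
  assumes A: "is_arc n A" and A': "is_arc n A'"
    and le: "lower_end A \<le> lower_end A'" "upper_end A' \<le> upper_end A"
    and R: "\<And>c. \<lbrakk>lower_end A' < c; c < upper_end A'\<rbrakk> \<Longrightarrow> c \<in> right_pts A' \<longleftrightarrow> c \<in> right_pts A"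
  shows "arc_subarc A' A"
proof -
  obtain q p L S where a: "A = Arc q p L S" by (cases A)
  obtain q' p' L' S' where a': "A' = Arc q' p' L' S'" by (cases A')
  have LS: "c \<in> L \<or> c \<in> S \<longleftrightarrow> p < c \<and> c < q \<and> c \<in> pm n" "\<not> (c \<in> L \<and> c \<in> S)"
    "c \<in> L' \<or> c \<in> S' \<longleftrightarrow> p' < c \<and> c < q' \<and> c \<in> pm n" "\<not> (c \<in> L' \<and> c \<in> S')" for c
    using A A' unfolding a a' by auto
  have "c \<in> S' \<longleftrightarrow> c \<in> S \<and> p' < c \<and> c < q'" "c \<in> L' \<longleftrightarrow> c \<in> L \<and> p' < c \<and> c < q'" for c
    using R[of c] LS[of c] le unfolding a a' by auto
  then have "S' = S \<inter> {p'<..<q'}" "L' = L \<inter> {p'<..<q'}"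
    unfolding set_eq_iff Int_iff greaterThanLessThan_iff by blast+
  then show ?thesis using le unfolding a a' by simp
qed

lemma arc_subarcD:
  assumes "arc_subarc A' A"
  shows "lower_end A \<le> lower_end A'" "upper_end A' \<le> upper_end A"
    and "\<lbrakk>lower_end A' < c; c < upper_end A'\<rbrakk> \<Longrightarrow> c \<in> right_pts A' \<longleftrightarrow> c \<in> right_pts A"
  using assms by (cases A; cases A'; auto)+

lemma half_turn_sel [simp]:
  "upper_end (half_turn A) = - lower_end A" "lower_end (half_turn A) = - upper_end A"
  "right_pts (half_turn A) = uminus ` left_pts A"
  by (cases A; simp)+

lemma type_B_mem:
  "is_type_B_arc n (Ordinary p q L R) \<Longrightarrow> c \<in> L \<longleftrightarrow> p < c \<and> c < q \<and> c \<notin> R"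
  "is_type_B_arc n (Ordinary p q L R) \<Longrightarrow> c \<in> R \<Longrightarrow> p < c \<and> c < q"
  "is_type_B_arc n (Orbifold q L R) \<Longrightarrow> c \<in> L \<longleftrightarrow> 0 < c \<and> c < q \<and> c \<notin> R"
  "is_type_B_arc n (Orbifold q L R) \<Longrightarrow> c \<in> R \<Longrightarrow> 0 < c \<and> c < q"
  "is_type_B_arc n (Long p q L R) \<Longrightarrow> c \<in> L \<Longrightarrow> 0 < c \<and> c < p \<and> c \<notin> R"
  "is_type_B_arc n (Long p q L R) \<Longrightarrow> c \<in> R \<Longrightarrow> 0 < c \<and> c < q"
  by auto

text \<open>Most cases lift directly. A half-turn is needed for ordinary subarcs of the left piece
  of a long arc, because that piece is the turned lower part of the unfolded arc, and for the clause
  with no points between the pieces, where the sides are exchanged.\<close>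

lemma loose_subarc_imp_arc_subarc:
  assumes \<alpha>': "is_type_B_arc n \<alpha>'" and \<alpha>: "is_type_B_arc n \<alpha>" and sub: "loose_subarc \<alpha>' \<alpha>"
  shows "arc_subarc (unfold_arc \<alpha>') (unfold_arc \<alpha>) \<or> arc_subarc (half_turn (unfold_arc \<alpha>')) (unfold_arc \<alpha>)"
proof -
  note A = unfold_arc_properties(1)[OF \<alpha>] and A' = unfold_arc_properties(1)[OF \<alpha>']
  have hA': "is_arc n (half_turn (unfold_arc \<alpha>'))" using A' by simp
  note I = arc_subarcI[OF A A'] and hI = arc_subarcI[OF A hA']
  show ?thesis
  proof (cases \<alpha>)
    case (Ordinary p q L R)
    then obtain p' q' L' R' where a': "\<alpha>' = Ordinary p' q' L' R'" "p \<le> p'" "q' \<le> q" "R' = R \<inter> {p'<..<q'}"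
      using sub by (cases \<alpha>') (auto simp: loose_subarc_def)
    have "arc_subarc (unfold_arc \<alpha>') (unfold_arc \<alpha>)"
      by (rule I) (use a' Ordinary in auto)
    then show ?thesis ..
  next
    case (Orbifold q L R)
    have mem: "c \<in> L \<longleftrightarrow> 0 < c \<and> c < q \<and> c \<notin> R" "c \<in> R \<Longrightarrow> 0 < c \<and> c < q" for c
      using \<alpha> type_B_mem(3,4) unfolding Orbifold by blast+
    have "arc_subarc (unfold_arc \<alpha>') (unfold_arc \<alpha>)"
    proof (cases \<alpha>')
      case a': (Ordinary p' q' L' R')
      have "0 < p'" "q' \<le> q" "p' < q'" "R' = R \<inter> {p'<..<q'}"
        using sub \<alpha>' unfolding a' Orbifold by (auto simp: loose_subarc_def)
      then show ?thesis
        using mem(1) unfolding a' Orbifold by (intro arc_subarcI[OF A A', unfolded a' Orbifold]) (auto simp: mem_uminus_image)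
    next
      case a': (Orbifold q' L' R')
      have *: "q' \<le> q" "R' = R \<inter> {0<..<q'}"
        using sub unfolding a' Orbifold by (auto simp: loose_subarc_def)
      have mem': "c \<in> L' \<longleftrightarrow> 0 < c \<and> c < q' \<and> c \<notin> R'" for c
        using \<alpha>' type_B_mem(3) unfolding a' by blast
      show ?thesis
        by (rule I) (use * mem(1) mem' mem(2) in \<open>auto simp: a' Orbifold mem_uminus_image\<close>)
    next
      case a': (Long p' q' L' R')
      have *: "p' \<le> q" "q' \<le> q" "L' = L \<inter> {0<..<p'}" "R' = R \<inter> {0<..<q'}"
        using sub unfolding a' Orbifold by (auto simp: loose_subarc_def)
      show ?thesis
      proof (rule I)
        show "c \<in> right_pts (unfold_arc \<alpha>') \<longleftrightarrow> c \<in> right_pts (unfold_arc \<alpha>)"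
          if "lower_end (unfold_arc \<alpha>') < c" "c < upper_end (unfold_arc \<alpha>')" for c
          using that mem(1)[of "- c"] mem(2)[of c] * by (auto simp: a' Orbifold mem_uminus_image)
      qed (use * in \<open>auto simp: a' Orbifold\<close>)
    qed
    then show ?thesis ..
  next
    case (Long p q L R)
    have mem: "c \<in> L \<Longrightarrow> 0 < c \<and> c < p \<and> c \<notin> R" "c \<in> R \<Longrightarrow> 0 < c \<and> c < q" for c
      using \<alpha> type_B_mem(5,6) unfolding Long by blast+
    have pq: "0 < p" "0 < q" using \<alpha> unfolding Long by auto
    show ?thesis
    proof (cases \<alpha>')
      case a': (Ordinary p' q' L' R')
      have p': "0 < p'" "p' < q'" using \<alpha>' unfolding a' by auto
      consider "q' \<le> p" "L' = L \<inter> {p'<..<q'}" | "q' \<le> q" "R' = R \<inter> {p'<..<q'}"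
        using sub unfolding a' Long by (auto simp: loose_subarc_def)
      then show ?thesis
      proof cases
        case 1
        have "arc_subarc (half_turn (unfold_arc \<alpha>')) (unfold_arc \<alpha>)"
        proof (rule hI)
          show "c \<in> right_pts (half_turn (unfold_arc \<alpha>')) \<longleftrightarrow> c \<in> right_pts (unfold_arc \<alpha>)"
            if "lower_end (half_turn (unfold_arc \<alpha>')) < c" "c < upper_end (half_turn (unfold_arc \<alpha>'))" for c
            using that mem(2)[of c] 1 p' by (auto simp: a' Long mem_uminus_image)
        qed (use 1 p' pq in \<open>auto simp: a' Long\<close>)
        then show ?thesis ..
      next
        case 2
        have "arc_subarc (unfold_arc \<alpha>') (unfold_arc \<alpha>)"
        proof (rule I)
          show "c \<in> right_pts (unfold_arc \<alpha>') \<longleftrightarrow> c \<in> right_pts (unfold_arc \<alpha>)"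
            if "lower_end (unfold_arc \<alpha>') < c" "c < upper_end (unfold_arc \<alpha>')" for c
            using that mem(1)[of "- c"] 2 p' by (auto simp: a' Long mem_uminus_image)
        qed (use 2 p' pq in \<open>auto simp: a' Long\<close>)
        then show ?thesis ..
      qed
    next
      case a': (Orbifold q' L' R')
      have *: "q' \<le> p" "q' \<le> q" "L' = L \<inter> {0<..<q'}" "R' = R \<inter> {0<..<q'}"
        using sub unfolding a' Long by (auto simp: loose_subarc_def)
      have "arc_subarc (unfold_arc \<alpha>') (unfold_arc \<alpha>)"
      proof (rule I)
        show "c \<in> right_pts (unfold_arc \<alpha>') \<longleftrightarrow> c \<in> right_pts (unfold_arc \<alpha>)"
          if "lower_end (unfold_arc \<alpha>') < c" "c < upper_end (unfold_arc \<alpha>')" for c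
          using that mem(1)[of "- c"] mem(2)[of c] * by (auto simp: a' Long mem_uminus_image)
      qed (use * in \<open>auto simp: a' Long\<close>)
      then show ?thesis ..
    next
      case a': (Long p' q' L' R')
      have p': "0 < p'" "0 < q'" using \<alpha>' unfolding a' by auto
      consider "p' \<le> p" "q' \<le> q" "L' = L \<inter> {0<..<p'}" "R' = R \<inter> {0<..<q'}"
        | "p' \<le> q" "q' \<le> p" "L' = {0<..<p'} - R" "R' = {0<..<q'} - L"
        using sub unfolding a' Long by (auto simp: loose_subarc_def)
      then show ?thesis
      proof cases
        case 1
        have "arc_subarc (unfold_arc \<alpha>') (unfold_arc \<alpha>)"
        proof (rule I)
          show "c \<in> right_pts (unfold_arc \<alpha>') \<longleftrightarrow> c \<in> right_pts (unfold_arc \<alpha>)"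
            if "lower_end (unfold_arc \<alpha>') < c" "c < upper_end (unfold_arc \<alpha>')" for c
            using that mem(1)[of "- c"] mem(2)[of c] 1 by (auto simp: a' Long mem_uminus_image)
        qed (use 1 in \<open>auto simp: a' Long\<close>)
        then show ?thesis ..
      next
        case 2
        have "arc_subarc (half_turn (unfold_arc \<alpha>')) (unfold_arc \<alpha>)"
        proof (rule hI)
          show "c \<in> right_pts (half_turn (unfold_arc \<alpha>')) \<longleftrightarrow> c \<in> right_pts (unfold_arc \<alpha>)"
            if "lower_end (half_turn (unfold_arc \<alpha>')) < c" "c < upper_end (half_turn (unfold_arc \<alpha>'))" for c
            using that mem(1)[of "- c"] mem(2)[of c] 2 p' by (auto simp: a' Long mem_uminus_image)
        qed (use 2 in \<open>auto simp: a' Long\<close>)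
        then show ?thesis ..
      qed
    qed
  qed
qed

text \<open>Loose subarcs of loose subarcs are needed: the relation \<^const>\<open>loose_subarc\<close> itself is not
  transitive.\<close>
lemma arc_subarc_imp_loose_subarc:
  assumes \<alpha>': "is_type_B_arc n \<alpha>'" and \<alpha>: "is_type_B_arc n \<alpha>"
    and sub: "arc_subarc (unfold_arc \<alpha>') (unfold_arc \<alpha>) \<or> arc_subarc (half_turn (unfold_arc \<alpha>')) (unfold_arc \<alpha>)"
  shows "loose_subarc \<alpha>' \<alpha> \<or> (\<exists>\<beta>. is_type_B_arc n \<beta> \<and> loose_subarc \<beta> \<alpha> \<and> loose_subarc \<alpha>' \<beta>)"
proof (cases \<alpha>')
  case a': (Ordinary p' q' L' R')
  have p': "0 < p'" "p' < q'" using \<alpha>' unfolding a' by auto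
  have mem': "c \<in> L' \<longleftrightarrow> p' < c \<and> c < q' \<and> c \<notin> R'" "c \<in> R' \<Longrightarrow> p' < c \<and> c < q'" for c
    using \<alpha>' type_B_mem(1,2) unfolding a' by blast+
  have "subarc \<alpha>' \<alpha>"
  proof (cases \<alpha>)
    case (Ordinary p q L R)
    have p: "0 < p" "p < q" using \<alpha> unfolding Ordinary by auto
    have "\<not> arc_subarc (half_turn (unfold_arc \<alpha>')) (unfold_arc \<alpha>)"
      using p p' unfolding a' Ordinary by auto
    then show ?thesis using sub unfolding a' Ordinary by auto
  next
    case (Orbifold q L R)
    have mem: "c \<in> L \<longleftrightarrow> 0 < c \<and> c < q \<and> c \<notin> R" "c \<in> R \<Longrightarrow> 0 < c \<and> c < q" for c
      using \<alpha> type_B_mem(3,4) unfolding Orbifold by blast+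
    from sub have "q' \<le> q \<and> (\<forall>c. p' < c \<longrightarrow> c < q' \<longrightarrow> (c \<in> R' \<longleftrightarrow> c \<in> R))"
    proof
      assume "arc_subarc (unfold_arc \<alpha>') (unfold_arc \<alpha>)"
      note D = arc_subarcD[OF this]
      have "c \<in> R' \<longleftrightarrow> c \<in> R" if "p' < c" "c < q'" for c
        using D(3)[of c] that p' mem(1)[of "- c"] by (auto simp: a' Orbifold mem_uminus_image)
      then show ?thesis using D(2) by (auto simp: a' Orbifold)
    next
      assume "arc_subarc (half_turn (unfold_arc \<alpha>')) (unfold_arc \<alpha>)"
      note D = arc_subarcD[OF this]
      have q': "q' \<le> q" using D(1) by (auto simp: a' Orbifold)
      have "c \<in> R' \<longleftrightarrow> c \<in> R" if "p' < c" "c < q'" for c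
        using D(3)[of "- c"] that p' q' mem(1)[of c] mem'(1)[of c] mem(2)[of "- c"]
        by (auto simp: a' Orbifold mem_uminus_image)
      then show ?thesis using q' by blast
    qed
    then have "q' \<le> q" "c \<in> R' \<longleftrightarrow> c \<in> R \<and> p' < c \<and> c < q'" for c
      using mem'(2)[of c] by blast+
    moreover from this(2) have "R' = R \<inter> {p'<..<q'}"
      unfolding set_eq_iff by simp
    ultimately show ?thesis unfolding a' Orbifold by simp
  next
    case (Long p q L R)
    have mem: "c \<in> L \<Longrightarrow> 0 < c \<and> c < p \<and> c \<notin> R" "c \<in> R \<Longrightarrow> 0 < c \<and> c < q" for c
      using \<alpha> type_B_mem(5,6) unfolding Long by blast+
    from sub show ?thesis
    proof
      assume "arc_subarc (unfold_arc \<alpha>') (unfold_arc \<alpha>)"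
      note D = arc_subarcD[OF this]
      have "c \<in> R' \<longleftrightarrow> c \<in> R \<and> p' < c \<and> c < q'" for c
        using D(3)[of c] p' mem(1)[of "- c"] mem'(2)[of c] by (auto simp: a' Long mem_uminus_image)
      then have "R' = R \<inter> {p'<..<q'}" unfolding set_eq_iff by auto
      then show ?thesis using D(2) unfolding a' Long by simp
    next
      assume "arc_subarc (half_turn (unfold_arc \<alpha>')) (unfold_arc \<alpha>)"
      note D = arc_subarcD[OF this]
      have "c \<in> L' \<longleftrightarrow> c \<in> L \<and> p' < c \<and> c < q'" for c
        using D(3)[of "- c"] p' mem(2)[of "- c"] mem'(1)[of c] by (auto simp: a' Long mem_uminus_image)
      then have "L' = L \<inter> {p'<..<q'}" unfolding set_eq_iff by auto
      then show ?thesis using D(1) unfolding a' Long by simp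
    qed
  qed
  then show ?thesis by (simp add: loose_subarc_def)
next
  case a': (Orbifold q' L' R')
  have q': "0 < q'" using \<alpha>' unfolding a' by auto
  have mem': "c \<in> L' \<longleftrightarrow> 0 < c \<and> c < q' \<and> c \<notin> R'" "c \<in> R' \<Longrightarrow> 0 < c \<and> c < q'" for c
    using \<alpha>' type_B_mem(3,4) unfolding a' by blast+
  \<comment> \<open>An orbifold arc lifts to a symmetric arc, so the two alternatives
    coincide.\<close>
  have "half_turn (unfold_arc \<alpha>') = unfold_arc \<alpha>'"
    unfolding a' by (auto simp: image_Un image_image)
  with sub have "arc_subarc (unfold_arc \<alpha>') (unfold_arc \<alpha>)" by auto
  note D = arc_subarcD[OF this]
  have "subarc \<alpha>' \<alpha>"
  proof (cases \<alpha>)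
    case (Ordinary p q L R)
    then show ?thesis using D(1) \<alpha> q' unfolding a' Ordinary by auto
  next
    case (Orbifold q L R)
    have mem: "c \<in> L \<longleftrightarrow> 0 < c \<and> c < q \<and> c \<notin> R" "c \<in> R \<Longrightarrow> 0 < c \<and> c < q" for c
      using \<alpha> type_B_mem(3,4) unfolding Orbifold by blast+
    have "c \<in> R' \<longleftrightarrow> c \<in> R \<and> 0 < c \<and> c < q'" for c
      using D(3)[of c] q' mem(1)[of "- c"] mem'(1)[of "- c"] mem'(2)[of c] by (auto simp: a' Orbifold mem_uminus_image)
    then have "R' = R \<inter> {0<..<q'}" unfolding set_eq_iff by auto
    then show ?thesis using D(2) unfolding a' Orbifold by simp
  next
    case (Long p q L R)
    have mem: "c \<in> L \<Longrightarrow> 0 < c \<and> c < p \<and> c \<notin> R" "c \<in> R \<Longrightarrow> 0 < c \<and> c < q" for c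
      using \<alpha> type_B_mem(5,6) unfolding Long by blast+
    have "c \<in> R' \<longleftrightarrow> c \<in> R \<and> 0 < c \<and> c < q'" for c
      using D(3)[of c] q' mem(1)[of "- c"] mem'(1)[of "- c"] mem'(2)[of c] by (auto simp: a' Long mem_uminus_image)
    moreover have "c \<in> L' \<longleftrightarrow> c \<in> L \<and> 0 < c \<and> c < q'" for c
      using D(3)[of "- c"] q' mem(2)[of "- c"] mem'(1)[of c] mem'(2)[of "- c"] by (auto simp: a' Long mem_uminus_image)
    ultimately have "R' = R \<inter> {0<..<q'}" "L' = L \<inter> {0<..<q'}" unfolding set_eq_iff by auto
    then show ?thesis using D(1,2) unfolding a' Long by simp
  qed
  then show ?thesis by (simp add: loose_subarc_def)
next
  case a': (Long p' q' L' R')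
  have p': "0 < p'" "0 < q'" "p' \<noteq> q'" "p' \<notin> R'" "q' \<notin> L'" "p' \<le> int n" "q' \<le> int n" using \<alpha>' unfolding a' by auto
  have mem': "c \<in> L' \<Longrightarrow> 0 < c \<and> c < p' \<and> c \<notin> R'" "c \<in> R' \<Longrightarrow> 0 < c \<and> c < q'" for c
    using \<alpha>' type_B_mem(5,6) unfolding a' by blast+
  show ?thesis
  proof (cases \<alpha>)
    case (Ordinary p q L R)
    then show ?thesis using sub \<alpha> p' unfolding a' Ordinary by auto
  next
    case (Orbifold q L R)
    have mem: "c \<in> L \<longleftrightarrow> 0 < c \<and> c < q \<and> c \<notin> R" "c \<in> R \<Longrightarrow> 0 < c \<and> c < q" for c
      using \<alpha> type_B_mem(3,4) unfolding Orbifold by blast+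
    have "half_turn (unfold_arc \<alpha>) = unfold_arc \<alpha>"
      unfolding Orbifold by (auto simp: image_Un image_image)
    then have "arc_subarc (unfold_arc \<alpha>') (unfold_arc \<alpha>)"
      using sub arc_subarc_half_turn by metis
    note D = arc_subarcD[OF this]
    have "c \<in> R' \<longleftrightarrow> c \<in> R \<and> 0 < c \<and> c < q'" for c
      using D(3)[of c] p' mem(1)[of "- c"] mem'(1)[of "- c"] mem'(2)[of c] by (auto simp: a' Orbifold mem_uminus_image)
    moreover have "c \<in> L' \<longleftrightarrow> c \<in> L \<and> 0 < c \<and> c < p'" for c
      using D(3)[of "- c"] p' mem(2)[of "- c"] mem'(1)[of c] mem'(2)[of "- c"] by (auto simp: a' Orbifold mem_uminus_image)
    ultimately have "R' = R \<inter> {0<..<q'}" "L' = L \<inter> {0<..<p'}" unfolding set_eq_iff by auto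
    then show ?thesis using D(1,2) unfolding a' Orbifold by (simp add: loose_subarc_def)
  next
    case (Long p q L R)
    have pq: "0 < p" "0 < q" "p \<noteq> q" "p \<notin> R" "q \<notin> L" "p \<le> int n" "q \<le> int n" using \<alpha> unfolding Long by auto
    have mem: "c \<in> L \<Longrightarrow> 0 < c \<and> c < p \<and> c \<notin> R" "c \<in> R \<Longrightarrow> 0 < c \<and> c < q" for c
      using \<alpha> type_B_mem(5,6) unfolding Long by blast+
    from sub show ?thesis
    proof
      assume "arc_subarc (unfold_arc \<alpha>') (unfold_arc \<alpha>)"
      note D = arc_subarcD[OF this]
      have le: "p' \<le> p" "q' \<le> q" using D(1,2) unfolding a' Long by auto
      have R: "c \<in> R' \<longleftrightarrow> c \<in> R \<and> 0 < c \<and> c < q'" for c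
        using D(3)[of c] p' mem(1)[of "- c"] mem'(1)[of "- c"] mem'(2)[of c] by (auto simp: a' Long mem_uminus_image)
      have L: "c \<in> L' \<longleftrightarrow> c \<in> L \<and> 0 < c \<and> c < p'" for c
        using D(3)[of "- c"] p' mem(2)[of "- c"] mem'(1)[of c] mem'(2)[of "- c"] by (auto simp: a' Long mem_uminus_image)
      have eq: "R' = R \<inter> {0<..<q'}" "L' = L \<inter> {0<..<p'}" using R L unfolding set_eq_iff by auto
      \<comment> \<open>A subarc must also satisfy \<open>p' \<notin> R\<close> and
        \<open>q' \<notin> L\<close>. As \<open>q'\<close> is not in \<open>L'\<close>, it can be in
        \<open>L\<close> only if \<open>p' < q'\<close>, and symmetrically; so at most one condition
        fails.\<close>
      consider "p' \<notin> R" "q' \<notin> L" | "q' \<in> L" "p' < q'" | "p' \<in> R" "q' < p'"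
        using L[of q'] R[of p'] p' by linarith
      then show ?thesis
      proof cases
        case 1
        then show ?thesis using le eq unfolding a' Long by (simp add: loose_subarc_def)
      next
        case 2
        \<comment> \<open>Cutting the left piece at \<open>p'\<close> first removes it from height
          \<open>q'\<close>; then the right piece can be cut at \<open>q'\<close>.\<close>
        let ?\<beta> = "Long p' q L' R"
        have "p' \<notin> R" using R[of p'] 2 p' by blast
        moreover have "L' \<subseteq> {0<..<p'}" "L' \<inter> R = {}" "R \<subseteq> {0<..<q}" "q \<notin> L'"
          using L mem pq(5) by auto
        ultimately have "is_type_B_arc n ?\<beta>" "subarc ?\<beta> \<alpha>" "subarc \<alpha>' ?\<beta>"
          using p' pq le 2 eq L[of q'] unfolding a' Long by auto
        then show ?thesis unfolding loose_subarc_def by blast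
      next
        case 3
        let ?\<beta> = "Long p q' L R'"
        have "q' \<notin> L" using L[of q'] 3 p' by blast
        moreover have "R' \<subseteq> {0<..<q'}" "L \<inter> R' = {}" "L \<subseteq> {0<..<p}" "p \<notin> R'"
          using R mem pq(4) by auto
        ultimately have "is_type_B_arc n ?\<beta>" "subarc ?\<beta> \<alpha>" "subarc \<alpha>' ?\<beta>"
          using p' pq le 3 eq R[of p'] unfolding a' Long by auto
        then show ?thesis unfolding loose_subarc_def by blast
      qed
    next
      assume "arc_subarc (half_turn (unfold_arc \<alpha>')) (unfold_arc \<alpha>)"
      note D = arc_subarcD[OF this]
      have le: "p' \<le> q" "q' \<le> p" using D(1,2) unfolding a' Long by auto
      \<comment> \<open>The half-turn exchanges sides, so below \<open>p'\<close> the points of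
        \<open>R\<close> are those missing from \<open>L'\<close>, and likewise for \<open>L\<close>
        and \<open>R'\<close>. As \<open>L\<close> and \<open>R\<close> are disjoint, no point
        remains between the pieces.\<close>
      have L: "c \<in> L' \<longleftrightarrow> 0 < c \<and> c < p' \<and> c \<notin> R" for c
        using D(3)[of c] p' mem(1)[of "- c"] mem(2)[of c] mem'(1)[of c] mem'(2)[of "- c"]
        by (auto simp: a' Long mem_uminus_image)
      have R: "c \<in> R' \<longleftrightarrow> 0 < c \<and> c < q' \<and> c \<notin> L" for c
        using D(3)[of "- c"] p' mem(1)[of c] mem(2)[of "- c"] mem'(1)[of "- c"] mem'(2)[of c]
        by (auto simp: a' Long mem_uminus_image)
      have "L' = {0<..<p'} - R" "R' = {0<..<q'} - L" "{0<..<min p' q'} \<subseteq> L' \<union> R'"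
        using L R mem(1) by auto
      then show ?thesis using le unfolding a' Long loose_subarc_def by blast
    qed
  qed
qed

section \<open>Restrictions to signed permutations\<close>

text \<open>Conjugation by the longest element is an automorphism fixing all signed permutations, so a
  congruence may be intersected with its conjugate.\<close>
lemma ex_symmetric_congruence:
  assumes \<Phi>: "lattice_congruence (weak_S2n n) \<Phi>"
  obtains \<Psi> where "symmetric_congruence n \<Psi>" "restriction \<Psi> (Bn n) = restriction \<Phi> (Bn n)"
proof
  have X: "S2n n = S2n n \<or> S2n n = Bn n" by simp
  note E = congruence_equiv[OF \<Phi>]
  define \<Psi> where "\<Psi> = {(x, y). (x, y) \<in> \<Phi> \<and> (conjugate n x, conjugate n y) \<in> \<Phi>}"
  have S: "x \<in> S2n n \<and> y \<in> S2n n" if "(x, y) \<in> \<Phi>" for x y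
    using that E by (simp add: equiv_class_eq_iff)
  have conj_meet: "conjugate n (perm_meet n x y) = perm_meet n (conjugate n x) (conjugate n y)"
    if "x \<in> S2n n" "y \<in> S2n n" for x y
    using that perm_meet[OF X that] perm_meet[OF X conjugate_S2n[OF that(1)] conjugate_S2n[OF that(2)]]
    by (intro inversions_inj[of _ n])
      (simp_all add: conjugate_S2n inversions_conjugate mirror_Diff mirror_trancl mirror_Un)
  have conj_join: "conjugate n (perm_join n x y) = perm_join n (conjugate n x) (conjugate n y)"
    if "x \<in> S2n n" "y \<in> S2n n" for x y
    using that perm_join[OF X that] perm_join[OF X conjugate_S2n[OF that(1)] conjugate_S2n[OF that(2)]]
    by (intro inversions_inj[of _ n])
      (simp_all add: conjugate_S2n inversions_conjugate mirror_trancl mirror_Un)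
  have "equiv (S2n n) \<Psi>"
  proof (rule equivI)
    show "\<Psi> \<subseteq> S2n n \<times> S2n n" using S by (auto simp: \<Psi>_def)
    show "refl_on (S2n n) \<Psi>"
      using congruence_refl[OF \<Phi>] conjugate_S2n by (auto simp: \<Psi>_def refl_on_def)
    show "sym \<Psi>" using congruence_sym[OF \<Phi>] by (auto simp: \<Psi>_def sym_def)
    show "trans \<Psi>" using congruence_trans[OF \<Phi>] unfolding \<Psi>_def trans_def by blast
  qed
  moreover have "(perm_meet n x y, perm_meet n x' y') \<in> \<Psi>" "(perm_join n x y, perm_join n x' y') \<in> \<Psi>"
    if "(x, x') \<in> \<Psi>" "(y, y') \<in> \<Psi>" for x x' y y'
    using that S congruence_meet[OF \<Phi>] congruence_join[OF \<Phi>] by (auto simp: \<Psi>_def conj_meet conj_join)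
  ultimately have "lattice_congruence (weak_S2n n) \<Psi>"
    unfolding lattice_congruence_weak_order[OF X] by blast
  moreover have "(x, y) \<in> \<Psi> \<longleftrightarrow> (conjugate n x, conjugate n y) \<in> \<Psi>"
    if "x \<in> S2n n" "y \<in> S2n n" for x y
    using that by (auto simp: \<Psi>_def conjugate_conjugate)
  ultimately show "symmetric_congruence n \<Psi>"
    by (simp add: symmetric_congruence_def conjugate_def)
  show "restriction \<Psi> (Bn n) = restriction \<Phi> (Bn n)"
    using conjugate_Bn by (auto simp: restriction_def \<Psi>_def)
qed

lemma contracts_restriction:
  assumes \<Phi>: "lattice_congruence (weak_S2n n) \<Phi>" and j: "sole_descent n j q p"
  shows "contracts (weak_Bn n) (restriction \<Phi> (Bn n)) j \<longleftrightarrow>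
    contracts_arc n \<Phi> (label n j q p) \<and> contracts_arc n \<Phi> (half_turn (label n j q p))"
proof -
  have "j \<in> Bn n" "descent n j q p" using j by (simp_all add: sole_descent_def)
  then show ?thesis
    using contracts_weak_Bn[OF j] contracts_reduce[OF \<Phi>] reduce(1) by (simp add: restriction_def)
qed

lemma sole_descent_uminus:
  assumes "sole_descent n j q p"
  shows "sole_descent n j (- p) (- q)"
  using assms descent_uminus[of j n q p] unfolding sole_descent_def by auto

lemma sole_descent_arc:
  assumes "is_type_B_arc n \<alpha>"
  obtains j q p where "sole_descent n j q p" "label n j q p = unfold_arc \<alpha>" "folds_to (delta n j) \<alpha>"
proof -
  obtain x q p where x: "x \<in> Bn n" "descent n x q p" "label n x q p = unfold_arc \<alpha>"
    using unfold_arc_properties(3)[OF assms] by blast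
  obtain j where j: "sole_descent n j q p" "label n j q p = label n x q p"
    using ex_sole_descent[OF x(1,2)] .
  then show thesis
    using that[OF j(1)] x(3) unfold_arc_properties(2)[OF assms] delta_sole_descent[OF j(1)] by simp
qed

lemma fold_sole_descent:
  assumes j: "sole_descent n j q p" and fold: "folds_to (delta n j) \<alpha>"
  shows "is_type_B_arc n \<alpha>" "unfold_arc \<alpha> = label n j q p \<or> unfold_arc \<alpha> = half_turn (label n j q p)"
  using fold_label[of j n q p \<alpha>] assms delta_sole_descent[OF j] by (simp_all add: sole_descent_def)

lemma is_arc_sole_descent: "sole_descent n j q p \<Longrightarrow> is_arc n (label n j q p)"
  using is_arc_label Bn_subset_S2n unfolding sole_descent_def by blast

text \<open>By symmetry, contraction of a join-irreducible is contraction of the unfolded arc. A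
  loose subarc lifts to a subarc up to a half-turn, and \<open>contracts_arc_mono\<close> is applied
  in contraposed form.\<close>

lemma closed_uncontracted_arcs:
  assumes \<Phi>: "symmetric_congruence n \<Phi>"
  shows "closed_under_loose_subarcs n (uncontracted_arcs n (restriction \<Phi> (Bn n)))"
  unfolding closed_under_loose_subarcs_def
proof (intro ballI allI impI)
  fix \<alpha> \<alpha>'
  assume "\<alpha> \<in> uncontracted_arcs n (restriction \<Phi> (Bn n))"
    and \<alpha>': "is_type_B_arc n \<alpha>'" and sub: "loose_subarc \<alpha>' \<alpha>"
  have \<Phi>': "lattice_congruence (weak_S2n n) \<Phi>" using \<Phi> by (simp add: symmetric_congruence_def)
  obtain j q p where j: "sole_descent n j q p" "\<not> contracts (weak_Bn n) (restriction \<Phi> (Bn n)) j"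
    "folds_to (delta n j) \<alpha>"
    using \<open>\<alpha> \<in> _\<close> unfolding uncontracted_arcs_def join_irreducible_weak_Bn by blast
  note \<alpha> = fold_sole_descent[OF j(1,3)]
  note half = contracts_arc_half_turn[OF \<Phi>]
  note arc = is_arc_sole_descent[OF j(1)]
  have "\<not> contracts_arc n \<Phi> (label n j q p)"
    using j(2) contracts_restriction[OF \<Phi>' j(1)] half[OF arc] by simp
  then have n\<alpha>: "\<not> contracts_arc n \<Phi> (unfold_arc \<alpha>)"
    using \<alpha>(2) half[OF arc] by auto
  note A = unfold_arc_properties(1)[OF \<alpha>(1)] and A' = unfold_arc_properties(1)[OF \<alpha>']
  have n\<alpha>': "\<not> contracts_arc n \<Phi> (unfold_arc \<alpha>')"
    using loose_subarc_imp_arc_subarc[OF \<alpha>' \<alpha>(1) sub]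
  proof
    assume "arc_subarc (unfold_arc \<alpha>') (unfold_arc \<alpha>)"
    then show ?thesis using contracts_arc_mono[OF \<Phi>' A A'] n\<alpha> by blast
  next
    assume "arc_subarc (half_turn (unfold_arc \<alpha>')) (unfold_arc \<alpha>)"
    moreover have "is_arc n (half_turn (unfold_arc \<alpha>'))" using A' by simp
    ultimately show ?thesis
      using contracts_arc_mono[OF \<Phi>' A] half[OF A'] n\<alpha> by blast
  qed
  obtain j' q' p' where j': "sole_descent n j' q' p'" "label n j' q' p' = unfold_arc \<alpha>'"
    "folds_to (delta n j') \<alpha>'"
    using sole_descent_arc[OF \<alpha>'] .
  have "\<not> contracts (weak_Bn n) (restriction \<Phi> (Bn n)) j'"
    using contracts_restriction[OF \<Phi>' j'(1)] n\<alpha>' j'(2) by simp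
  then show "\<alpha>' \<in> uncontracted_arcs n (restriction \<Phi> (Bn n))"
    using j' unfolding uncontracted_arcs_def join_irreducible_weak_Bn by blast
qed

text \<open>Closing under subarcs makes \<open>U\<close> define a congruence, and the two names of
  each join-irreducible make \<open>U\<close> closed under half-turns. What remains is that
  \<open>U\<close> contains no arc of a contracted join-irreducible.\<close>

lemma restriction_of_symmetric:
  assumes \<Theta>: "lattice_congruence (weak_Bn n) \<Theta>"
    and closed: "closed_under_loose_subarcs n (uncontracted_arcs n \<Theta>)"
  obtains \<Phi> where "symmetric_congruence n \<Phi>" "\<Theta> = restriction \<Phi> (Bn n)"
proof -
  define U where "U = {B. is_arc n B \<and> (\<exists>j q p. sole_descent n j q p \<and>
    \<not> contracts (weak_Bn n) \<Theta> j \<and> arc_subarc B (label n j q p))}"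
  have arcs: "is_arc n A" if "A \<in> U" for A
    using that by (simp add: U_def)
  have sub: "B \<in> U" if "A \<in> U" "is_arc n B" "arc_subarc B A" for A B
    using that arc_subarc_trans unfolding U_def by blast
  have half: "half_turn A \<in> U" if A: "A \<in> U" for A
  proof -
    obtain j q p where j: "sole_descent n j q p" "\<not> contracts (weak_Bn n) \<Theta> j"
      "arc_subarc A (label n j q p)" "is_arc n A"
      using A unfolding U_def by blast
    have "half_turn (label n j q p) = label n j (- p) (- q)"
      using half_turn_label j(1) by (simp add: sole_descent_def)
    then have "arc_subarc (half_turn A) (label n j (- p) (- q))"
      using j(3) arc_subarc_half_turn by metis
    then show ?thesis
      using sole_descent_uminus[OF j(1)] j(2,4) unfolding U_def by auto
  qed
  define \<Phi> where "\<Phi> = arc_congruence n U"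
  have sym: "symmetric_congruence n \<Phi>"
    unfolding \<Phi>_def using arcs sub half by (rule symmetric_arc_congruence)
  then have \<Phi>: "lattice_congruence (weak_S2n n) \<Phi>" by (simp add: symmetric_congruence_def)
  \<comment> \<open>The decisive use of loose subarcs: a label that entered \<open>U\<close> only as
    a subarc folds to an arc reached from an uncontracted one in at most two loose steps.\<close>
  have mem: "label n j q p \<in> U \<longleftrightarrow> \<not> contracts (weak_Bn n) \<Theta> j" if j: "sole_descent n j q p" for j q p
  proof
    assume "\<not> contracts (weak_Bn n) \<Theta> j"
    then show "label n j q p \<in> U"
      using j is_arc_sole_descent[OF j] arc_subarc_refl unfolding U_def by blast
  next
    assume "label n j q p \<in> U"
    then obtain i b a where i: "sole_descent n i b a" "\<not> contracts (weak_Bn n) \<Theta> i"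
      "arc_subarc (label n j q p) (label n i b a)"
      unfolding U_def by blast
    obtain \<alpha>' where \<alpha>': "folds_to (delta n j) \<alpha>'"
      using ex_fold_label[of j n q p] j delta_sole_descent[OF j] unfolding sole_descent_def by metis
    obtain \<alpha> where \<alpha>: "folds_to (delta n i) \<alpha>"
      using ex_fold_label[of i n b a] i(1) delta_sole_descent[OF i(1)] unfolding sole_descent_def by metis
    note f' = fold_sole_descent[OF j \<alpha>'] and f = fold_sole_descent[OF i(1) \<alpha>]
    have "arc_subarc (half_turn (label n j q p)) (half_turn (label n i b a))"
      using i(3) by simp
    then have "arc_subarc (unfold_arc \<alpha>') (unfold_arc \<alpha>) \<or> arc_subarc (half_turn (unfold_arc \<alpha>')) (unfold_arc \<alpha>)"
      using i(3) f(2) f'(2) by (metis half_turn_half_turn)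
    then have loose: "loose_subarc \<alpha>' \<alpha> \<or> (\<exists>\<beta>. is_type_B_arc n \<beta> \<and> loose_subarc \<beta> \<alpha> \<and> loose_subarc \<alpha>' \<beta>)"
      by (rule arc_subarc_imp_loose_subarc[OF f'(1) f(1)])
    have "\<alpha> \<in> uncontracted_arcs n \<Theta>"
      using i \<alpha> unfolding uncontracted_arcs_def join_irreducible_weak_Bn by blast
    then have "\<alpha>' \<in> uncontracted_arcs n \<Theta>"
      using loose closed f'(1) unfolding closed_under_loose_subarcs_def by metis
    then obtain k d c where k: "sole_descent n k d c" "\<not> contracts (weak_Bn n) \<Theta> k" "folds_to (delta n k) \<alpha>'"
      unfolding uncontracted_arcs_def join_irreducible_weak_Bn by blast
    \<comment> \<open>The witness \<open>k\<close> for \<open>\<alpha>'\<close> is a priori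
      unrelated to \<open>j\<close>; both fold to the same arc, so their labels agree up to a
      half-turn, and \<open>sole_descent_unique\<close> identifies them.\<close>
    have "label n k d c = label n j q p \<or> half_turn (label n k d c) = label n j q p"
      using fold_sole_descent(2)[OF k(1,3)] f'(2) by (metis half_turn_half_turn)
    moreover have "half_turn (label n k d c) = label n k (- c) (- d)"
      using half_turn_label k(1) by (simp add: sole_descent_def)
    ultimately obtain d' c' where k': "sole_descent n k d' c'" "label n k d' c' = label n j q p"
      using k(1) sole_descent_uminus[OF k(1)] by metis
    have "d' = q" "c' = p" using k'(2) label_ends by metis+
    then have "k = j" using sole_descent_unique[of n k q p j] k' j by simp
    then show "\<not> contracts (weak_Bn n) \<Theta> j" using k(2) by simp
  qed
  have same: "contracts (weak_Bn n) (restriction \<Phi> (Bn n)) j \<longleftrightarrow> contracts (weak_Bn n) \<Theta> j"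
    if irr: "join_irreducible (weak_Bn n) j" for j
  proof -
    obtain q p where j: "sole_descent n j q p"
      using irr unfolding join_irreducible_weak_Bn by blast
    have S: "j \<in> S2n n" and d: "descent n j q p"
      using j by (auto simp: sole_descent_def Bn_iff)
    have con: "contracts_arc n \<Phi> (label n j q p) \<longleftrightarrow> label n j q p \<notin> U"
      unfolding \<Phi>_def using arcs sub S d by (rule contracts_arc_congruence)
    show ?thesis
      using contracts_restriction[OF \<Phi> j] contracts_arc_half_turn[OF sym is_arc_sole_descent[OF j]]
        con mem[OF j] by simp
  qed
  have "\<Theta> = restriction \<Phi> (Bn n)"
  proof
    show "\<Theta> \<subseteq> restriction \<Phi> (Bn n)"
      using same by (intro congruence_subset[OF \<Theta> lattice_congruence_restriction[OF \<Phi>]]) auto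
    show "restriction \<Phi> (Bn n) \<subseteq> \<Theta>"
      using same by (intro congruence_subset[OF lattice_congruence_restriction[OF \<Phi>] \<Theta>]) auto
  qed
  with sym show thesis by (rule that)
qed

theorem theorem6p10:
  fixes n :: nat and \<Theta> :: "(int \<Rightarrow> int) rel"
  assumes "lattice_congruence (weak_Bn n) \<Theta>"
  shows "((\<exists>\<Phi>. lattice_congruence (weak_S2n n) \<Phi> \<and> \<Theta> = restriction \<Phi> (Bn n)) \<longleftrightarrow>
          (\<exists>\<Phi>. symmetric_congruence n \<Phi> \<and> \<Theta> = restriction \<Phi> (Bn n))) \<and>
         ((\<exists>\<Phi>. symmetric_congruence n \<Phi> \<and> \<Theta> = restriction \<Phi> (Bn n)) \<longleftrightarrow>
          closed_under_loose_subarcs n (uncontracted_arcs n \<Theta>))"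
proof (intro conjI iffI)
  assume "\<exists>\<Phi>. lattice_congruence (weak_S2n n) \<Phi> \<and> \<Theta> = restriction \<Phi> (Bn n)"
  then show "\<exists>\<Phi>. symmetric_congruence n \<Phi> \<and> \<Theta> = restriction \<Phi> (Bn n)"
    using ex_symmetric_congruence by metis
next
  assume "\<exists>\<Phi>. symmetric_congruence n \<Phi> \<and> \<Theta> = restriction \<Phi> (Bn n)"
  then show "\<exists>\<Phi>. lattice_congruence (weak_S2n n) \<Phi> \<and> \<Theta> = restriction \<Phi> (Bn n)"
    unfolding symmetric_congruence_def by blast
next
  assume "\<exists>\<Phi>. symmetric_congruence n \<Phi> \<and> \<Theta> = restriction \<Phi> (Bn n)"
  then show "closed_under_loose_subarcs n (uncontracted_arcs n \<Theta>)"
    using closed_uncontracted_arcs by blast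
next
  assume "closed_under_loose_subarcs n (uncontracted_arcs n \<Theta>)"
  then show "\<exists>\<Phi>. symmetric_congruence n \<Phi> \<and> \<Theta> = restriction \<Phi> (Bn n)"
    using restriction_of_symmetric[OF assms] by metis
qed

end
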